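(* Let $\theta<0$, $\xi\in(0,1)$ and $y\in\mathbb{R}$. Put $\gamma=\frac{1-\xi}{\xi}$, $u=-\sqrt{\xi(1-\xi)}$, $\lambda=\frac{-u}{\arctan_{-\theta}(\gamma^{-1/2})}$ and $z_0=\frac1\lambda$. Then, as $n\to\infty$, $$p_n^{\xi,y}(\theta)\sim c(\theta,\lambda,\xi)\,h(y)\,\lambda^{n+1},$$ where $$h(y)=\begin{cases}\cos_{-\theta}(uz_0,-y), & y>0,\\ -\gamma^{1/2}\sin_{-\theta}(uz_0,y), & y\le0,\end{cases}$$ and, with $g(z)=\cos_{-\theta}(uz)+\gamma^{1/2}\sin_{-\theta}(uz)$, $$c(\theta,\lambda,\xi)=\lim_{z\to z_0}(z_0-z)\,\frac{\cos_{-\theta}(uz)-\gamma^{-1/2}\sin_{-\theta}(uz)}{g(z)}=-\frac{\cos_{-\theta}(uz_0)-\gamma^{-1/2}\sin_{-\theta}(uz_0)}{g'(z_0)}.$$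
   Context: For $\xi\in[0,1]$ let $\phi_\xi(x)=\xi e^{x}$ for $x<0$ and $\phi_\xi(x)=(1-\xi)e^{-x}$ for $x>0$, and let $(X_i)_{i\ge0}$ be i.i.d. with density $\phi_\xi$. For $y\in\mathbb{R}$ put $p_0^{\xi,y}(\theta)=1$ and $p_n^{\xi,y}(\theta)=\mathbb{P}(X_2>\theta y,X_3>\theta X_2,\dots,X_{n+1}>\theta X_n)$ for $n\ge1$. $a_n\sim b_n$ means $a_n/b_n\to1$. $q$-notation. For $q>0$, $q\ne1$: $[k]_q=\frac{1-q^k}{1-q}$, $[n]_q!=\prod_{k=1}^n[k]_q$, and $[n]_1!=n!$. Define $e_q(z)=\sum_{n\ge0}\frac{z^n}{[n]_q!}$, $\cos_q(z)=\sum_{n\ge0}\frac{(-1)^nz^{2n}}{[2n]_q!}$, $\sin_q(z)=\sum_{n\ge0}\frac{(-1)^nz^{2n+1}}{[2n+1]_q!}$. For $q\ge1$ these are entire. For $0<q<1$ the series converge for $|z|<1/(1-q)$, and the same symbols denote the meromorphic continuations to $\mathbb{C}$, given by $e_q(z)=\prod_{n\ge0}\frac{1}{1-z(1-q)q^n}$, $\cos_q(z)=\frac{e_q(iz)+e_q(-iz)}{2}$, $\sin_q(z)=\frac{e_q(iz)-e_q(-iz)}{2i}$. Two-variable functions. For $0<q<1$ and $y\in\mathbb{R}$, or $q>1$ and $y\le0$: $\sin_q(z,y)=\sum_{j\ge0}\frac{(-1)^jz^{2j+1}}{[2j+1]_q!}e^{q\frac{1-q^{2j+1}}{1-q}y}$,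 $\cos_q(z,y)=\sum_{j\ge0}\frac{(-1)^jz^{2j}}{[2j]_q!}e^{q\frac{1-q^{2j}}{1-q}y}$, and $\sin_1(z,y)=\sin(ze^y)$, $\cos_1(z,y)=\cos(ze^y)$. For $0<q<1$ the symbols again denote the meromorphic continuations in $z$, given by $\sin_q(z,y)=e^{\frac{qy}{1-q}}\sum_{m\ge0}\frac{(-\frac{qy}{1-q})^m}{m!}\sin_q(q^mz)$ and the same formula with $\cos$ in place of $\sin$. For $q>0$, $z_c(q)$ is the smallest positive real zero of $\cos_q$; the function $\tan_q=\sin_q/\cos_q:[0,z_c(q))\to[0,\infty)$ is a strictly increasing bijection, and $\arctan_q$ denotes its inverse. *)

theory Defs
  imports "HOL-Probability.Probability"
begin

section \<open>The persistence probabilities\<close>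

text \<open>The value at the null set \<open>x = 0\<close> is irrelevant; it is set to \<open>0\<close>.\<close>

definition phi :: "real \<Rightarrow> real \<Rightarrow> real" where
  "phi \<xi> x = (if x < 0 then \<xi> * exp x else if x > 0 then (1 - \<xi>) * exp (- x) else 0)"

definition iid_phi :: "'a measure \<Rightarrow> (nat \<Rightarrow> 'a \<Rightarrow> real) \<Rightarrow> real \<Rightarrow> bool" where
  "iid_phi M X \<xi> \<longleftrightarrow>
     prob_space M \<and>
     prob_space.indep_vars M (\<lambda>_. borel) X UNIV \<and>
     (\<forall>i. distributed M lborel (X i) (\<lambda>x. ennreal (phi \<xi> x)))"

definition persist :: "'a measure \<Rightarrow> (nat \<Rightarrow> 'a \<Rightarrow> real) \<Rightarrow> real \<Rightarrow> real \<Rightarrow> nat \<Rightarrow> real" where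
  "persist M X \<theta> y n =
     (if n = 0 then 1
      else measure M {\<omega> \<in> space M. X 2 \<omega> > \<theta> * y \<and> (\<forall>k\<in>{2..n}. X (k + 1) \<omega> > \<theta> * X k \<omega>)})"


section \<open>q-trigonometric functions of one variable\<close>

definition qbracket :: "real \<Rightarrow> nat \<Rightarrow> real" where
  "qbracket q k = (1 - q ^ k) / (1 - q)"

definition qfact :: "real \<Rightarrow> nat \<Rightarrow> real" where
  "qfact q n = (if q = 1 then fact n else (\<Prod>k=1..n. qbracket q k))"

text \<open>
  For \<open>q < 1\<close> the power series converge only for \<open>norm z < 1 / (1 - q)\<close>; the functions below are
  then the meromorphic continuations. The values at the poles of \<open>qexp q\<close> (which are real,
  so that \<open>qcos q\<close> and \<open>qsin q\<close> have no pole on the real axis) are meaningless.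
\<close>

definition qexp :: "real \<Rightarrow> complex \<Rightarrow> complex" where
  "qexp q z =
     (if q < 1 then (\<Prod>n. 1 / (1 - z * of_real ((1 - q) * q ^ n)))
      else (\<Sum>n. z ^ n / of_real (qfact q n)))"

definition qcos :: "real \<Rightarrow> complex \<Rightarrow> complex" where
  "qcos q z =
     (if q < 1 then (qexp q (\<i> * z) + qexp q (- (\<i> * z))) / 2
      else (\<Sum>n. (-1) ^ n * z ^ (2 * n) / of_real (qfact q (2 * n))))"

definition qsin :: "real \<Rightarrow> complex \<Rightarrow> complex" where
  "qsin q z =
     (if q < 1 then (qexp q (\<i> * z) - qexp q (- (\<i> * z))) / (2 * \<i>)
      else (\<Sum>n. (-1) ^ n * z ^ (2 * n + 1) / of_real (qfact q (2 * n + 1))))"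

definition qtan :: "real \<Rightarrow> complex \<Rightarrow> complex" where
  "qtan q z = qsin q z / qcos q z"

definition zc :: "real \<Rightarrow> real" where
  "zc q = (LEAST x. 0 < x \<and> qcos q (of_real x) = 0)"

definition qarctan :: "real \<Rightarrow> real \<Rightarrow> real" where
  "qarctan q t = the_inv_into {0..<zc q} (\<lambda>x. qtan q (of_real x)) (of_real t)"


section \<open>q-trigonometric functions of two variables\<close>

text \<open>
  For \<open>q < 1\<close> these are the continuations in \<open>z\<close> of the series used for \<open>q > 1\<close>.
  For \<open>q > 1\<close> they are meant only for \<open>y \<le> 0\<close>.
\<close>

definition qcos2 :: "real \<Rightarrow> complex \<Rightarrow> real \<Rightarrow> complex" where
  "qcos2 q z y =
     (if q < 1 then
        of_real (exp (q * y / (1 - q))) *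
        (\<Sum>m. of_real ((- (q * y / (1 - q))) ^ m / fact m) * qcos q (of_real (q ^ m) * z))
      else if q = 1 then cos (z * of_real (exp y))
      else (\<Sum>j. (-1) ^ j * z ^ (2 * j) / of_real (qfact q (2 * j))
                * of_real (exp (q * ((1 - q ^ (2 * j)) / (1 - q)) * y))))"

definition qsin2 :: "real \<Rightarrow> complex \<Rightarrow> real \<Rightarrow> complex" where
  "qsin2 q z y =
     (if q < 1 then
        of_real (exp (q * y / (1 - q))) *
        (\<Sum>m. of_real ((- (q * y / (1 - q))) ^ m / fact m) * qsin q (of_real (q ^ m) * z))
      else if q = 1 then sin (z * of_real (exp y))
      else (\<Sum>j. (-1) ^ j * z ^ (2 * j + 1) / of_real (qfact q (2 * j + 1))
                * of_real (exp (q * ((1 - q ^ (2 * j + 1)) / (1 - q)) * y))))"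

end

theory Submission
  imports Defs "HOL-Complex_Analysis.Complex_Analysis"
begin

text \<open>
  Put \<open>q = - \<theta>\<close>. Conditioning on the first variable gives an integral recursion for the persistence
  probabilities; writing \<open>A n\<close>, \<open>B n\<close> for their restrictions to \<open>y \<le> 0\<close> and \<open>y > 0\<close>, as functions of
  \<open>\<bar>y\<bar>\<close>, the combination \<open>B n + \<i> \<kappa> A n\<close> with \<open>\<kappa> = \<gamma> powr (- 1/2)\<close> diagonalises it, so that its
  generating function in \<open>n\<close> is a two-variable \<open>q\<close>-exponential times \<open>\<beta> z + \<i> \<kappa>\<close>. Continuity at
  \<open>y = 0\<close> forces \<open>\<beta> = N / g\<close>.

  It remains to see that \<open>z0\<close> is the only zero of \<open>g\<close> in the closed disc of radius \<open>z0\<close>, and that it is simple.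
  For \<open>q \<ge> 1\<close> the \<open>q\<close>-exponential is entire, and for \<open>q < 1\<close> it is \<open>1 / E (- z)\<close> where \<open>E\<close> is the entire
  \<open>q\<close>-exponential of base \<open>1 / q\<close>. In both cases the entire function is a product of factors \<open>1 + b * z\<close>
  with \<open>b > 0\<close> (or \<open>exp\<close>), hence of Hermite--Biehler type: all zeros of \<open>g\<close> are real, and on the real axis
  \<open>g\<close> is a positive function times the sine of an explicit increasing phase \<open>\<Theta>\<close>, with
  \<open>tan\<^sub>q = tan \<circ> \<Theta>\<close>.

  The asymptotics for fixed \<open>y\<close> follow by Tannery's theorem. For \<open>q < 1\<close> the power series in \<open>z\<close> may diverge at
  \<open>z0\<close>; there one expands \<open>exp (- (q [k]\<^sub>q y))\<close> in powers of \<open>q ^ k\<close> instead and controls the resulting moments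
  by a two-term recursion. The limits are nonzero since \<open>p\<^sub>n\<^sub>+\<^sub>1 y\<close> is at least a positive multiple of \<open>p\<^sub>n 0\<close>.
\<close>

section \<open>The integral recursion\<close>

text \<open>Values in \<open>ennreal\<close> let Tonelli apply with measurability alone; the closed
  form found later is nonnegative, which brings back real numbers.\<close>

primrec persist_rec :: "real \<Rightarrow> real \<Rightarrow> nat \<Rightarrow> real \<Rightarrow> ennreal" where
  "persist_rec \<theta> \<xi> 0 y = 1"
| "persist_rec \<theta> \<xi> (Suc n) y =
     (\<integral>\<^sup>+x. ennreal (phi \<xi> x) * (indicator {\<theta> * y<..} x * persist_rec \<theta> \<xi> n x) \<partial>lborel)"

text \<open>The persistence event on an arbitrary index block, with \<open>y\<close> as predecessor
  of the first coordinate. Both \<open>k\<close> and \<open>y\<close> are free so that splitting off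
  the first coordinate leaves an event of the same form.\<close>

definition chain :: "real \<Rightarrow> nat \<Rightarrow> nat \<Rightarrow> real \<Rightarrow> (nat \<Rightarrow> real) \<Rightarrow> bool" where
  "chain \<theta> k n y x \<longleftrightarrow> (\<forall>j\<in>{k..<k + n}. \<theta> * (if j = k then y else x (j - 1)) < x j)"

lemma chain_Suc:
  "chain \<theta> k (Suc n) y (w(k := x)) \<longleftrightarrow> \<theta> * y < x \<and> chain \<theta> (Suc k) n x w"
proof -
  have *: "{k..<k + Suc n} = insert k {Suc k..<Suc k + n}" by auto
  have "(\<forall>j\<in>{Suc k..<Suc k + n}. \<theta> * (if j = k then y else (w(k := x)) (j - 1)) < (w(k := x)) j)
      \<longleftrightarrow> chain \<theta> (Suc k) n x w"
    unfolding chain_def by (rule ball_cong) auto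
  then show ?thesis
    by (subst chain_def) (simp only: * Set.ball_simps, simp)
qed

lemma measurable_chain [measurable]:
  "Measurable.pred (PiM {k..<k + n} (\<lambda>_. borel)) (chain \<theta> k n y)"
proof -
  have "Measurable.pred (PiM {k..<k + n} (\<lambda>_. borel))
     (\<lambda>x. \<theta> * (if j = k then y else x (j - 1)) < (x j :: real))" if j: "j \<in> {k..<k + n}" for j
  proof (cases "j = k")
    case True
    then show ?thesis using j by simp
  next
    case False
    then have "j - 1 \<in> {k..<k + n}" using j by auto
    then show ?thesis using j False by simp
  qed
  then show ?thesis unfolding chain_def by (intro pred_intros_finite) auto
qed

lemma measurable_phi [measurable]: "phi \<xi> \<in> borel_measurable borel"
  unfolding phi_def [abs_def] by measurable

text \<open>Tonelli with the first coordinate outermost: for a fixed value \<open>x\<close> of it,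
  the inner integral is over a chain on the block from \<open>Suc k\<close> started at
  \<open>x\<close>.\<close>

lemma nn_integral_chain:
  assumes "prob_space (density lborel (\<lambda>x. ennreal (phi \<xi> x)))"
  shows "(\<integral>\<^sup>+x. indicator {x. chain \<theta> k n y x} x \<partial>PiM {k..<k + n} (\<lambda>_. density lborel (\<lambda>x. ennreal (phi \<xi> x))))
     = persist_rec \<theta> \<xi> n y"
proof (induction n arbitrary: k y)
  case 0
  then show ?case by (simp add: chain_def PiM_empty)
next
  case (Suc n)
  define \<mu> where "\<mu> = density lborel (\<lambda>x. ennreal (phi \<xi> x))"
  interpret prob_space \<mu> using assms by (simp add: \<mu>_def)
  interpret product_sigma_finite "\<lambda>_::nat. \<mu>" by standard
  have *: "{k..<k + Suc n} = insert k {Suc k..<Suc k + n}" by auto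
  have sets_\<mu>: "sets \<mu> = sets borel" by (simp add: \<mu>_def)
  have sP: "sets (PiM I (\<lambda>_. \<mu>)) = sets (PiM I (\<lambda>_. borel))" for I :: "nat set"
    by (intro sets_PiM_cong) (auto simp: sets_\<mu>)
  have meas: "(\<lambda>x. indicator {x. chain \<theta> k n y x} x :: ennreal) \<in> borel_measurable (PiM {k..<k + n} (\<lambda>_. \<mu>))" for k n y
    by (subst measurable_cong_sets[OF sP refl]) measurable
  have IH: "(\<integral>\<^sup>+x. indicator {x. chain \<theta> k n y x} x \<partial>PiM {k..<k + n} (\<lambda>_. \<mu>)) = persist_rec \<theta> \<xi> n y" for k y
    using Suc.IH by (simp add: \<mu>_def)
  have ind: "indicator {x. chain \<theta> k (Suc n) y x} (w(k := x)) =
      (indicator {\<theta> * y<..} x * indicator {w. chain \<theta> (Suc k) n x w} w :: ennreal)" for w x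
    by (auto simp: indicator_def chain_Suc)
  have "(\<integral>\<^sup>+x. indicator {x. chain \<theta> k (Suc n) y x} x \<partial>PiM {k..<k + Suc n} (\<lambda>_. \<mu>))
     = (\<integral>\<^sup>+x. (\<integral>\<^sup>+w. indicator {x. chain \<theta> k (Suc n) y x} (w(k := x)) \<partial>PiM {Suc k..<Suc k + n} (\<lambda>_. \<mu>)) \<partial>\<mu>)"
    unfolding * by (intro product_nn_integral_insert_rev) (use meas[of k "Suc n" y] in \<open>simp_all only: *[symmetric], auto\<close>)
  also have "\<dots> = (\<integral>\<^sup>+x. indicator {\<theta> * y<..} x * persist_rec \<theta> \<xi> n x \<partial>\<mu>)"
    unfolding ind by (subst nn_integral_cmult) (use meas[of "Suc k" n] IH[of "Suc k"] in simp_all)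
  also have "\<dots> = persist_rec \<theta> \<xi> (Suc n) y"
  proof -
    have "persist_rec \<theta> \<xi> n \<in> borel_measurable borel"
    proof (induction n)
      case (Suc n)
      note [measurable] = Suc.IH
      show ?case unfolding persist_rec.simps(2)[abs_def] greaterThan_def by measurable
    qed (simp add: persist_rec.simps(1)[abs_def])
    note [measurable] = this
    show ?thesis unfolding \<mu>_def by (subst nn_integral_density) auto
  qed
  finally show ?case by (simp add: \<mu>_def)
qed

text \<open>By independence the joint law of \<open>X 2, ..., X (n + 1)\<close> is a product
  measure, so the probability is the integral of the \<open>chain\<close> indicator over the block
  \<open>{2..<2 + n}\<close>.\<close>

lemma persist_eq_persist_rec:
  assumes "iid_phi M X \<xi>"
  shows "ennreal (persist M X \<theta> y n) = persist_rec \<theta> \<xi> n y"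
proof (cases "n = 0")
  case True
  then show ?thesis by (simp add: persist_def)
next
  case False
  define \<mu> where "\<mu> = density lborel (\<lambda>x. ennreal (phi \<xi> x))"
  from assms have "prob_space M" and indep: "prob_space.indep_vars M (\<lambda>_. borel) X UNIV"
    and dist: "\<And>i. distributed M lborel (X i) (\<lambda>x. ennreal (phi \<xi> x))"
    by (auto simp: iid_phi_def)
  interpret prob_space M by fact
  have [measurable]: "X i \<in> borel_measurable M" for i
    using distributed_measurable[OF dist[of i]] by simp
  \<comment> \<open>The independence hypothesis is over \<open>borel\<close>, the density over
    \<open>lborel\<close>; the two have the same sets.\<close>
  have distr: "distr M borel (X i) = \<mu>" for i
    using distributed_distr_eq_density[OF dist[of i]] unfolding \<mu>_def
    by (metis distr_cong sets_lborel)
  have "prob_space (distr M borel (X 0))" by (rule prob_space_distr) simp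
  then have ps: "prob_space \<mu>" by (simp add: distr)
  let ?I = "{2..<2 + n}"
  have "indep_vars (\<lambda>_. borel) X ?I" by (rule indep_vars_subset[OF indep]) simp
  then have joint: "distr M (PiM ?I (\<lambda>_. borel)) (\<lambda>x. \<lambda>i\<in>?I. X i x) = PiM ?I (\<lambda>_. \<mu>)"
    using indep_vars_iff_distr_eq_PiM'[where I = ?I and M' = "\<lambda>_. borel" and X = X] False by (simp add: distr)
  have iff: "(X 2 \<omega> > \<theta> * y \<and> (\<forall>k\<in>{2..n}. X (k + 1) \<omega> > \<theta> * X k \<omega>)) \<longleftrightarrow>
      chain \<theta> 2 n y (\<lambda>i\<in>?I. X i \<omega>)" for \<omega>
  proof -
    have "(\<forall>k\<in>{2..n}. X (k + 1) \<omega> > \<theta> * X k \<omega>) \<longleftrightarrow> (\<forall>j\<in>Suc ` {2..n}. X j \<omega> > \<theta> * X (j - 1) \<omega>)"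
      by (subst Set.ball_simps(9)) simp
    also have "Suc ` {2..n} = {3..<2 + n}" by (auto simp: image_iff)
    finally have eq: "(\<forall>k\<in>{2..n}. X (k + 1) \<omega> > \<theta> * X k \<omega>) \<longleftrightarrow> (\<forall>j\<in>{3..<2 + n}. X j \<omega> > \<theta> * X (j - 1) \<omega>)" .
    have I: "?I = insert 2 {3..<2 + n}" using False by auto
    have "chain \<theta> 2 n y x \<longleftrightarrow> \<theta> * y < x 2 \<and> (\<forall>j\<in>{3..<2 + n}. \<theta> * x (j - 1) < x j)" for x
    proof -
      have "(\<forall>j\<in>{3..<2 + n}. \<theta> * (if j = 2 then y else x (j - 1)) < x j)
          \<longleftrightarrow> (\<forall>j\<in>{3..<2 + n}. \<theta> * x (j - 1) < x j)"
        by (rule ball_cong) auto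
      then show ?thesis unfolding chain_def I by (simp only: Set.ball_simps, simp)
    qed
    moreover have "(\<forall>j\<in>{3..<2 + n}. \<theta> * (\<lambda>i\<in>?I. X i \<omega>) (j - 1) < (\<lambda>i\<in>?I. X i \<omega>) j) \<longleftrightarrow>
        (\<forall>j\<in>{3..<2 + n}. \<theta> * X (j - 1) \<omega> < X j \<omega>)"
      by (rule ball_cong) auto
    moreover have "(\<lambda>i\<in>?I. X i \<omega>) 2 = X 2 \<omega>" using False by simp
    ultimately have "chain \<theta> 2 n y (\<lambda>i\<in>?I. X i \<omega>) \<longleftrightarrow>
       X 2 \<omega> > \<theta> * y \<and> (\<forall>j\<in>{3..<2 + n}. X j \<omega> > \<theta> * X (j - 1) \<omega>)"
      by metis
    then show ?thesis using eq by simp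
  qed
  have "ennreal (persist M X \<theta> y n) = emeasure M {\<omega> \<in> space M. chain \<theta> 2 n y (\<lambda>i\<in>?I. X i \<omega>)}"
    using False unfolding persist_def iff emeasure_eq_measure by (simp only: if_False)
  also have "\<dots> = (\<integral>\<^sup>+\<omega>. indicator {x. chain \<theta> 2 n y x} (\<lambda>i\<in>?I. X i \<omega>) \<partial>M)"
  proof (subst nn_integral_indicator[symmetric])
    have "Measurable.pred M (\<lambda>\<omega>. chain \<theta> 2 n y (\<lambda>i\<in>?I. X i \<omega>))"
      by (rule measurable_compose[OF _ measurable_chain]) measurable
    then show "{\<omega> \<in> space M. chain \<theta> 2 n y (\<lambda>i\<in>?I. X i \<omega>)} \<in> events" by (simp add: pred_def)
  qed (intro nn_integral_cong, auto simp: indicator_def)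
  also have "\<dots> = (\<integral>\<^sup>+x. indicator {x. chain \<theta> 2 n y x} x \<partial>distr M (PiM ?I (\<lambda>_. borel)) (\<lambda>x. \<lambda>i\<in>?I. X i x))"
    by (rule nn_integral_distr[symmetric]) measurable
  also have "\<dots> = persist_rec \<theta> \<xi> n y"
    unfolding joint unfolding \<mu>_def by (rule nn_integral_chain) (use ps \<mu>_def in simp)
  finally show ?thesis .
qed

section \<open>The two branches of the persistence probabilities\<close>

text \<open>The bracket \<open>[k]_q\<close> as a geometric sum, which covers \<open>q = 1\<close>
  without a case distinction.\<close>

definition qnum :: "real \<Rightarrow> nat \<Rightarrow> real" where
  "qnum q k = (\<Sum>i<k. q ^ i)"

lemma qnum_0 [simp]: "qnum q 0 = 0"
  by (simp add: qnum_def)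

lemma qnum_Suc: "qnum q (Suc k) = 1 + q * qnum q k"
  unfolding qnum_def sum.lessThan_Suc_shift by (simp add: sum_distrib_left)

lemma qnum_eq: "q \<noteq> 1 \<Longrightarrow> qnum q k = (1 - q ^ k) / (1 - q)"
  by (simp add: qnum_def sum_gp_strict)

lemma qnum_nonneg: "0 < q \<Longrightarrow> 0 \<le> qnum q k"
  by (simp add: qnum_def sum_nonneg)

lemma qnum_Suc_ge_1: "0 < q \<Longrightarrow> 1 \<le> qnum q (Suc k)"
  by (simp add: qnum_Suc qnum_nonneg)

lemma qfact_0 [simp]: "qfact q 0 = 1"
  by (simp add: qfact_def)

lemma qfact_Suc: "qfact q (Suc n) = qnum q (Suc n) * qfact q n"
  by (cases "q = 1") (simp_all add: qfact_def qbracket_def qnum_eq, simp_all add: qnum_def)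

lemma qfact_pos: "0 < q \<Longrightarrow> 0 < qfact q n"
proof (induction n)
  case (Suc n)
  then show ?case using qnum_Suc_ge_1[of q n] by (simp add: qfact_Suc)
qed simp

section \<open>The closed form of the persistence probabilities\<close>

locale laplace_persistence =
  fixes q \<xi> :: real
  assumes q_pos: "0 < q" and xi_pos: "0 < \<xi>" and xi_less_1: "\<xi> < 1"
begin

text \<open>In the notation of the theorem \<open>\<rho>\<close> is \<open>- u\<close>, and
  \<open>\<kappa>\<close> below is \<open>1 / sqrt \<gamma>\<close>.\<close>

definition \<rho> :: real where "\<rho> = sqrt (\<xi> * (1 - \<xi>))"

definition \<kappa> :: real where "\<kappa> = sqrt (\<xi> / (1 - \<xi>))"

definition psi :: "nat \<Rightarrow> complex" where
  "psi k = (\<i> * of_real \<rho>) ^ k / of_real (qfact q k)"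

text \<open>The sequence \<open>\<beta>\<close> is forced by continuity at \<open>y = 0\<close>: it is the unique solution of
  \<open>branch_pos n 0 = branch_neg n 0\<close> for all \<open>n\<close>.\<close>

definition \<beta> :: "nat \<Rightarrow> real" where
  "\<beta> = fps_nth (- Abs_fps (\<lambda>k. Re ((1 + \<i> / of_real \<kappa>) * (\<i> * of_real \<kappa>) * psi k)) *
                inverse (Abs_fps (\<lambda>k. Re ((1 + \<i> / of_real \<kappa>) * psi k))))"

definition \<eta> :: "nat \<Rightarrow> complex" where
  "\<eta> m = of_real (\<beta> m) + (if m = 0 then \<i> * of_real \<kappa> else 0)"

text \<open>The coefficient of \<open>z ^ n\<close> in the two-variable q-exponential at
  \<open>\<i> * \<rho> * z\<close> times the series with coefficients \<open>\<eta>\<close>. Its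
  real part is the branch for positive starting points, its imaginary part over
  \<open>\<kappa>\<close> the branch for the others, both as functions of the absolute
  value.\<close>

definition Psi :: "nat \<Rightarrow> real \<Rightarrow> complex" where
  "Psi n y = (\<Sum>k\<le>n. psi k * of_real (exp (- (q * qnum q k * y))) * \<eta> (n - k))"

definition branch_pos :: "nat \<Rightarrow> real \<Rightarrow> real" where
  "branch_pos n y = Re (Psi n y)"

definition branch_neg :: "nat \<Rightarrow> real \<Rightarrow> real" where
  "branch_neg n y = Im (Psi n y) / \<kappa>"

lemma rho_pos: "0 < \<rho>" and kappa_pos: "0 < \<kappa>"
  using xi_pos xi_less_1 by (simp_all add: \<rho>_def \<kappa>_def)

lemma rho_kappa: "\<rho> * \<kappa> = \<xi>" "\<rho> / \<kappa> = 1 - \<xi>"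
proof -
  have "\<rho> * \<kappa> = sqrt (\<xi>\<^sup>2)" "\<rho> / \<kappa> = sqrt ((1 - \<xi>)\<^sup>2)"
    unfolding \<rho>_def \<kappa>_def real_sqrt_mult[symmetric] real_sqrt_divide[symmetric]
    using xi_pos xi_less_1 by (simp_all add: power2_eq_square)
  then show "\<rho> * \<kappa> = \<xi>" "\<rho> / \<kappa> = 1 - \<xi>" using xi_pos xi_less_1 by simp_all
qed

lemma psi_0 [simp]: "psi 0 = 1"
  by (simp add: psi_def)

lemma psi_Suc: "of_real (qnum q (Suc k)) * psi (Suc k) = \<i> * of_real \<rho> * psi k"
proof -
  have "qnum q (Suc k) \<noteq> 0" using qnum_Suc_ge_1[OF q_pos, of k] by linarith
  then show ?thesis by (simp add: psi_def qfact_Suc)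
qed

text \<open>If \<open>Psi n 0 = B + \<i> * \<kappa> * A\<close>, the real part of
  \<open>(1 + \<i> / \<kappa>) * Psi n 0\<close> is \<open>B - A\<close>, so this is continuity at
  \<open>y = 0\<close>. It is the coefficient form of \<open>\<beta> * R = - T\<close>, which
  defines \<open>\<beta>\<close>; \<open>R\<close> is invertible because its constant term is
  1.\<close>

lemma beta_convolution:
  "Re ((1 + \<i> / of_real \<kappa>) * (\<Sum>k\<le>n. psi k * \<eta> (n - k))) = 0"
proof -
  define R where "R = Abs_fps (\<lambda>k. Re ((1 + \<i> / of_real \<kappa>) * psi k))"
  define T where "T = Abs_fps (\<lambda>k. Re ((1 + \<i> / of_real \<kappa>) * (\<i> * of_real \<kappa>) * psi k))"
  have "R $ 0 \<noteq> 0" by (simp add: R_def)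
  then have "Abs_fps \<beta> * R = - T"
    unfolding \<beta>_def R_def[symmetric] T_def[symmetric] fps_nth_inverse
    by (simp add: fps_nth_inverse mult.assoc inverse_mult_eq_1)
  then have "(R * Abs_fps \<beta>) $ n = - T $ n" by (simp add: mult.commute)
  then have "(\<Sum>k\<le>n. Re ((1 + \<i> / of_real \<kappa>) * psi k) * \<beta> (n - k)) =
       - Re ((1 + \<i> / of_real \<kappa>) * (\<i> * of_real \<kappa>) * psi n)"
    by (simp add: fps_mult_nth R_def T_def atLeast0AtMost)
  \<comment> \<open>The imaginary part of \<open>\<eta>\<close> sits at index 0, that is at
    \<open>k = n\<close>, and produces the coefficient of \<open>T\<close>.\<close>
  moreover have "(1 + \<i> / of_real \<kappa>) * (\<Sum>k\<le>n. psi k * \<eta> (n - k)) =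
     (\<Sum>k\<le>n. (1 + \<i> / of_real \<kappa>) * psi k * of_real (\<beta> (n - k))) +
     (\<Sum>k\<le>n. if k = n then (1 + \<i> / of_real \<kappa>) * (\<i> * of_real \<kappa>) * psi n else 0)"
    unfolding sum_distrib_left sum.distrib[symmetric]
    by (rule sum.cong) (auto simp: \<eta>_def algebra_simps)
  ultimately show ?thesis by simp
qed

lemma branch_0 [simp]: "branch_pos 0 y = 1" "branch_neg 0 y = 1"
proof -
  have "\<eta> 0 = 1 + \<i> * of_real \<kappa>"
    using beta_convolution[of 0] kappa_pos by (simp add: \<eta>_def complex_eq_iff)
  then show "branch_pos 0 y = 1" "branch_neg 0 y = 1"
    using kappa_pos by (simp_all add: branch_pos_def branch_neg_def Psi_def)
qed

lemma branch_at_0: "branch_pos n 0 = branch_neg n 0"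
  using beta_convolution[of n] by (simp add: branch_pos_def branch_neg_def Psi_def)

lemma branch_pos_sum: "branch_pos n y = (\<Sum>k\<le>n. exp (- (q * qnum q k * y)) * Re (psi k * \<eta> (n - k)))"
  and branch_neg_sum: "branch_neg n y = (\<Sum>k\<le>n. exp (- (q * qnum q k * y)) * (Im (psi k * \<eta> (n - k)) / \<kappa>))"
  by (simp_all add: branch_pos_def branch_neg_def Psi_def sum_divide_distrib algebra_simps diff_divide_distrib add_divide_distrib)

lemma Psi_eq: "Psi n y = of_real (branch_pos n y) + \<i> * of_real (\<kappa> * branch_neg n y)"
  using kappa_pos by (simp add: branch_pos_def branch_neg_def complex_eq_iff)

section \<open>Derivatives, signs and bounds of the branches\<close>

lemma exp_qnum_Suc: "exp (- (q * qnum q (Suc k) * y)) = exp (- (q * y)) * exp (- (q * qnum q k * (q * y)))"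
  by (simp add: qnum_Suc exp_add[symmetric] algebra_simps)

text \<open>Since \<open>[k + 1]_q = 1 + q [k]_q\<close>, differentiation kills the term
  \<open>k = 0\<close>, pulls out \<open>q * exp (- (q * y))\<close> and leaves a sum of the same
  shape at \<open>q * y\<close> with shifted coefficients.\<close>

lemma has_real_derivative_exp_sum:
  fixes c :: "nat \<Rightarrow> real"
  assumes "\<And>k. k \<le> n \<Longrightarrow> - (qnum q (Suc k) * c (Suc k)) = d k"
  shows "((\<lambda>y. \<Sum>k\<le>Suc n. exp (- (q * qnum q k * y)) * c k) has_real_derivative
     q * exp (- (q * y)) * (\<Sum>k\<le>n. exp (- (q * qnum q k * (q * y))) * d k)) (at y)"
proof -
  have "((\<lambda>y. \<Sum>k\<le>Suc n. exp (- (q * qnum q k * y)) * c k) has_real_derivative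
     (\<Sum>k\<le>Suc n. - (q * qnum q k) * exp (- (q * qnum q k * y)) * c k)) (at y)"
    by (auto intro!: derivative_eq_intros sum.cong)
  also have "(\<Sum>k\<le>Suc n. - (q * qnum q k) * exp (- (q * qnum q k * y)) * c k) =
     (\<Sum>k\<le>n. q * exp (- (q * y)) * (exp (- (q * qnum q k * (q * y))) * d k))"
    unfolding sum.atMost_Suc_shift exp_qnum_Suc using assms
    by (simp add: algebra_simps flip: assms)
  finally show ?thesis by (simp add: sum_distrib_left)
qed

text \<open>For \<open>y > 0\<close> this is the integral recursion differentiated in
  \<open>y\<close>. The factor \<open>\<i> * \<rho>\<close> in \<open>psi_Suc\<close> exchanges real
  and imaginary parts, and \<open>\<rho> * \<kappa> = \<xi>\<close> gives the constant.\<close>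

lemma branch_pos_deriv:
  "(branch_pos (Suc n) has_real_derivative \<xi> * (q * exp (- (q * y)) * branch_neg n (q * y))) (at y)"
proof -
  have *: "- (qnum q (Suc k) * Re (psi (Suc k) * \<eta> (Suc n - Suc k))) = \<xi> * (Im (psi k * \<eta> (n - k)) / \<kappa>)" for k
  proof -
    have "qnum q (Suc k) * Re (psi (Suc k) * \<eta> (Suc n - Suc k)) =
        Re (of_real (qnum q (Suc k)) * psi (Suc k) * \<eta> (n - k))"
      by (simp add: mult.assoc)
    also have "\<dots> = - \<rho> * Im (psi k * \<eta> (n - k))"
      unfolding psi_Suc by (simp add: algebra_simps)
    finally have "- (qnum q (Suc k) * Re (psi (Suc k) * \<eta> (Suc n - Suc k))) = \<rho> * \<kappa> * (Im (psi k * \<eta> (n - k)) / \<kappa>)"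
      using kappa_pos by simp
    then show ?thesis unfolding rho_kappa .
  qed
  have eq: "branch_pos (Suc n) = (\<lambda>y. \<Sum>k\<le>Suc n. exp (- (q * qnum q k * y)) * Re (psi k * \<eta> (Suc n - k)))"
    by (rule ext) (rule branch_pos_sum)
  show ?thesis
    unfolding eq branch_neg_sum
    by (rule DERIV_cong[OF has_real_derivative_exp_sum[OF *]]) (simp add: sum_distrib_left algebra_simps)
qed

lemma branch_neg_deriv:
  "(branch_neg (Suc n) has_real_derivative - (1 - \<xi>) * (q * exp (- (q * y)) * branch_pos n (q * y))) (at y)"
proof -
  have *: "- (qnum q (Suc k) * (Im (psi (Suc k) * \<eta> (Suc n - Suc k)) / \<kappa>)) = - (1 - \<xi>) * Re (psi k * \<eta> (n - k))" for k
  proof -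
    have "qnum q (Suc k) * Im (psi (Suc k) * \<eta> (Suc n - Suc k)) =
        Im (of_real (qnum q (Suc k)) * psi (Suc k) * \<eta> (n - k))"
      by (simp add: mult.assoc)
    also have "\<dots> = \<rho> * Re (psi k * \<eta> (n - k))"
      unfolding psi_Suc by (simp add: algebra_simps)
    finally have "- (qnum q (Suc k) * (Im (psi (Suc k) * \<eta> (Suc n - Suc k)) / \<kappa>)) = - (\<rho> / \<kappa>) * Re (psi k * \<eta> (n - k))"
      by simp
    then show ?thesis unfolding rho_kappa .
  qed
  have eq: "branch_neg (Suc n) = (\<lambda>y. \<Sum>k\<le>Suc n. exp (- (q * qnum q k * y)) * (Im (psi k * \<eta> (Suc n - k)) / \<kappa>))"
    by (rule ext) (rule branch_neg_sum)
  show ?thesis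
    unfolding eq branch_pos_sum
    by (rule DERIV_cong[OF has_real_derivative_exp_sum[OF *]]) (simp add: sum_distrib_left algebra_simps)
qed

text \<open>Terms with \<open>k > 0\<close> decay, and the term \<open>k = 0\<close> is
  \<open>Im (\<eta> (Suc n)) / \<kappa> = 0\<close>, as \<open>\<eta>\<close> is real beyond index
  0. Hence the restriction to positive index.\<close>

lemma branch_neg_tendsto_0: "(branch_neg (Suc n) \<longlongrightarrow> 0) at_top"
proof -
  have "((\<lambda>y. \<Sum>k\<le>Suc n. exp (- (q * qnum q k * y)) * (Im (psi k * \<eta> (Suc n - k)) / \<kappa>))
      \<longlongrightarrow> (\<Sum>k\<le>Suc n. (if k = 0 then 1 else 0) * (Im (psi k * \<eta> (Suc n - k)) / \<kappa>))) at_top"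
  proof (intro tendsto_sum tendsto_mult tendsto_const)
    fix k
    show "((\<lambda>y. exp (- (q * qnum q k * y))) \<longlongrightarrow> (if k = 0 then 1 else 0)) at_top"
    proof (cases k)
      case (Suc m)
      then have "0 < q * qnum q k" using q_pos qnum_Suc_ge_1[OF q_pos, of m] by simp
      moreover have "((\<lambda>y. exp (- (c * y))) \<longlongrightarrow> 0) at_top" if "0 < c" for c :: real
        using that by real_asymp
      ultimately have "((\<lambda>y. exp (- (q * qnum q k * y))) \<longlongrightarrow> 0) at_top" by blast
      then show ?thesis using Suc by simp
    qed simp
  qed
  also have "(\<Sum>k\<le>Suc n. (if k = 0 then 1 else 0) * (Im (psi k * \<eta> (Suc n - k)) / \<kappa>)) =
      (\<Sum>k\<le>Suc n. if k = 0 then Im (\<eta> (Suc n)) / \<kappa> else 0)"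
    by (rule sum.cong) auto
  also have "\<dots> = 0" by (simp add: \<eta>_def)
  finally show ?thesis by (simp only: branch_neg_sum[abs_def])
qed

text \<open>The branches are signed sums of exponentials, so the sign is read off the derivatives:
  \<open>branch_neg\<close> decreases to its limit 0, and \<open>branch_pos\<close> increases from
  the value they share at 0.\<close>

lemma branch_nonneg: "0 \<le> y \<Longrightarrow> 0 \<le> branch_pos n y \<and> 0 \<le> branch_neg n y"
proof (induction n arbitrary: y)
  case (Suc n)
  have neg: "0 \<le> branch_neg (Suc n) y" if "0 \<le> y" for y
  proof (rule tendsto_upperbound[OF branch_neg_tendsto_0[of n]])
    have "branch_neg (Suc n) x \<le> branch_neg (Suc n) y" if "y \<le> x" for x
    proof (rule DERIV_nonpos_imp_nonincreasing[OF that])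
      fix t :: real assume t: "y \<le> t"
      have "0 \<le> branch_pos n (q * t)" using Suc.IH[of "q * t"] q_pos t \<open>0 \<le> y\<close> by simp
      then show "\<exists>d. (branch_neg (Suc n) has_real_derivative d) (at t) \<and> d \<le> 0"
        using branch_neg_deriv[of n t] q_pos xi_less_1
        by (intro exI conjI) (assumption, simp add: mult_nonpos_nonneg)
    qed
    then show "\<forall>\<^sub>F x in at_top. branch_neg (Suc n) x \<le> branch_neg (Suc n) y"
      using eventually_ge_at_top by (rule eventually_mono[rotated])
  qed simp
  have "branch_pos (Suc n) 0 \<le> branch_pos (Suc n) y"
  proof (rule DERIV_nonneg_imp_nondecreasing[OF Suc.prems])
    fix t :: real assume t: "0 \<le> t"
    have "0 \<le> branch_neg n (q * t)" using Suc.IH[of "q * t"] q_pos t by simp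
    then show "\<exists>d. (branch_pos (Suc n) has_real_derivative d) (at t) \<and> 0 \<le> d"
      using branch_pos_deriv[of n t] q_pos xi_pos by (intro exI conjI) (assumption, simp)
  qed
  then show ?case using neg[of 0] neg[OF Suc.prems] by (simp add: branch_at_0)
qed simp

lemma branch_pos_mono: "0 \<le> y \<Longrightarrow> branch_pos n 0 \<le> branch_pos n y"
proof (cases n)
  case (Suc m)
  assume "0 \<le> y"
  then show ?thesis unfolding Suc
  proof (rule DERIV_nonneg_imp_nondecreasing)
    fix t :: real assume t: "0 \<le> t"
    have "0 \<le> branch_neg m (q * t)" using branch_nonneg[of "q * t" m] q_pos t by simp
    then show "\<exists>d. (branch_pos (Suc m) has_real_derivative d) (at t) \<and> 0 \<le> d"
      using branch_pos_deriv[of m t] q_pos xi_pos by (intro exI conjI) (assumption, simp)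
  qed
qed simp

text \<open>The difference of the two sides decreases to 0 at infinity. The bound compares
  consecutive indices and later keeps the limits for \<open>y \<le> 0\<close> away from
  zero.\<close>

lemma branch_neg_lower_bound:
  assumes "0 \<le> y"
  shows "(1 - \<xi>) * exp (- (q * y)) * branch_pos n 0 \<le> branch_neg (Suc n) y"
proof -
  define f where "f y = branch_neg (Suc n) y - (1 - \<xi>) * exp (- (q * y)) * branch_pos n 0" for y
  have "((\<lambda>y. exp (- (q * y))) \<longlongrightarrow> 0) at_top" using q_pos by real_asymp
  then have "(f \<longlongrightarrow> 0 - (1 - \<xi>) * 0 * branch_pos n 0) at_top"
    unfolding f_def by (intro tendsto_intros branch_neg_tendsto_0)
  then have "(f \<longlongrightarrow> 0) at_top" by simp
  moreover have "f x \<le> f y" if "y \<le> x" for x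
  proof (rule DERIV_nonpos_imp_nonincreasing[OF that])
    fix t :: real assume t: "y \<le> t"
    have "(f has_real_derivative - (1 - \<xi>) * (q * exp (- (q * t)) * branch_pos n (q * t)) -
        - (1 - \<xi>) * (q * exp (- (q * t)) * branch_pos n 0)) (at t)"
      unfolding f_def
      by (rule derivative_eq_intros branch_neg_deriv refl | simp add: algebra_simps)+
    moreover have "branch_pos n 0 \<le> branch_pos n (q * t)"
      using t assms q_pos by (intro branch_pos_mono) simp
    then have "(1 - \<xi>) * (q * exp (- (q * t)) * branch_pos n 0) \<le> (1 - \<xi>) * (q * exp (- (q * t)) * branch_pos n (q * t))"
      using q_pos xi_less_1 by (intro mult_left_mono) auto
    ultimately show "\<exists>d. (f has_real_derivative d) (at t) \<and> d \<le> 0"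
      by (intro exI conjI) (assumption, simp add: algebra_simps)
  qed
  then have "\<forall>\<^sub>F x in at_top. f x \<le> f y"
    using eventually_ge_at_top by (rule eventually_mono[rotated])
  ultimately have "0 \<le> f y" by (rule tendsto_upperbound) simp
  then show ?thesis by (simp add: f_def)
qed

section \<open>The branches solve the integral recursion\<close>

lemma branch_measurable [measurable]:
  "branch_pos n \<in> borel_measurable borel" "branch_neg n \<in> borel_measurable borel"
  unfolding branch_pos_sum[abs_def] branch_neg_sum[abs_def] by measurable

text \<open>\<open>branch_neg_deriv\<close> at \<open>x / q\<close> supplies the antiderivative,
  whose value at infinity vanishes by \<open>branch_neg_tendsto_0\<close>.\<close>

lemma nn_integral_branch_pos_atLeast:
  assumes "0 \<le> y"
  shows "(\<integral>\<^sup>+x. ennreal ((1 - \<xi>) * exp (- x) * branch_pos n x) * indicator {q * y..} x \<partial>lborel)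
     = ennreal (branch_neg (Suc n) y)"
proof -
  have "(\<integral>\<^sup>+x. ennreal ((1 - \<xi>) * exp (- x) * branch_pos n x) * indicator {q * y..} x \<partial>lborel)
     = ennreal (0 - (- branch_neg (Suc n) (q * y / q)))"
  proof (rule nn_integral_FTC_atLeast)
    fix x assume x: "q * y \<le> x"
    have "((\<lambda>x. - branch_neg (Suc n) (x / q)) has_real_derivative
        - (- (1 - \<xi>) * (q * exp (- (q * (x / q))) * branch_pos n (q * (x / q))) * (1 / q))) (at x)"
      using q_pos
      by (intro DERIV_minus DERIV_chain2[OF branch_neg_deriv]) (auto intro!: derivative_eq_intros)
    then show "((\<lambda>x. - branch_neg (Suc n) (x / q)) has_real_derivative
        (1 - \<xi>) * exp (- x) * branch_pos n x) (at x)"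
      by (rule DERIV_cong) (use q_pos in \<open>simp add: algebra_simps\<close>)
    have "0 \<le> x" using x q_pos assms by (meson mult_nonneg_nonneg less_imp_le order_trans)
    then show "0 \<le> (1 - \<xi>) * exp (- x) * branch_pos n x"
      using branch_nonneg[of x n] xi_less_1 by simp
  next
    have "filterlim (\<lambda>x. x / q) at_top at_top" using q_pos by real_asymp
    from tendsto_minus[OF filterlim_compose[OF branch_neg_tendsto_0 this]]
    show "((\<lambda>x. - branch_neg (Suc n) (x / q)) \<longlongrightarrow> 0) at_top" by simp
  qed measurable
  then show ?thesis using q_pos by simp
qed

lemma nn_integral_branch_neg_Icc:
  assumes "0 \<le> y"
  shows "(\<integral>\<^sup>+x. ennreal (\<xi> * exp x * branch_neg n (- x)) * indicator {- (q * y)..0} x \<partial>lborel)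
     = ennreal (branch_pos (Suc n) y - branch_pos (Suc n) 0)"
proof -
  have "(\<integral>\<^sup>+x. ennreal (\<xi> * exp x * branch_neg n (- x)) * indicator {- (q * y)..0} x \<partial>lborel)
     = ennreal (- branch_pos (Suc n) (- 0 / q) - (- branch_pos (Suc n) (- (- (q * y)) / q)))"
  proof (rule nn_integral_FTC_Icc[where F = "\<lambda>x. - branch_pos (Suc n) (- x / q)"])
    fix x assume "x \<in> {- (q * y)..0}"
    then have x: "- (q * y) \<le> x" "x \<le> 0" by auto
    have "((\<lambda>x. - branch_pos (Suc n) (- x / q)) has_real_derivative
        - (\<xi> * (q * exp (- (q * (- x / q))) * branch_neg n (q * (- x / q))) * (- 1 / q))) (at x)"
      using q_pos
      by (intro DERIV_minus DERIV_chain2[OF branch_pos_deriv]) (auto intro!: derivative_eq_intros)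
    then show "((\<lambda>x. - branch_pos (Suc n) (- x / q)) has_real_derivative
        \<xi> * exp x * branch_neg n (- x)) (at x)"
      by (rule DERIV_cong) (use q_pos in simp)
    show "0 \<le> \<xi> * exp x * branch_neg n (- x)"
      using branch_nonneg[of "- x" n] x xi_pos by simp
  qed (use q_pos assms in auto)
  then show ?thesis using q_pos by simp
qed

definition survival :: "nat \<Rightarrow> real \<Rightarrow> real" where
  "survival n y = (if y > 0 then branch_pos n y else branch_neg n (- y))"

lemma persist_rec_eq_survival: "persist_rec (- q) \<xi> n y = ennreal (survival n y)"
proof (induction n arbitrary: y)
  case (Suc n)
  \<comment> \<open>Only at these two points can the strict threshold differ from the closed
    intervals below, or the density from its one-sided formulas.\<close>
  have sing: "AE x in lborel. x \<notin> {- (q * y), 0 :: real}"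
    using AE_lborel_singleton[of "- (q * y)"] AE_lborel_singleton[of "0::real"] by eventually_elim simp
  show ?case
  proof (cases "y > 0")
    case False
    \<comment> \<open>The threshold \<open>- (q * y)\<close> is nonnegative, so only the positive
      half of the density contributes.\<close>
    have "persist_rec (- q) \<xi> (Suc n) y =
        (\<integral>\<^sup>+x. ennreal ((1 - \<xi>) * exp (- x) * branch_pos n x) * indicator {q * (- y)..} x \<partial>lborel)"
      unfolding persist_rec.simps
    proof (rule nn_integral_cong_AE, use sing in eventually_elim)
      case (elim x)
      show ?case
      proof (cases "- (q * y) < x")
        case True
        moreover have "q * y \<le> 0" using False q_pos by (simp add: mult_nonneg_nonpos)
        ultimately have "0 < x" by linarith
        then show ?thesis using True branch_nonneg[of x n] xi_less_1
          by (simp add: Suc.IH phi_def survival_def ennreal_mult'' ennreal_mult')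
      qed (use elim in \<open>auto simp: indicator_def\<close>)
    qed
    also have "\<dots> = ennreal (survival (Suc n) y)"
      using False nn_integral_branch_pos_atLeast[of "- y" n] by (simp add: survival_def)
    finally show ?thesis .
  next
    case True
    have qy: "0 < q * y" using True q_pos by simp
    \<comment> \<open>The negative part of the range yields the increment of
      \<open>branch_pos\<close> over 0, the positive part yields
      \<open>branch_neg (Suc n) 0\<close>; by \<open>branch_at_0\<close> the latter cancels the
      subtracted constant.\<close>
    have "persist_rec (- q) \<xi> (Suc n) y =
        (\<integral>\<^sup>+x. ennreal (\<xi> * exp x * branch_neg n (- x)) * indicator {- (q * y)..0} x +
              ennreal ((1 - \<xi>) * exp (- x) * branch_pos n x) * indicator {q * 0..} x \<partial>lborel)"
      unfolding persist_rec.simps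
    proof (rule nn_integral_cong_AE, use sing in eventually_elim)
      case (elim x)
      consider "0 < x" | "- (q * y) < x" "x < 0" | "x < - (q * y)" "x < 0"
        using elim qy by force
      then show ?case
      proof cases
        case 1
        then show ?thesis using qy branch_nonneg[of x n] xi_less_1
          by (simp add: Suc.IH phi_def survival_def ennreal_mult'' ennreal_mult')
      next
        case 2
        then show ?thesis using branch_nonneg[of "- x" n] xi_pos
          by (simp add: Suc.IH phi_def survival_def ennreal_mult'' ennreal_mult')
      next
        case 3
        then show ?thesis by simp
      qed
    qed
    also have "\<dots> = ennreal (branch_pos (Suc n) y - branch_pos (Suc n) 0) + ennreal (branch_neg (Suc n) 0)"
      using nn_integral_branch_neg_Icc[of y n] nn_integral_branch_pos_atLeast[of 0 n] True
      by (subst nn_integral_add) auto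
    also have "\<dots> = ennreal (survival (Suc n) y)"
    proof -
      have "branch_pos (Suc n) 0 \<le> branch_pos (Suc n) y"
        using True by (intro branch_pos_mono) simp
      then show ?thesis using True branch_at_0[of "Suc n"] branch_nonneg[of 0 "Suc n"]
        by (subst ennreal_plus[symmetric]) (auto simp: survival_def)
    qed
    finally show ?thesis .
  qed
qed (simp add: survival_def)

lemma persist_eq_survival:
  assumes "iid_phi M X \<xi>"
  shows "persist M X (- q) y n = survival n y"
proof -
  have "0 \<le> survival n y" using branch_nonneg[of "\<bar>y\<bar>" n] by (auto simp: survival_def)
  moreover have "0 \<le> persist M X (- q) y n" by (simp add: persist_def)
  ultimately show ?thesis
    using persist_eq_persist_rec[OF assms, of "- q" y n] by (simp add: persist_rec_eq_survival)
qed

end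

section \<open>Coefficient asymptotics of quotients of power series\<close>

text \<open>Multiplying \<open>Q\<close> by \<open>z0 - z\<close> removes the only pole in the
  closed disc, so the new series converges beyond \<open>norm z0\<close>. Its partial sums at
  \<open>z0\<close> telescope to \<open>fps_nth Q n * z0 ^ Suc n\<close>, and convergence of that
  series is the claim.\<close>

lemma fps_quotient_coeff_asymptotics:
  fixes Q f g :: "complex fps"
  assumes f: "fps_conv_radius f = \<infinity>" and g: "fps_conv_radius g = \<infinity>"
    and eq: "Q * g = f" and z0: "z0 \<noteq> 0"
    and root: "eval_fps g z0 = 0" and simple: "deriv (eval_fps g) z0 \<noteq> 0"
    and other: "\<And>z. norm z \<le> norm z0 \<Longrightarrow> z \<noteq> z0 \<Longrightarrow> eval_fps g z \<noteq> 0"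
  shows "(\<lambda>n. fps_nth Q n * z0 ^ Suc n) \<longlonglongrightarrow> - eval_fps f z0 / deriv (eval_fps g) z0"
proof -
  have holf: "eval_fps f holomorphic_on UNIV" and holg: "eval_fps g holomorphic_on UNIV"
    using f g by (auto intro!: holomorphic_on_eval_fps)
  \<comment> \<open>\<open>G z\<close> is \<open>eval_fps g z / (z0 - z)\<close> with the removable
    singularity filled in.\<close>
  define G where "G z = - (if z = z0 then deriv (eval_fps g) z0 else (eval_fps g z - eval_fps g z0) / (z - z0))" for z
  have holG: "G holomorphic_on UNIV"
    unfolding G_def[abs_def] by (intro holomorphic_on_minus pole_lemma_open holg open_UNIV)
  have G: "(z0 - z) * G z = eval_fps g z" for z
    by (cases "z = z0") (auto simp: G_def root field_simps)
  have G0: "G z \<noteq> 0" if "norm z \<le> norm z0" for z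
    using that other[of z] simple G[of z] by (cases "z = z0") (auto simp: G_def)
  \<comment> \<open>By compactness \<open>G\<close> stays nonzero on a slightly larger disc.\<close>
  have "open {z. G z \<noteq> 0}"
  proof -
    have "continuous_on UNIV G" by (rule holomorphic_on_imp_continuous_on[OF holG])
    then show ?thesis by (intro open_Collect_neq continuous_on_const) auto
  qed
  then obtain d where d: "d > 0" "(\<Union>x\<in>cball 0 (norm z0). cball x d) \<subseteq> {z. G z \<noteq> 0}"
    by (rule compact_subset_open_imp_cball_epsilon_subset[of "cball 0 (norm z0)", rotated])
       (use G0 in auto)
  define R where "R = norm z0 + d"
  have R: "norm z0 < R" "0 < R" using d by (auto simp: R_def add_nonneg_pos)
  have GR: "G z \<noteq> 0" if "norm z < R" for z
  proof (cases "norm z \<le> norm z0")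
    case False
    \<comment> \<open>The radial projection of \<open>z\<close> to the circle of radius
      \<open>norm z0\<close>.\<close>
    define w where "w = of_real (norm z0 / norm z) * z"
    have nz: "norm z \<noteq> 0" using False by auto
    then have "norm w = norm z0" by (simp add: w_def norm_mult norm_divide)
    moreover have "dist w z \<le> d"
    proof -
      have "z - w = of_real (1 - norm z0 / norm z) * z" by (simp add: w_def algebra_simps)
      then have "norm (z - w) = \<bar>1 - norm z0 / norm z\<bar> * norm z" by (simp only: norm_mult norm_of_real)
      also have "1 - norm z0 / norm z \<ge> 0" using False nz by (simp add: field_simps)
      then have "\<bar>1 - norm z0 / norm z\<bar> * norm z = norm z - norm z0" using nz by (simp add: field_simps)
      also have "\<dots> \<le> d" using that by (simp add: R_def)
      finally show ?thesis by (simp add: dist_norm norm_minus_commute)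
    qed
    ultimately have "z \<in> (\<Union>x\<in>cball 0 (norm z0). cball x d)" by (intro UN_I[of w]) auto
    then show ?thesis using d(2) by blast
  qed (use G0 in auto)
  define H where "H z = eval_fps f z / G z" for z
  have holH: "H holomorphic_on ball 0 R"
    unfolding H_def by (intro holomorphic_intros holomorphic_on_subset[OF holf] holomorphic_on_subset[OF holG])
       (use GR in auto)
  define h where "h = fps_expansion H 0"
  have exph: "H has_fps_expansion h"
    unfolding h_def by (rule has_fps_expansion_fps_expansion[OF _ _ holH]) (use R in auto)
  \<comment> \<open>Both series expand the same function near 0. Cancelling \<open>g\<close> then
    identifies \<open>h\<close> with \<open>z0 - X\<close> times \<open>Q\<close>.\<close>
  have "h * g = (fps_const z0 - fps_X) * f"
  proof (rule fps_expansion_unique_complex)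
    show "(\<lambda>z. (z0 - z) * eval_fps f z) has_fps_expansion (fps_const z0 - fps_X) * f"
      by (intro fps_expansion_intros eval_fps_has_fps_expansion) (simp add: f)
    have "(\<lambda>z. H z * eval_fps g z) has_fps_expansion h * g"
      by (intro fps_expansion_intros eval_fps_has_fps_expansion exph) (simp add: g)
    also have "?this \<longleftrightarrow> (\<lambda>z. (z0 - z) * eval_fps f z) has_fps_expansion h * g"
    proof (rule has_fps_expansion_cong)
      have "eventually (\<lambda>z. z \<in> ball 0 R) (nhds (0::complex))"
        using R by (intro eventually_nhds_in_open) auto
      then show "\<forall>\<^sub>F z in nhds 0. H z * eval_fps g z = (z0 - z) * eval_fps f z"
      proof eventually_elim
        case (elim z)
        have "G z \<noteq> 0" using GR elim by simp
        then show ?case by (simp add: H_def flip: G)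
      qed
    qed simp
    finally show "(\<lambda>z. (z0 - z) * eval_fps f z) has_fps_expansion h * g" .
  qed
  then have "(h - (fps_const z0 - fps_X) * Q) * g = 0" by (simp add: algebra_simps flip: eq)
  moreover have "eval_fps (0 :: complex fps) = (\<lambda>_. 0)" by (auto simp: eval_fps_def)
  then have "g \<noteq> 0" using simple by auto
  ultimately have h: "h = (fps_const z0 - fps_X) * Q" by simp
  have partial: "(\<Sum>k\<le>n. fps_nth h k * z0 ^ k) = fps_nth Q n * z0 ^ Suc n" for n
    by (induction n) (simp_all add: h algebra_simps)
  have "fps_conv_radius h \<ge> ereal R"
    unfolding h_def by (rule conv_radius_fps_expansion) (use holH in simp)
  then have "(\<lambda>n. fps_nth h n * z0 ^ n) sums eval_fps h z0"
    using R by (intro sums_eval_fps) (metis ereal_less_eq(3) less_ereal.simps(1) order_less_le_trans)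
  moreover have "eval_fps h z0 = H z0"
    using eval_fps_expansion'[of H 0 "ereal R" z0] holH R by (simp add: h_def)
  ultimately have "(\<lambda>n. \<Sum>k\<le>n. fps_nth h k * z0 ^ k) \<longlonglongrightarrow> H z0"
    by (simp add: sums_def_le)
  then show ?thesis unfolding partial by (simp add: H_def G_def)
qed

section \<open>Functions of Hermite--Biehler type\<close>

text \<open>On \<open>[0, 1]\<close> the derivative of the sine is at least
  \<open>cos (pi / 3) = 1 / 2\<close>, because \<open>pi > 3\<close>.\<close>

lemma sin_ge_half: "0 \<le> t \<Longrightarrow> t \<le> 1 \<Longrightarrow> t / 2 \<le> sin t" for t :: real
proof -
  assume t: "0 \<le> t" "t \<le> 1"
  have "sin 0 - 0 / 2 \<le> sin t - t / 2"
  proof (rule DERIV_nonneg_imp_nondecreasing[OF t(1)])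
    fix x :: real assume x: "0 \<le> x" "x \<le> t"
    have "cos (pi / 3) \<le> cos x"
      by (rule cos_monotone_0_pi_le) (use x t pi_gt3 in auto)
    then show "\<exists>d. ((\<lambda>t. sin t - t / 2) has_real_derivative d) (at x) \<and> 0 \<le> d"
      by (intro exI[of _ "cos x - 1 / 2"]) (auto intro!: derivative_eq_intros simp: cos_60)
  qed
  then show ?thesis by simp
qed

lemma sin_minus_tan_times_cos:
  "cos b \<noteq> 0 \<Longrightarrow> sin t - tan b * cos t = sin (t - b) / cos b" for t b :: real
  by (simp add: sin_diff tan_def field_simps)

text \<open>Functions of Hermite--Biehler type: \<open>E\<close> is larger at \<open>\<i> * v\<close> than at \<open>- \<i> * v\<close> for \<open>v\<close> in
  the lower half-plane, and \<open>\<Theta>\<close> is its phase on the imaginary axis. Both \<open>exp\<close> (with phase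
  \<open>\<Theta> x = x\<close>) and the entire \<open>q\<close>-exponentials are of this kind.\<close>

locale phase_function =
  fixes E :: "complex \<Rightarrow> complex" and \<Theta> :: "real \<Rightarrow> real" and a :: real
  assumes entire: "E holomorphic_on UNIV"
    and norm_less: "Im v < 0 \<Longrightarrow> norm (E (- (\<i> * v))) < norm (E (\<i> * v))"
    and polar: "E (\<i> * of_real x) = of_real (norm (E (\<i> * of_real x))) * cis (\<Theta> x)"
    and nonzero: "E (\<i> * of_real x) \<noteq> 0"
    and cnj_commute: "E (cnj z) = cnj (E z)"
    and a_pos: "0 < a"
    and phase_minus: "\<Theta> (- x) = - \<Theta> x"
    and phase_lower: "x \<le> y \<Longrightarrow> arctan (a * y) - arctan (a * x) \<le> \<Theta> y - \<Theta> x"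
    and phase_upper: "x \<le> y \<Longrightarrow> \<Theta> y - \<Theta> x \<le> y - x"
    and phase_large: "\<exists>x. pi / 2 \<le> \<Theta> x"
begin

definition cosE :: "complex \<Rightarrow> complex" where
  "cosE v = (E (\<i> * v) + E (- (\<i> * v))) / 2"

definition sinE :: "complex \<Rightarrow> complex" where
  "sinE v = (E (\<i> * v) - E (- (\<i> * v))) / (2 * \<i>)"

definition R :: "real \<Rightarrow> real" where
  "R x = norm (E (\<i> * of_real x))"

lemma R_pos: "0 < R x"
  using nonzero by (simp add: R_def)

lemma E_i: "E (\<i> * of_real x) = of_real (R x) * cis (\<Theta> x)"
  using polar by (simp add: R_def)

lemma E_minus_i: "E (- (\<i> * of_real x)) = of_real (R x) * cis (- \<Theta> x)"
proof -
  have "E (- (\<i> * of_real x)) = cnj (E (\<i> * of_real x))"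
    by (simp flip: cnj_commute)
  then show ?thesis by (simp add: E_i cis_cnj)
qed

lemma R_minus: "R (- x) = R x"
  using E_minus_i[of x] R_pos[of x] by (simp add: R_def norm_mult)

lemma E_minus_eq: "E (- (\<i> * v)) = cosE v - \<i> * sinE v"
  by (simp add: cosE_def sinE_def field_simps)

lemma cosE_real: "cosE (of_real x) = of_real (R x * cos (\<Theta> x))"
  by (simp add: cosE_def E_i E_minus_i complex_eq_iff)

lemma sinE_real: "sinE (of_real x) = of_real (R x * sin (\<Theta> x))"
  by (simp add: sinE_def E_i E_minus_i complex_eq_iff Re_divide Im_divide)

lemma holomorphic_cosE: "cosE holomorphic_on A" and holomorphic_sinE: "sinE holomorphic_on A"
proof -
  have "(\<lambda>v. E (\<i> * v)) holomorphic_on A" "(\<lambda>v. E (- (\<i> * v))) holomorphic_on A"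
    using holomorphic_on_compose_gen[OF _ entire, of "\<lambda>v. \<i> * v" A]
      holomorphic_on_compose_gen[OF _ entire, of "\<lambda>v. - (\<i> * v)" A]
    by (auto simp: o_def intro!: holomorphic_intros)
  then show "cosE holomorphic_on A" "sinE holomorphic_on A"
    unfolding cosE_def[abs_def] sinE_def[abs_def] by (auto intro!: holomorphic_intros)
qed

lemma phase_strict_mono: "x < y \<Longrightarrow> \<Theta> x < \<Theta> y"
  using phase_lower[of x y] a_pos by (smt (verit) arctan_less_iff mult_less_cancel_left_pos)

lemma phase_less_iff: "\<Theta> x < \<Theta> y \<longleftrightarrow> x < y"
  using phase_strict_mono by (metis linorder_less_linear order_less_asym)

lemma phase_eq_iff: "\<Theta> x = \<Theta> y \<longleftrightarrow> x = y"
  using phase_strict_mono by (metis linorder_less_linear order_less_irrefl)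

lemma phase_0 [simp]: "\<Theta> 0 = 0"
  using phase_minus[of 0] by simp

lemma phase_continuous: "continuous_on A \<Theta>"
proof (rule continuous_on_subset[OF _ subset_UNIV], rule lipschitz_on_continuous_on)
  have "\<bar>\<Theta> x - \<Theta> y\<bar> \<le> \<bar>x - y\<bar>" for x y
    using phase_upper[of x y] phase_upper[of y x] phase_strict_mono[of x y] phase_strict_mono[of y x]
    by linarith
  then show "1-lipschitz_on UNIV \<Theta>" by (intro lipschitz_onI) (auto simp: dist_real_def)
qed

lemma phase_surj:
  assumes "0 \<le> t" "t \<le> pi / 2"
  obtains x where "0 \<le> x" "\<Theta> x = t"
proof -
  obtain X where X: "pi / 2 \<le> \<Theta> X" using phase_large by blast
  then have "0 \<le> X" using phase_less_iff[of X 0] by (smt (verit) pi_gt_zero phase_0 divide_pos_pos)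
  then obtain x where "0 \<le> x" "x \<le> X" "\<Theta> x = t"
    using IVT'[of \<Theta> 0 t X] phase_continuous X assms by auto
  then show ?thesis using that by blast
qed

section \<open>Zeros of the combination of \<open>sinE\<close> and \<open>cosE\<close>\<close>

lemma sinE_minus_cosE_real:
  "sinE (of_real x) - of_real \<kappa> * cosE (of_real x) =
     of_real (R x * sin (\<Theta> x - arctan \<kappa>) / cos (arctan \<kappa>))"
proof -
  have "R x * sin (\<Theta> x) - \<kappa> * (R x * cos (\<Theta> x)) = R x * (sin (\<Theta> x) - tan (arctan \<kappa>) * cos (\<Theta> x))"
    by (simp add: tan_arctan algebra_simps)
  also have "\<dots> = R x * sin (\<Theta> x - arctan \<kappa>) / cos (arctan \<kappa>)"
    by (subst sin_minus_tan_times_cos) auto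
  finally show ?thesis
    by (simp add: sinE_real cosE_real flip: of_real_mult of_real_diff)
qed

text \<open>At a root, \<open>E (\<i> * v) * (1 - \<i> * \<kappa>) = E (- (\<i> * v)) * (1 + \<i> *
  \<kappa>)\<close>. The constants are conjugate, so \<open>E\<close> has equal modulus at both
  points, which \<open>norm_less\<close> for \<open>v\<close> or for \<open>- v\<close> forbids off
  the real axis.\<close>

lemma sinE_minus_cosE_root_real:
  assumes "sinE v - of_real \<kappa> * cosE v = 0"
  shows "Im v = 0"
proof -
  have "E (\<i> * v) * (1 - \<i> * of_real \<kappa>) - E (- (\<i> * v)) * (1 + \<i> * of_real \<kappa>) =
      2 * \<i> * (sinE v - of_real \<kappa> * cosE v)"
  proof -
    have "2 * \<i> * sinE v = E (\<i> * v) - E (- (\<i> * v))" "2 * cosE v = E (\<i> * v) + E (- (\<i> * v))"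
      by (simp_all add: sinE_def cosE_def)
    moreover have "2 * \<i> * (sinE v - of_real \<kappa> * cosE v) = 2 * \<i> * sinE v - \<i> * of_real \<kappa> * (2 * cosE v)"
      by (simp add: algebra_simps)
    ultimately show ?thesis by (simp add: algebra_simps)
  qed
  then have "E (\<i> * v) * (1 - \<i> * of_real \<kappa>) = E (- (\<i> * v)) * (1 + \<i> * of_real \<kappa>)"
    using assms by simp
  then have "norm (E (\<i> * v)) * norm (1 - \<i> * of_real \<kappa>) = norm (E (- (\<i> * v))) * norm (1 + \<i> * of_real \<kappa>)"
    by (metis norm_mult)
  moreover have "norm (1 - \<i> * of_real \<kappa>) = norm (1 + \<i> * of_real \<kappa>)"
    by (simp add: cmod_def)
  moreover have "norm (1 + \<i> * of_real \<kappa>) \<noteq> 0"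
    by (simp add: complex_eq_iff)
  ultimately have "norm (E (\<i> * v)) = norm (E (- (\<i> * v)))" by simp
  then show ?thesis using norm_less[of v] norm_less[of "- v"] by fastforce
qed

text \<open>Roots are real, and for \<open>\<bar>x\<bar> \<le> s\<close> oddness and monotonicity of
  the phase put \<open>arctan \<kappa> - \<Theta> x\<close> into
  \<open>[0, 2 * arctan \<kappa>]\<close>, inside \<open>[0, pi)\<close>, where the sine vanishes
  only at 0.\<close>

lemma sinE_minus_cosE_root_unique:
  assumes \<kappa>: "0 < \<kappa>" and s: "0 \<le> s" "\<Theta> s = arctan \<kappa>" and v: "norm v \<le> s"
    and root: "sinE v - of_real \<kappa> * cosE v = 0"
  shows "v = of_real s"
proof -
  define x where "x = Re v"
  have vx: "v = of_real x" using sinE_minus_cosE_root_real[OF root] by (simp add: x_def complex_eq_iff)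
  have x: "\<bar>x\<bar> \<le> s" using v by (simp add: vx)
  have "R x * sin (\<Theta> x - arctan \<kappa>) / cos (arctan \<kappa>) = 0"
    using root unfolding vx sinE_minus_cosE_real by simp
  then have sin0: "sin (\<Theta> x - arctan \<kappa>) = 0" using R_pos[of x] by auto
  have "\<Theta> x \<le> arctan \<kappa>" "- arctan \<kappa> \<le> \<Theta> x"
    using phase_less_iff[of s x] phase_less_iff[of x "- s"] x s phase_minus[of s] by auto
  moreover have "0 < arctan \<kappa>" "arctan \<kappa> < pi / 2" using \<kappa> arctan_ubound[of \<kappa>] by simp_all
  ultimately have "0 \<le> arctan \<kappa> - \<Theta> x" "arctan \<kappa> - \<Theta> x < pi" by auto
  moreover have "sin (arctan \<kappa> - \<Theta> x) = 0" using sin0 by (metis minus_diff_eq sin_minus neg_0_equal_iff_equal)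
  ultimately have "\<Theta> x = arctan \<kappa>" using sin_gt_zero[of "arctan \<kappa> - \<Theta> x"] by fastforce
  then show ?thesis using s phase_eq_iff vx by metis
qed

text \<open>The phase is given by inequalities only, so simplicity comes from a lower bound: right
  of \<open>s\<close> the modulus of the difference quotient dominates a multiple of the one of
  \<open>arctan (a * x)\<close>, whose limit is positive.\<close>

lemma sinE_minus_cosE_root_simple:
  assumes \<kappa>: "0 < \<kappa>" and s: "\<Theta> s = arctan \<kappa>"
  shows "deriv (\<lambda>v. sinE v - of_real \<kappa> * cosE v) (of_real s) \<noteq> 0"
proof
  define D where "D = (\<lambda>v. sinE v - of_real \<kappa> * cosE v)"
  assume "deriv (\<lambda>v. sinE v - of_real \<kappa> * cosE v) (of_real s) = 0"
  moreover have "D holomorphic_on UNIV" unfolding D_def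
    by (intro holomorphic_intros holomorphic_sinE holomorphic_cosE)
  ultimately have "(D has_field_derivative 0) (at (of_real s))"
    using holomorphic_derivI[of D UNIV "of_real s"] by (simp add: D_def)
  then have lim: "((\<lambda>v. (D v - D (of_real s)) / (v - of_real s)) \<longlongrightarrow> 0) (at (of_real s))"
    by (simp add: has_field_derivative_iff)
  have Ds: "D (of_real s) = 0" unfolding D_def sinE_minus_cosE_real by (simp add: s)
  have "filterlim (of_real :: real \<Rightarrow> complex) (at (of_real s)) (at_right s)"
    by (auto simp: filterlim_at eventually_at_filter intro!: tendsto_intros)
  from tendsto_norm_zero[OF filterlim_compose[OF lim this]]
  have upper: "((\<lambda>x. \<bar>R x * sin (\<Theta> x - \<Theta> s) / cos (arctan \<kappa>)\<bar> / \<bar>x - s\<bar>) \<longlongrightarrow> 0) (at_right s)"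
    unfolding Ds unfolding D_def sinE_minus_cosE_real
    by (simp only: diff_0_right of_real_diff[symmetric] norm_divide norm_of_real s)
  \<comment> \<open>The minorant obtained from \<open>phase_lower\<close> and
    \<open>sin t \<ge> t / 2\<close>, which accounts for the 2.\<close>
  define A where "A x = R x / (2 * cos (arctan \<kappa>)) * ((arctan (a * x) - arctan (a * s)) / (x - s))" for x
  have "(A \<longlongrightarrow> R s / (2 * cos (arctan \<kappa>)) * (a / (1 + (a * s)\<^sup>2))) (at_right s)"
  proof -
    have "((\<lambda>x. arctan (a * x)) has_real_derivative a / (1 + (a * s)\<^sup>2)) (at s)"
      by (auto intro!: derivative_eq_intros simp: field_simps)
    then have "((\<lambda>x. (arctan (a * x) - arctan (a * s)) / (x - s)) \<longlongrightarrow> a / (1 + (a * s)\<^sup>2)) (at_right s)"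
      by (auto simp: has_field_derivative_iff intro: tendsto_mono[OF at_le])
    moreover have "((\<lambda>x. R x / (2 * cos (arctan \<kappa>))) \<longlongrightarrow> R s / (2 * cos (arctan \<kappa>))) (at_right s)"
    proof (rule tendsto_divide)
      have "isCont E z" for z using holomorphic_on_imp_continuous_on[OF entire]
        by (simp add: continuous_on_eq_continuous_at)
      moreover have "isCont (\<lambda>x :: real. \<i> * of_real x) s" by (intro continuous_intros)
      ultimately have "isCont (\<lambda>x. E (\<i> * of_real x)) s"
        by (rule isCont_o2[rotated])
      then have "isCont R s" unfolding R_def[abs_def] by (rule continuous_norm)
      then show "(R \<longlongrightarrow> R s) (at_right s)" by (auto simp: isCont_def intro: tendsto_mono[OF at_le])
    qed (auto simp: cos_arctan_not_zero)
    ultimately show ?thesis unfolding A_def[abs_def] by (rule tendsto_mult[rotated])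
  qed
  moreover have "\<forall>\<^sub>F x in at_right s. A x \<le> \<bar>R x * sin (\<Theta> x - \<Theta> s) / cos (arctan \<kappa>)\<bar> / \<bar>x - s\<bar>"
  proof -
    have "\<forall>\<^sub>F x in at_right s. x \<in> {s<..<s + 1}"
      by (rule eventually_at_right_real) simp
    then show ?thesis
    proof eventually_elim
      case (elim x)
      define t where "t = \<Theta> x - \<Theta> s"
      have t: "0 \<le> t" "t \<le> 1" "arctan (a * x) - arctan (a * s) \<le> t"
        using phase_strict_mono[of s x] phase_upper[of s x] phase_lower[of s x] elim by (auto simp: t_def)
      then have half: "(arctan (a * x) - arctan (a * s)) / 2 \<le> sin t"
        using sin_ge_half[of t] by (simp add: field_simps)
      have "0 \<le> sin t" using sin_ge_half[of t] t by linarith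
      have c: "0 < cos (arctan \<kappa>)" by (simp add: cos_arctan add_pos_nonneg)
      have "A x = R x / cos (arctan \<kappa>) / (x - s) * ((arctan (a * x) - arctan (a * s)) / 2)"
        by (simp add: A_def field_simps)
      also have "\<dots> \<le> R x / cos (arctan \<kappa>) / (x - s) * sin t"
        using half by (intro mult_left_mono) (use R_pos[of x] c elim in \<open>auto intro!: divide_nonneg_pos\<close>)
      also have "\<dots> = \<bar>R x * sin (\<Theta> x - \<Theta> s) / cos (arctan \<kappa>)\<bar> / \<bar>x - s\<bar>"
        using R_pos[of x] c elim \<open>0 \<le> sin t\<close> by (simp add: abs_mult flip: t_def)
      finally show ?case .
    qed
  qed
  ultimately have "R s / (2 * cos (arctan \<kappa>)) * (a / (1 + (a * s)\<^sup>2)) \<le> 0"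
    using upper by (intro tendsto_le[OF _ upper]) auto
  moreover have "0 < R s / (2 * cos (arctan \<kappa>)) * (a / (1 + (a * s)\<^sup>2))"
    using R_pos[of s] a_pos
    by (intro mult_pos_pos divide_pos_pos) (auto simp: cos_arctan add_pos_nonneg)
  ultimately show False by linarith
qed

end

section \<open>The entire q-exponentials\<close>

lemma qnum_ge: "1 \<le> q \<Longrightarrow> real k \<le> qnum q k"
  by (induction k) (auto simp: qnum_Suc intro: order_trans[OF _ mult_right_mono[of 1 q]])

lemma qfact_ge_fact: "1 \<le> q \<Longrightarrow> fact n \<le> qfact q n"
proof (induction n)
  case (Suc n)
  have "fact (Suc n) = real (Suc n) * fact n" by simp
  also have "\<dots> \<le> qnum q (Suc n) * qfact q n"
    using Suc qnum_ge[of q "Suc n"] by (intro mult_mono) auto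
  finally show ?case by (simp only: qfact_Suc)
qed simp

definition entire_qexp :: "real \<Rightarrow> complex \<Rightarrow> complex" where
  "entire_qexp Q z = (\<Sum>n. z ^ n / of_real (qfact Q n))"

lemma summable_norm_entire_qexp:
  assumes "1 \<le> Q"
  shows "summable (\<lambda>n. norm (z ^ n / of_real (qfact Q n) :: complex))"
proof (rule summable_comparison_test')
  show "summable (\<lambda>n. norm z ^ n / fact n)"
    using summable_exp_generic[of "norm z"] by (simp add: field_simps)
  show "norm (norm (z ^ n / of_real (qfact Q n))) \<le> norm z ^ n / fact n" for n
    using qfact_ge_fact[OF assms, of n] qfact_pos[of Q n] assms
    by (auto simp: norm_divide norm_power intro!: divide_left_mono mult_pos_pos)
qed

lemma entire_qexp_sums:
  "1 \<le> Q \<Longrightarrow> (\<lambda>n. z ^ n / of_real (qfact Q n)) sums entire_qexp Q z"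
  unfolding entire_qexp_def by (intro summable_sums summable_norm_cancel[OF summable_norm_entire_qexp])

lemma fps_conv_radius_qexp:
  assumes "1 \<le> Q"
  shows "fps_conv_radius (Abs_fps (\<lambda>n. w ^ n / of_real (qfact Q n) :: complex)) = \<infinity>"
proof -
  have "summable (\<lambda>n. w ^ n / of_real (qfact Q n) * z ^ n)" for z
    using summable_norm_cancel[OF summable_norm_entire_qexp[OF assms, of "w * z"]]
    by (simp add: power_mult_distrib)
  then show ?thesis unfolding fps_conv_radius_def by (intro conv_radius_inftyI'') auto
qed

lemma eval_fps_qexp:
  "eval_fps (Abs_fps (\<lambda>n. w ^ n / of_real (qfact Q n))) z = entire_qexp Q (w * z)"
  by (simp add: eval_fps_def entire_qexp_def power_mult_distrib)

lemma entire_qexp_0 [simp]: "entire_qexp Q 0 = 1"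
  using eval_fps_qexp[of 1 Q 0] by (simp add: eval_fps_at_0)

lemma entire_qexp_1: "entire_qexp 1 z = exp z"
  by (simp add: entire_qexp_def qfact_def exp_def scaleR_conv_of_real field_simps)

lemma holomorphic_entire_qexp: "1 \<le> Q \<Longrightarrow> entire_qexp Q holomorphic_on A"
  using holomorphic_on_eval_fps[of A "Abs_fps (\<lambda>n. 1 ^ n / of_real (qfact Q n))"]
  unfolding eval_fps_qexp[abs_def] by (simp add: fps_conv_radius_qexp[of Q 1, simplified])

lemma entire_qexp_cnj: "1 \<le> Q \<Longrightarrow> entire_qexp Q (cnj z) = cnj (entire_qexp Q z)"
  using sums_cnj[THEN iffD2, OF entire_qexp_sums[of Q z]] entire_qexp_sums[of Q "cnj z"]
  by (auto dest: sums_unique2)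

text \<open>The q-difference equation, read off the coefficients:
  \<open>(Q ^ (n + 1) - 1) / [n + 1]_Q! = (Q - 1) / [n]_Q!\<close>. For \<open>Q > 1\<close> its
  iteration yields the product representation.\<close>

lemma entire_qexp_scale:
  assumes "1 \<le> Q"
  shows "entire_qexp Q (of_real Q * z) = (1 + of_real (Q - 1) * z) * entire_qexp Q z"
proof -
  have "of_real (Q ^ Suc n - 1) / of_real (qfact Q (Suc n)) = (of_real (Q - 1) / of_real (qfact Q n) :: complex)" for n
  proof -
    have "Q ^ Suc n - 1 = (Q - 1) * qnum Q (Suc n)"
      using qnum_eq[of Q "Suc n"] by (cases "Q = 1") (auto simp: field_simps)
    moreover have "qnum Q (Suc n) \<noteq> 0" using qnum_Suc_ge_1[of Q n] assms by linarith
    ultimately show ?thesis by (simp only: qfact_Suc of_real_mult) simp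
  qed
  then have *: "(of_real Q * z) ^ Suc n / of_real (qfact Q (Suc n)) - z ^ Suc n / of_real (qfact Q (Suc n))
      = of_real (Q - 1) * z * (z ^ n / of_real (qfact Q n))" for n
  proof -
    have "(of_real Q * z) ^ Suc n / of_real (qfact Q (Suc n)) - z ^ Suc n / of_real (qfact Q (Suc n))
      = of_real (Q ^ Suc n - 1) / of_real (qfact Q (Suc n)) * z ^ Suc n"
      by (simp add: power_mult_distrib field_simps diff_divide_distrib)
    then show ?thesis
      by (simp only: \<open>of_real (Q ^ Suc n - 1) / of_real (qfact Q (Suc n)) = (of_real (Q - 1) / of_real (qfact Q n) :: complex)\<close>) simp
  qed
  let ?d = "\<lambda>n. (of_real Q * z) ^ n / of_real (qfact Q n) - z ^ n / of_real (qfact Q n)"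
  have "?d sums (entire_qexp Q (of_real Q * z) - entire_qexp Q z)"
    by (intro sums_diff entire_qexp_sums assms)
  then have "(\<lambda>n. ?d (Suc n)) sums (entire_qexp Q (of_real Q * z) - entire_qexp Q z)"
    using sums_Suc_iff[of ?d] by simp
  moreover have "(\<lambda>n. ?d (Suc n)) sums (of_real (Q - 1) * z * entire_qexp Q z)"
    unfolding * by (intro sums_mult entire_qexp_sums assms)
  ultimately have "entire_qexp Q (of_real Q * z) - entire_qexp Q z = of_real (Q - 1) * z * entire_qexp Q z"
    by (rule sums_unique2)
  then show ?thesis by (simp add: algebra_simps)
qed

lemma arctan_diff_le: "x \<le> y \<Longrightarrow> arctan y - arctan x \<le> y - x" for x y :: real
proof -
  assume "x \<le> y"
  then have "x - arctan x \<le> y - arctan y"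
  proof (rule DERIV_nonneg_imp_nondecreasing)
    fix t :: real
    show "\<exists>d. ((\<lambda>t. t - arctan t) has_real_derivative d) (at t) \<and> 0 \<le> d"
      by (intro exI[of _ "1 - inverse (1 + t\<^sup>2)"])
        (auto intro!: derivative_eq_intros simp: field_simps add_nonneg_eq_0_iff add_pos_nonneg)
  qed
  then show ?thesis by simp
qed

lemma factor_norm_le:
  assumes "Im v \<le> 0" "0 \<le> b"
  shows "norm (1 + of_real b * (- (\<i> * v))) \<le> norm (1 + of_real b * (\<i> * v))"
proof -
  have "(1 + b * Im v)\<^sup>2 \<le> (1 - b * Im v)\<^sup>2"
    using assms mult_nonneg_nonpos[of b "Im v"] by (simp add: power2_eq_square algebra_simps)
  then show ?thesis by (auto simp: cmod_def intro!: real_sqrt_le_mono)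
qed

section \<open>Product representation and phase of the q-exponential with base above 1\<close>

locale qexp_base =
  fixes p :: real
  assumes p_pos: "0 < p" and p_less_1: "p < 1"
begin

abbreviation E :: "complex \<Rightarrow> complex" where "E \<equiv> entire_qexp (1 / p)"

lemma inverse_p: "1 \<le> 1 / p" using p_pos p_less_1 by simp

lemma E_rec: "E z = (1 + of_real (1 - p) * z) * E (of_real p * z)"
proof -
  have "of_real (1 / p) * (of_real p * z) = z" "of_real (1 / p - 1) * (of_real p * z) = of_real (1 - p) * z"
    using p_pos by (simp_all add: field_simps)
  then show ?thesis using entire_qexp_scale[OF inverse_p, of "of_real p * z"] by simp
qed

lemma E_prod: "E z = (\<Prod>n<N. 1 + of_real ((1 - p) * p ^ n) * z) * E (of_real (p ^ N) * z)"
proof (induction N)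
  case (Suc N)
  then show ?case using E_rec[of "of_real (p ^ N) * z"] by (simp add: mult_ac)
qed simp

lemma E_scaled_tendsto_1: "(\<lambda>N. E (of_real (p ^ N) * z)) \<longlonglongrightarrow> 1"
proof -
  have "isCont E 0" using holomorphic_on_imp_continuous_on[OF holomorphic_entire_qexp[OF inverse_p, of UNIV]]
    by (simp add: continuous_on_eq_continuous_at)
  moreover have "(\<lambda>N. of_real (p ^ N) * z) \<longlonglongrightarrow> of_real 0 * z"
    using p_pos p_less_1 by (intro tendsto_mult tendsto_of_real LIMSEQ_power_zero tendsto_const) auto
  ultimately show ?thesis using isCont_tendsto_compose[of 0 E] by simp
qed

text \<open>Iterating \<open>E_rec\<close> leaves the tail \<open>E (p ^ N * z)\<close>, which tends
  to \<open>E 0 = 1\<close>.\<close>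

lemma E_prod_tendsto: "(\<lambda>N. \<Prod>n<N. 1 + of_real ((1 - p) * p ^ n) * z) \<longlonglongrightarrow> E z"
proof -
  have "\<forall>\<^sub>F N in sequentially. E (of_real (p ^ N) * z) \<noteq> 0"
    using tendsto_imp_eventually_ne[OF E_scaled_tendsto_1, of 0] by simp
  then have "\<forall>\<^sub>F N in sequentially. E z / E (of_real (p ^ N) * z) = (\<Prod>n<N. 1 + of_real ((1 - p) * p ^ n) * z)"
    by eventually_elim (metis E_prod nonzero_mult_div_cancel_right)
  moreover have "(\<lambda>N. E z / E (of_real (p ^ N) * z)) \<longlonglongrightarrow> E z / 1"
    by (intro tendsto_divide tendsto_const E_scaled_tendsto_1) simp
  ultimately show ?thesis using Lim_transform_eventually by fastforce
qed

lemma E_nonzero: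
  assumes "\<And>n. 1 + of_real ((1 - p) * p ^ n) * z \<noteq> 0"
  shows "E z \<noteq> 0"
proof -
  have "\<forall>\<^sub>F N in sequentially. E (of_real (p ^ N) * z) \<noteq> 0"
    using tendsto_imp_eventually_ne[OF E_scaled_tendsto_1, of 0] by simp
  then obtain N where "E (of_real (p ^ N) * z) \<noteq> 0" by (auto simp: eventually_sequentially)
  then show ?thesis using assms by (subst E_prod[of z N]) simp
qed

lemma E_norm_le:
  assumes "Im v \<le> 0"
  shows "norm (E (- (\<i> * v))) \<le> norm (E (\<i> * v))"
proof (rule tendsto_le[OF sequentially_bot tendsto_norm[OF E_prod_tendsto] tendsto_norm[OF E_prod_tendsto]])
  show "\<forall>\<^sub>F N in sequentially. norm (\<Prod>n<N. 1 + of_real ((1 - p) * p ^ n) * (- (\<i> * v)))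
      \<le> norm (\<Prod>n<N. 1 + of_real ((1 - p) * p ^ n) * (\<i> * v))"
    unfolding prod_norm[symmetric]
    by (intro always_eventually allI prod_mono conjI factor_norm_le assms) (use p_pos p_less_1 in auto)
qed

text \<open>The limit of factorwise inequalities gives only \<open>E_norm_le\<close>. Strictness
  comes from splitting off the first factor; this needs the remaining factor
  \<open>E (\<i> * w)\<close> to be nonzero.\<close>

lemma E_norm_less:
  assumes "Im v < 0"
  shows "norm (E (- (\<i> * v))) < norm (E (\<i> * v))"
proof -
  define w where "w = of_real p * v"
  have Imw: "Im w \<le> 0" using assms p_pos by (simp add: w_def mult_nonneg_nonpos)
  have "E (\<i> * w) \<noteq> 0"
  proof (rule E_nonzero)
    fix n
    have "0 \<le> (1 - p) * p ^ n * (- Im w)" using Imw p_pos p_less_1 by (intro mult_nonneg_nonneg) auto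
    then have "Re (1 + of_real ((1 - p) * p ^ n) * (\<i> * w)) \<noteq> 0" by simp
    then show "1 + of_real ((1 - p) * p ^ n) * (\<i> * w) \<noteq> 0" by (metis zero_complex.sel(1))
  qed
  have strict: "norm (1 + of_real (1 - p) * (- (\<i> * v))) < norm (1 + of_real (1 - p) * (\<i> * v))"
  proof -
    have "(1 - p) * Im v < 0" using assms p_less_1 by (simp add: mult_pos_neg)
    then have "(1 + (1 - p) * Im v)\<^sup>2 < (1 - (1 - p) * Im v)\<^sup>2"
      by (simp add: power2_eq_square algebra_simps)
    then show ?thesis by (auto simp: cmod_def intro!: real_sqrt_less_mono)
  qed
  have "norm (E (- (\<i> * v))) = norm (1 + of_real (1 - p) * (- (\<i> * v))) * norm (E (- (\<i> * w)))"
    by (subst E_rec) (simp add: w_def norm_mult mult_ac)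
  also have "\<dots> \<le> norm (1 + of_real (1 - p) * (- (\<i> * v))) * norm (E (\<i> * w))"
    by (intro mult_left_mono E_norm_le Imw) simp
  also have "\<dots> < norm (1 + of_real (1 - p) * (\<i> * v)) * norm (E (\<i> * w))"
    using strict \<open>E (\<i> * w) \<noteq> 0\<close> by (intro mult_strict_right_mono) auto
  also have "\<dots> = norm (E (\<i> * v))"
    by (subst (2) E_rec) (simp add: w_def norm_mult mult_ac)
  finally show ?thesis .
qed

text \<open>A factor \<open>1 + \<i> * t\<close> with real \<open>t\<close> has argument
  \<open>arctan t\<close>; the phase is the sum of the arguments of all factors.\<close>

definition \<Theta> :: "real \<Rightarrow> real" where
  "\<Theta> x = (\<Sum>n. arctan ((1 - p) * p ^ n * x))"

lemma sums_weights: "(\<lambda>n. (1 - p) * p ^ n) sums 1"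
  using sums_mult[OF geometric_sums[of p], of "1 - p"] p_pos p_less_1 by simp

lemma weight_pos: "0 < (1 - p) * p ^ n"
  using p_pos p_less_1 by simp

lemma summable_phase: "summable (\<lambda>n. arctan ((1 - p) * p ^ n * x))"
proof (rule summable_comparison_test')
  show "summable (\<lambda>n. (1 - p) * p ^ n * \<bar>x\<bar>)"
    using sums_summable[OF sums_weights] by (intro summable_mult2)
  show "norm (arctan ((1 - p) * p ^ n * x)) \<le> (1 - p) * p ^ n * \<bar>x\<bar>" for n
    using abs_arctan_le[of "(1 - p) * p ^ n * x"] p_pos p_less_1 by (simp add: abs_mult)
qed

lemma phase_function: "phase_function E \<Theta> (1 - p)"
proof
  show "E holomorphic_on UNIV" by (rule holomorphic_entire_qexp[OF inverse_p])
  show "norm (E (- (\<i> * v))) < norm (E (\<i> * v))" if "Im v < 0" for v by (rule E_norm_less[OF that])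
  show "E (cnj z) = cnj (E z)" for z by (rule entire_qexp_cnj[OF inverse_p])
  show "0 < 1 - p" using p_less_1 by simp
  show "E (\<i> * of_real x) \<noteq> 0" for x
    by (rule E_nonzero) (simp add: complex_eq_iff)
  show "\<Theta> (- x) = - \<Theta> x" for x
    unfolding \<Theta>_def using suminf_minus[OF summable_phase[of x]] by (simp add: arctan_minus)
  \<comment> \<open>Polar form of the finite products, then the limit. Arguments are added as real
    numbers, so no branch has to be chosen.\<close>
  show "E (\<i> * of_real x) = of_real (norm (E (\<i> * of_real x))) * cis (\<Theta> x)" for x
  proof -
    let ?P = "\<lambda>N. \<Prod>n<N. 1 + of_real ((1 - p) * p ^ n) * (\<i> * of_real x)"
    have factor: "1 + \<i> * of_real t = of_real (norm (1 + \<i> * of_real t)) * cis (arctan t)" for t :: real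
    proof -
      have "norm (1 + \<i> * of_real t) = sqrt (1 + t\<^sup>2)" by (simp add: cmod_def)
      moreover have "0 < 1 + t\<^sup>2" by (simp add: add_pos_nonneg)
      ultimately show ?thesis by (simp add: complex_eq_iff cos_arctan sin_arctan)
    qed
    have "?P N = of_real (norm (?P N)) * cis (\<Sum>n<N. arctan ((1 - p) * p ^ n * x))" for N
    proof (induction N)
      case (Suc N)
      have "1 + of_real ((1 - p) * p ^ N) * (\<i> * of_real x) = 1 + \<i> * of_real ((1 - p) * p ^ N * x)"
        by (simp add: mult_ac)
      also note factor
      finally have "1 + of_real ((1 - p) * p ^ N) * (\<i> * of_real x) =
          of_real (norm (1 + of_real ((1 - p) * p ^ N) * (\<i> * of_real x))) * cis (arctan ((1 - p) * p ^ N * x))"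
        by (simp add: mult_ac)
      from arg_cong2[OF Suc this, of "(*)"] show ?case
        by (simp add: norm_mult cis_mult[symmetric] mult_ac)
    qed simp
    note polar = this
    have "(\<lambda>N. of_real (norm (?P N)) * cis (\<Sum>n<N. arctan ((1 - p) * p ^ n * x))) \<longlonglongrightarrow>
        of_real (norm (E (\<i> * of_real x))) * cis (\<Theta> x)"
    proof (intro tendsto_mult tendsto_of_real tendsto_norm E_prod_tendsto)
      have "isCont cis (\<Theta> x)" by (simp add: cis_conv_exp[abs_def])
      then show "(\<lambda>N. cis (\<Sum>n<N. arctan ((1 - p) * p ^ n * x))) \<longlonglongrightarrow> cis (\<Theta> x)"
        unfolding \<Theta>_def by (rule isCont_tendsto_compose[OF _ summable_LIMSEQ[OF summable_phase]])
    qed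
    then have "?P \<longlonglongrightarrow> of_real (norm (E (\<i> * of_real x))) * cis (\<Theta> x)"
      by (rule Lim_transform_eventually) (intro always_eventually allI polar[symmetric])
    with E_prod_tendsto show ?thesis by (rule LIMSEQ_unique)
  qed
  show "arctan ((1 - p) * y) - arctan ((1 - p) * x) \<le> \<Theta> y - \<Theta> x" if "x \<le> y" for x y
  proof -
    have "(\<Sum>n\<in>{0}. arctan ((1 - p) * p ^ n * y) - arctan ((1 - p) * p ^ n * x)) \<le>
        (\<Sum>n. arctan ((1 - p) * p ^ n * y) - arctan ((1 - p) * p ^ n * x))"
    proof (intro sum_le_suminf summable_diff summable_phase)
      fix n
      have "(1 - p) * p ^ n * x \<le> (1 - p) * p ^ n * y"
        using that weight_pos[of n] by (intro mult_left_mono) auto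
      then show "0 \<le> arctan ((1 - p) * p ^ n * y) - arctan ((1 - p) * p ^ n * x)"
        using arctan_le_iff by fastforce
    qed simp
    then show ?thesis by (simp add: \<Theta>_def suminf_diff summable_phase)
  qed
  \<comment> \<open>\<open>arctan\<close> is 1-Lipschitz and the weights
    \<open>(1 - p) * p ^ n\<close> sum to 1.\<close>
  show "\<Theta> y - \<Theta> x \<le> y - x" if "x \<le> y" for x y
  proof -
    have "\<Theta> y - \<Theta> x = (\<Sum>n. arctan ((1 - p) * p ^ n * y) - arctan ((1 - p) * p ^ n * x))"
      by (simp add: \<Theta>_def suminf_diff summable_phase)
    also have "\<dots> \<le> (\<Sum>n. (1 - p) * p ^ n * (y - x))"
    proof (intro suminf_le summable_diff summable_phase summable_mult2 sums_summable[OF sums_weights])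
      fix n
      have "(1 - p) * p ^ n * x \<le> (1 - p) * p ^ n * y"
        using that weight_pos[of n] by (intro mult_left_mono) auto
      from arctan_diff_le[OF this]
      show "arctan ((1 - p) * p ^ n * y) - arctan ((1 - p) * p ^ n * x) \<le> (1 - p) * p ^ n * (y - x)"
        by (simp add: algebra_simps)
    qed
    also have "\<dots> = y - x" using sums_unique[OF sums_mult2[OF sums_weights, of "y - x"]] by simp
    finally show ?thesis .
  qed
  show "\<exists>x. pi / 2 \<le> \<Theta> x"
  proof
    \<comment> \<open>Here the terms \<open>n = 0\<close> and \<open>n = 1\<close> are
      \<open>arctan (1 / p)\<close> and \<open>arctan 1\<close>, each at least
      \<open>pi / 4\<close>.\<close>
    let ?x = "1 / ((1 - p) * p)"
    have "pi / 4 \<le> arctan (1 / p)" using p_pos p_less_1 by (simp flip: arctan_one add: arctan_le_iff)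
    then have "pi / 2 \<le> (\<Sum>n<2. arctan ((1 - p) * p ^ n * ?x))"
      using p_pos p_less_1 by (simp add: numeral_2_eq_2 arctan_one)
    also have "\<dots> \<le> \<Theta> ?x"
      unfolding \<Theta>_def using p_pos p_less_1 by (intro sum_le_suminf summable_phase) auto
    finally show "pi / 2 \<le> \<Theta> ?x" .
  qed
qed

text \<open>Factor by factor, the product defining \<open>qexp p z\<close> is the reciprocal of the
  one for \<open>E (- z)\<close>.\<close>

lemma qexp_eq_inverse:
  assumes "E (- z) \<noteq> 0"
  shows "qexp p z = 1 / E (- z)"
proof -
  have "(\<lambda>N. 1 / (\<Prod>n<N. 1 + of_real ((1 - p) * p ^ n) * (- z))) \<longlonglongrightarrow> 1 / E (- z)"
    by (intro tendsto_divide tendsto_const E_prod_tendsto assms)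
  then have "(\<lambda>N. \<Prod>n<N. 1 / (1 - z * of_real ((1 - p) * p ^ n))) \<longlonglongrightarrow> 1 / E (- z)"
    by (simp add: prod_dividef mult.commute)
  then have "prodinf (\<lambda>n. 1 / (1 - z * of_real ((1 - p) * p ^ n))) = 1 / E (- z)"
    by (rule prodinf_eq_prod_lim') (use assms in simp)
  then show ?thesis using p_less_1 by (simp add: qexp_def)
qed

end

lemma phase_function_exp: "phase_function (entire_qexp 1) (\<lambda>x. x) 1"
proof
  show "norm (entire_qexp 1 (- (\<i> * v))) < norm (entire_qexp 1 (\<i> * v))" if "Im v < 0" for v
    using that by (simp add: entire_qexp_1)
  show "entire_qexp 1 (\<i> * of_real x) = of_real (norm (entire_qexp 1 (\<i> * of_real x))) * cis x" for x
    by (simp add: entire_qexp_1 cis_conv_exp)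
  show "arctan (1 * y) - arctan (1 * x) \<le> y - x" if "x \<le> y" for x y :: real
    using arctan_diff_le[OF that] by simp
  show "\<exists>x. pi / 2 \<le> x" by (rule exI[of _ "pi / 2"]) simp
qed (auto simp: entire_qexp_1 holomorphic_entire_qexp exp_cnj)

section \<open>The q-trigonometric functions and the residue\<close>

text \<open>The half sum cancels the odd terms, the half difference the even ones. The free weight
  \<open>w\<close> serves the one-variable and the two-variable functions alike.\<close>

lemma sums_even_odd:
  fixes w :: "nat \<Rightarrow> complex"
  assumes A: "(\<lambda>n. (\<i> * z) ^ n * w n) sums A" and B: "(\<lambda>n. (- (\<i> * z)) ^ n * w n) sums B"
  shows "(\<lambda>j. (-1) ^ j * z ^ (2 * j) * w (2 * j)) sums ((A + B) / 2)"
    and "(\<lambda>j. (-1) ^ j * z ^ (2 * j + 1) * w (2 * j + 1)) sums ((A - B) / (2 * \<i>))"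
proof -
  have i2: "(\<i> * z) ^ (2 * j) = (-1) ^ j * z ^ (2 * j)" "(- (\<i> * z)) ^ (2 * j) = (-1) ^ j * z ^ (2 * j)" for j
  proof -
    have "(\<i> * z)\<^sup>2 = - (z\<^sup>2)" "(- (\<i> * z))\<^sup>2 = - (z\<^sup>2)" by (simp_all add: power_mult_distrib)
    then show "(\<i> * z) ^ (2 * j) = (-1) ^ j * z ^ (2 * j)" "(- (\<i> * z)) ^ (2 * j) = (-1) ^ j * z ^ (2 * j)"
      by (simp_all only: power_mult power_minus[of "z\<^sup>2"])
  qed
  have "(\<lambda>n. ((\<i> * z) ^ n * w n + (- (\<i> * z)) ^ n * w n) / 2) sums ((A + B) / 2)"
    by (intro sums_divide sums_add A B)
  moreover have "strict_mono (\<lambda>j::nat. 2 * j)" by (auto simp: strict_mono_def)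
  moreover have "((\<i> * z) ^ n * w n + (- (\<i> * z)) ^ n * w n) / 2 = 0" if "n \<notin> range (\<lambda>j. 2 * j)" for n
    using that by (cases "even n") (auto elim!: evenE)
  ultimately have "(\<lambda>j. ((\<i> * z) ^ (2 * j) * w (2 * j) + (- (\<i> * z)) ^ (2 * j) * w (2 * j)) / 2) sums ((A + B) / 2)"
    by (subst sums_mono_reindex[of "\<lambda>j. 2 * j"]) auto
  then show "(\<lambda>j. (-1) ^ j * z ^ (2 * j) * w (2 * j)) sums ((A + B) / 2)"
    by (simp only: i2) (simp add: field_simps)
  have "(\<lambda>n. ((\<i> * z) ^ n * w n - (- (\<i> * z)) ^ n * w n) / (2 * \<i>)) sums ((A - B) / (2 * \<i>))"
    by (intro sums_divide sums_diff A B)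
  moreover have "strict_mono (\<lambda>j::nat. 2 * j + 1)" by (auto simp: strict_mono_def)
  moreover have "((\<i> * z) ^ n * w n - (- (\<i> * z)) ^ n * w n) / (2 * \<i>) = 0" if "n \<notin> range (\<lambda>j. 2 * j + 1)" for n
    using that by (cases "even n") (auto elim!: oddE)
  ultimately have "(\<lambda>j. ((\<i> * z) ^ (2 * j + 1) * w (2 * j + 1) - (- (\<i> * z)) ^ (2 * j + 1) * w (2 * j + 1)) / (2 * \<i>))
      sums ((A - B) / (2 * \<i>))"
    by (subst sums_mono_reindex[of "\<lambda>j. 2 * j + 1"]) auto
  moreover have "((\<i> * z) ^ (2 * j + 1) * w (2 * j + 1) - (- (\<i> * z)) ^ (2 * j + 1) * w (2 * j + 1)) / (2 * \<i>)
      = (-1) ^ j * z ^ (2 * j + 1) * w (2 * j + 1)" for j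
    by (simp only: power_add power_one_right i2) (simp add: field_simps)
  ultimately show "(\<lambda>j. (-1) ^ j * z ^ (2 * j + 1) * w (2 * j + 1)) sums ((A - B) / (2 * \<i>))"
    by (simp only:)
qed

text \<open>For \<open>q < 1\<close> the values of \<open>qexp q\<close> at \<open>\<i> * v\<close>
  and \<open>- (\<i> * v)\<close> are reciprocals of values of \<open>E\<close>, so the q-cosine and
  q-sine are \<open>cosE\<close> and \<open>sinE\<close> over one common product. Isolating it as
  \<open>W\<close> treats all \<open>q\<close> alike; the equations are imposed off the
  poles.\<close>

locale qtrig_phase = phase_function +
  fixes q :: real and W :: "complex \<Rightarrow> complex"
  assumes W_eq: "W v = (if q < 1 then 1 / (E (\<i> * v) * E (- (\<i> * v))) else 1)"
    and qcos_eq: "E (\<i> * v) \<noteq> 0 \<Longrightarrow> E (- (\<i> * v)) \<noteq> 0 \<Longrightarrow> qcos q v = W v * cosE v"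
    and qsin_eq: "E (\<i> * v) \<noteq> 0 \<Longrightarrow> E (- (\<i> * v)) \<noteq> 0 \<Longrightarrow> qsin q v = W v * sinE v"
begin

lemma nonzero': "E (- (\<i> * of_real x)) \<noteq> 0"
  using nonzero[of "- x"] by simp

lemma W_nonzero: "E (\<i> * v) \<noteq> 0 \<Longrightarrow> E (- (\<i> * v)) \<noteq> 0 \<Longrightarrow> W v \<noteq> 0"
  by (simp add: W_eq)

lemma W_minus: "W (- v) = W v"
  by (simp add: W_eq)

lemma cosE_minus: "cosE (- v) = cosE v" and sinE_minus: "sinE (- v) = - sinE v"
  by (simp_all add: cosE_def sinE_def field_simps)

text \<open>On the real axis \<open>W\<close> is the inverse square of \<open>R\<close>, which
  leaves the parts of \<open>cis (\<Theta> x) / R x\<close>, that is of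
  \<open>1 / E (- (\<i> * x))\<close>. The negative argument anticipates
  \<open>u * z0 = - s\<close>.\<close>

lemma qtrig_real_less_1:
  assumes "q < 1"
  shows "qcos q (of_real (- x)) = of_real (Re (1 / E (- (\<i> * of_real x))))"
    and "qsin q (of_real (- x)) = - of_real (Im (1 / E (- (\<i> * of_real x))))"
proof -
  have W: "W (of_real (- x)) = of_real (1 / (R x * R x))"
  proof -
    have "W (of_real (- x)) = 1 / (E (\<i> * of_real x) * E (- (\<i> * of_real x)))"
      using assms by (simp add: W_minus W_eq)
    also have "E (\<i> * of_real x) * E (- (\<i> * of_real x)) = of_real (R x * R x) * (cis (\<Theta> x) * cis (- \<Theta> x))"
      by (simp add: E_i E_minus_i del: cis_inverse)
    finally show ?thesis by (simp add: cis_mult)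
  qed
  have inv: "1 / E (- (\<i> * of_real x)) = of_real (1 / R x) * cis (\<Theta> x)"
    by (simp add: E_minus_i divide_inverse cis_inverse)
  have nz: "E (\<i> * of_real (- x)) \<noteq> 0" "E (- (\<i> * of_real (- x))) \<noteq> 0"
    by (rule nonzero nonzero')+
  show "qcos q (of_real (- x)) = of_real (Re (1 / E (- (\<i> * of_real x))))"
    unfolding qcos_eq[OF nz] W cosE_real inv
    using R_pos[of "- x"] R_pos[of x] by (simp add: phase_minus R_minus flip: of_real_mult of_real_divide)
  show "qsin q (of_real (- x)) = - of_real (Im (1 / E (- (\<i> * of_real x))))"
    unfolding qsin_eq[OF nz] W sinE_real inv
    using R_pos[of "- x"] R_pos[of x] by (simp add: phase_minus R_minus flip: of_real_mult of_real_divide of_real_minus)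
qed

lemma qcos_real_eq_0_iff: "qcos q (of_real x) = 0 \<longleftrightarrow> cos (\<Theta> x) = 0"
  using R_pos[of x] W_nonzero[OF nonzero nonzero', of x] qcos_eq[OF nonzero nonzero', of x]
  by (simp add: cosE_real)

lemma qtan_real: "qtan q (of_real x) = of_real (tan (\<Theta> x))"
  using R_pos[of x] W_nonzero[OF nonzero nonzero', of x]
  by (simp add: qtan_def qcos_eq qsin_eq nonzero nonzero' cosE_real sinE_real tan_def)

lemma phase_zc: "0 < zc q" "\<Theta> (zc q) = pi / 2"
proof -
  obtain x where x: "0 \<le> x" "\<Theta> x = pi / 2"
    using phase_surj[of "pi / 2"] by auto
  have "0 < x" using x phase_0 by (cases "x = 0") auto
  have "zc q = x"
    unfolding zc_def
  proof (rule Least_equality)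
    show "0 < x \<and> qcos q (of_real x) = 0" using \<open>0 < x\<close> by (simp add: qcos_real_eq_0_iff x(2))
    fix y assume y: "0 < y \<and> qcos q (of_real y) = 0"
    show "x \<le> y"
    proof (rule ccontr)
      assume "\<not> x \<le> y"
      then have "0 < \<Theta> y" "\<Theta> y < pi / 2"
        using y x phase_less_iff[of 0 y] phase_less_iff[of y x] by auto
      then have "0 < cos (\<Theta> y)" by (rule cos_gt_zero)
      then show False using y by (simp add: qcos_real_eq_0_iff)
    qed
  qed
  then show "0 < zc q" "\<Theta> (zc q) = pi / 2" using x \<open>0 < x\<close> by auto
qed

text \<open>On the real axis \<open>qtan\<close> is \<open>tan \<circ> \<Theta>\<close>, and
  \<open>\<Theta>\<close> maps \<open>[0, zc q)\<close> into \<open>[0, pi / 2)\<close>; inverting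
  \<open>qtan\<close> there amounts to solving \<open>\<Theta> x = arctan t\<close>.\<close>

lemma phase_qarctan:
  assumes "0 \<le> t"
  shows "\<Theta> (qarctan q t) = arctan t" and "0 \<le> qarctan q t"
proof -
  have at: "0 \<le> arctan t" "arctan t < pi / 2" using assms arctan_ubound[of t] by simp_all
  obtain x where x: "0 \<le> x" "\<Theta> x = arctan t"
    using phase_surj[of "arctan t"] at by auto
  have range: "0 \<le> \<Theta> x \<and> \<Theta> x < pi / 2" if "x \<in> {0..<zc q}" for x
    using that phase_less_iff[of x 0] phase_less_iff[of x "zc q"] phase_zc by auto
  have "inj_on (\<lambda>x. qtan q (of_real x)) {0..<zc q}"
  proof (rule inj_onI)
    fix x y assume xy: "x \<in> {0..<zc q}" "y \<in> {0..<zc q}" "qtan q (of_real x) = qtan q (of_real y)"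
    then have "tan (\<Theta> x) = tan (\<Theta> y)" by (simp add: qtan_real)
    moreover have "arctan (tan (\<Theta> x)) = \<Theta> x" "arctan (tan (\<Theta> y)) = \<Theta> y"
      using range[OF xy(1)] range[OF xy(2)] pi_gt_zero by (auto intro!: arctan_tan simp del: pi_gt_zero)
    ultimately have "\<Theta> x = \<Theta> y" by metis
    then show "x = y" by (simp add: phase_eq_iff)
  qed
  moreover have "x \<in> {0..<zc q}" using x at phase_zc phase_less_iff[of x "zc q"] by simp
  moreover have "qtan q (of_real x) = of_real t" using x by (simp add: qtan_real tan_arctan)
  ultimately have "qarctan q t = x" unfolding qarctan_def by (intro the_inv_into_f_eq)
  then show "\<Theta> (qarctan q t) = arctan t" "0 \<le> qarctan q t" using x by simp_all
qed

section \<open>The quotient \<open>N / g\<close> and its residue\<close>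

context
  fixes \<kappa> \<rho> s :: real
  assumes kappa: "0 < \<kappa>" and rho: "0 < \<rho>" and s: "\<Theta> s = arctan \<kappa>"
begin

text \<open>Entire substitutes for \<open>g\<close> and \<open>N\<close>: off the poles
  \<open>g z = - (W / \<kappa>) * den z\<close> and \<open>N z = W * num z\<close>, with
  \<open>W\<close> taken at \<open>\<rho> * z\<close>.\<close>

definition den :: "complex \<Rightarrow> complex" where
  "den z = sinE (of_real \<rho> * z) - of_real \<kappa> * cosE (of_real \<rho> * z)"

definition num :: "complex \<Rightarrow> complex" where
  "num z = cosE (of_real \<rho> * z) + of_real \<kappa> * sinE (of_real \<rho> * z)"

lemma holomorphic_den: "den holomorphic_on A" and holomorphic_num: "num holomorphic_on A"
proof -
  have "(\<lambda>z. sinE (of_real \<rho> * z)) holomorphic_on A" "(\<lambda>z. cosE (of_real \<rho> * z)) holomorphic_on A"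
    using holomorphic_on_compose_gen[OF _ holomorphic_sinE, of "\<lambda>z. of_real \<rho> * z" A UNIV]
      holomorphic_on_compose_gen[OF _ holomorphic_cosE, of "\<lambda>z. of_real \<rho> * z" A UNIV]
    by (auto simp: o_def intro!: holomorphic_intros)
  then show "den holomorphic_on A" "num holomorphic_on A"
    unfolding den_def[abs_def] num_def[abs_def] by (auto intro!: holomorphic_intros)
qed

lemma den_root: "den (of_real (s / \<rho>)) = 0"
  using rho s sinE_minus_cosE_real[of s \<kappa>] by (simp add: den_def)

lemma sinE_root: "sinE (of_real s) = of_real \<kappa> * cosE (of_real s)"
  using s sinE_minus_cosE_real[of s \<kappa>] by simp

lemma num_root: "num (of_real (s / \<rho>)) = (1 + of_real (\<kappa>\<^sup>2)) * cosE (of_real s)"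
  using rho by (simp add: num_def sinE_root algebra_simps power2_eq_square)

lemma cosE_root_nonzero: "cosE (of_real s) \<noteq> 0"
  using R_pos[of s] by (simp add: cosE_real s)

lemma den_root_unique:
  assumes "norm z \<le> norm (of_real (s / \<rho>) :: complex)" "den z = 0"
  shows "z = of_real (s / \<rho>)"
proof -
  have "0 < \<Theta> s" using s kappa by simp
  then have "0 \<le> s" using phase_less_iff[of 0 s] by simp
  moreover have "norm (of_real \<rho> * z) \<le> s"
  proof -
    have "norm z \<le> s / \<rho>" using assms(1) rho \<open>0 \<le> s\<close> by (simp only: norm_of_real) simp
    then show ?thesis using rho by (simp add: norm_mult field_simps)
  qed
  ultimately have "of_real \<rho> * z = of_real s"
    using sinE_minus_cosE_root_unique[OF kappa _ s] assms(2) by (simp add: den_def)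
  then show ?thesis using rho by (simp add: field_simps)
qed

lemma den_root_simple: "deriv den (of_real (s / \<rho>)) \<noteq> 0"
proof -
  define D where "D = (\<lambda>v. sinE v - of_real \<kappa> * cosE v)"
  have "D holomorphic_on UNIV" unfolding D_def
    by (intro holomorphic_intros holomorphic_sinE holomorphic_cosE)
  then have "(D has_field_derivative deriv D (of_real s)) (at (of_real \<rho> * of_real (s / \<rho>)))"
    using holomorphic_derivI[of D UNIV "of_real s"] rho by simp
  moreover have "((\<lambda>z. of_real \<rho> * z) has_field_derivative of_real \<rho>) (at (of_real (s / \<rho>) :: complex))"
    by (auto intro!: derivative_eq_intros)
  ultimately have "((\<lambda>z. D (of_real \<rho> * z)) has_field_derivative deriv D (of_real s) * of_real \<rho>) (at (of_real (s / \<rho>)))"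
    by (rule DERIV_chain2)
  then have "deriv den (of_real (s / \<rho>)) = deriv D (of_real s) * of_real \<rho>"
    unfolding den_def[abs_def] by (simp add: D_def DERIV_imp_deriv)
  then show ?thesis using sinE_minus_cosE_root_simple[OF kappa s] rho by (simp add: D_def)
qed

lemma quotient_residue:
  fixes g N :: "complex \<Rightarrow> complex" and z0 :: complex
  defines "z0 \<equiv> of_real (s / \<rho>)"
  assumes g: "g = (\<lambda>z. qcos q (of_real (- \<rho>) * z) + of_real (1 / \<kappa>) * qsin q (of_real (- \<rho>) * z))"
    and N: "N = (\<lambda>z. qcos q (of_real (- \<rho>) * z) - of_real \<kappa> * qsin q (of_real (- \<rho>) * z))"
  shows "((\<lambda>z. (z0 - z) * (N z / g z)) \<longlongrightarrow> of_real \<kappa> * num z0 / deriv den z0) (at z0)"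
    and "g field_differentiable (at z0)"
    and "- N z0 / deriv g z0 = of_real \<kappa> * num z0 / deriv den z0"
proof -
  \<comment> \<open>On this open set the common factor is holomorphic and nonzero, and it cancels
    from \<open>N / g\<close>.\<close>
  define U where "U = {z. E (\<i> * (of_real \<rho> * z)) \<noteq> 0 \<and> E (- (\<i> * (of_real \<rho> * z))) \<noteq> 0}"
  have E1: "(\<lambda>z. E (\<i> * (of_real \<rho> * z))) holomorphic_on A" "(\<lambda>z. E (- (\<i> * (of_real \<rho> * z)))) holomorphic_on A" for A
  proof -
    have "(\<lambda>z. \<i> * (of_real \<rho> * z)) holomorphic_on A" "(\<lambda>z. - (\<i> * (of_real \<rho> * z))) holomorphic_on A"
      by (intro holomorphic_intros)+
    then show "(\<lambda>z. E (\<i> * (of_real \<rho> * z))) holomorphic_on A" "(\<lambda>z. E (- (\<i> * (of_real \<rho> * z)))) holomorphic_on A"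
      using holomorphic_on_compose_gen[OF _ entire, of "\<lambda>z. \<i> * (of_real \<rho> * z)" A]
        holomorphic_on_compose_gen[OF _ entire, of "\<lambda>z. - (\<i> * (of_real \<rho> * z))" A]
      by (simp_all add: o_def)
  qed
  have "open U"
    unfolding U_def by (intro open_Collect_conj open_Collect_neq continuous_on_const holomorphic_on_imp_continuous_on E1)
  have "z0 \<in> U" using rho nonzero[of s] nonzero'[of s] by (simp add: U_def z0_def)
  have kz: "of_real \<kappa> \<noteq> (0 :: complex)" using kappa by simp
  define V where "V z = W (of_real \<rho> * z)" for z
  have V0: "V z \<noteq> 0" if "z \<in> U" for z using that W_nonzero by (simp add: U_def V_def)
  have eqs: "qcos q (of_real (- \<rho>) * z) = V z * cosE (of_real \<rho> * z)"
    "qsin q (of_real (- \<rho>) * z) = - (V z * sinE (of_real \<rho> * z))" if "z \<in> U" for z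
    using that qcos_eq[of "- (of_real \<rho> * z)"] qsin_eq[of "- (of_real \<rho> * z)"]
    by (simp_all add: U_def V_def W_minus cosE_minus sinE_minus)
  have gU: "g z = - (1 / of_real \<kappa>) * V z * den z" if "z \<in> U" for z
    unfolding g eqs[OF that] using kz by (simp add: den_def field_simps)
  have NU: "N z = V z * num z" if "z \<in> U" for z
    unfolding N eqs[OF that] by (simp add: num_def field_simps)
  have den': "(den has_field_derivative deriv den z0) (at z0)"
    using holomorphic_den[of UNIV] by (intro holomorphic_derivI) auto
  have den0: "den z0 = 0" using den_root by (simp add: z0_def)
  have dden: "deriv den z0 \<noteq> 0" using den_root_simple by (simp add: z0_def)
  have "V holomorphic_on U"
    unfolding V_def[abs_def] W_eq
    by (cases "q < 1") (auto simp: U_def intro!: holomorphic_intros E1)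
  then have V': "(V has_field_derivative deriv V z0) (at z0)"
    using \<open>open U\<close> \<open>z0 \<in> U\<close> by (rule holomorphic_derivI)
  \<comment> \<open>In the product rule the term with the derivative of \<open>V\<close> drops out,
    as \<open>den z0 = 0\<close>.\<close>
  have "((\<lambda>z. - (1 / of_real \<kappa>) * V z * den z) has_field_derivative - (1 / of_real \<kappa>) * V z0 * deriv den z0) (at z0)"
    by (rule derivative_eq_intros V' den' refl | simp add: den0)+
  then have g': "(g has_field_derivative - (1 / of_real \<kappa>) * V z0 * deriv den z0) (at z0)"
    by (rule has_field_derivative_transform_within_open[OF _ \<open>open U\<close> \<open>z0 \<in> U\<close>]) (simp add: gU)
  then show "g field_differentiable (at z0)" unfolding field_differentiable_def by blast
  show "- N z0 / deriv g z0 = of_real \<kappa> * num z0 / deriv den z0"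
    using V0[OF \<open>z0 \<in> U\<close>] kz dden by (simp add: DERIV_imp_deriv[OF g'] NU[OF \<open>z0 \<in> U\<close>] field_simps)
  have "((\<lambda>z. of_real \<kappa> * num z / ((den z - den z0) / (z - z0))) \<longlongrightarrow> of_real \<kappa> * num z0 / deriv den z0) (at z0)"
  proof (intro tendsto_divide tendsto_mult tendsto_const dden)
    have "continuous_on UNIV num" by (intro holomorphic_on_imp_continuous_on holomorphic_num)
    then show "(num \<longlongrightarrow> num z0) (at z0)" by (simp add: continuous_on_def)
    show "((\<lambda>z. (den z - den z0) / (z - z0)) \<longlongrightarrow> deriv den z0) (at z0)"
      using den' by (simp add: has_field_derivative_iff)
  qed
  moreover have "\<forall>\<^sub>F z in at z0. of_real \<kappa> * num z / ((den z - den z0) / (z - z0)) = (z0 - z) * (N z / g z)"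
  proof -
    have "\<forall>\<^sub>F z in at z0. z \<in> U" using \<open>open U\<close> \<open>z0 \<in> U\<close> by (rule eventually_at_in_open')
    then show ?thesis
    proof eventually_elim
      case (elim z)
      \<comment> \<open>Where \<open>den\<close> vanishes, division by zero makes both sides
        0.\<close>
      then show ?case using V0[OF elim] kz
        by (cases "den z = 0") (simp_all add: gU NU den0 field_simps)
    qed
  qed
  ultimately show "((\<lambda>z. (z0 - z) * (N z / g z)) \<longlongrightarrow> of_real \<kappa> * num z0 / deriv den z0) (at z0)"
    by (rule Lim_transform_eventually)
qed

end

end

lemma qtrig_phase_ge_1:
  assumes "1 \<le> q" "phase_function (entire_qexp q) \<Theta> a"
  shows "qtrig_phase (entire_qexp q) \<Theta> a q (\<lambda>v. if q < 1 then 1 / (entire_qexp q (\<i> * v) * entire_qexp q (- (\<i> * v))) else 1)"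
proof -
  interpret phase_function "entire_qexp q" \<Theta> a by fact
  have s1: "(\<lambda>n. (\<i> * z) ^ n * (1 / of_real (qfact q n))) sums entire_qexp q (\<i> * z)"
    and s2: "(\<lambda>n. (- (\<i> * z)) ^ n * (1 / of_real (qfact q n))) sums entire_qexp q (- (\<i> * z))" for z
    using entire_qexp_sums[OF assms(1), of "\<i> * z"] entire_qexp_sums[OF assms(1), of "- (\<i> * z)"] by simp_all
  show ?thesis
  proof
    show "qcos q v = (if q < 1 then 1 / (entire_qexp q (\<i> * v) * entire_qexp q (- (\<i> * v))) else 1) * cosE v" for v
      using sums_even_odd(1)[OF s1 s2, THEN sums_unique, of v] assms by (simp add: qcos_def cosE_def)
    show "qsin q v = (if q < 1 then 1 / (entire_qexp q (\<i> * v) * entire_qexp q (- (\<i> * v))) else 1) * sinE v" for v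
      using sums_even_odd(2)[OF s1 s2, THEN sums_unique, of v] assms by (simp add: qsin_def sinE_def)
  qed simp
qed

lemma qtrig_phase_less_1:
  assumes "0 < q" "q < 1" "phase_function (entire_qexp (1 / q)) \<Theta> a"
  shows "qtrig_phase (entire_qexp (1 / q)) \<Theta> a q
     (\<lambda>v. if q < 1 then 1 / (entire_qexp (1 / q) (\<i> * v) * entire_qexp (1 / q) (- (\<i> * v))) else 1)"
proof -
  interpret phase_function "entire_qexp (1 / q)" \<Theta> a by fact
  interpret qexp_base q using assms by unfold_locales
  show ?thesis
  proof
    fix v assume nz: "E (\<i> * v) \<noteq> 0" "E (- (\<i> * v)) \<noteq> 0"
    have 1: "qexp q (\<i> * v) = 1 / E (- (\<i> * v))" using qexp_eq_inverse[of "\<i> * v"] nz by simp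
    have 2: "qexp q (- (\<i> * v)) = 1 / E (\<i> * v)" using qexp_eq_inverse[of "- (\<i> * v)"] nz by simp
    show "qcos q v = (if q < 1 then 1 / (E (\<i> * v) * E (- (\<i> * v))) else 1) * cosE v"
      using assms nz by (simp add: qcos_def 1 2 cosE_def field_simps)
    show "qsin q v = (if q < 1 then 1 / (E (\<i> * v) * E (- (\<i> * v))) else 1) * sinE v"
      using assms nz by (simp add: qsin_def 1 2 sinE_def field_simps)
  qed simp
qed

lemma phase_function_entire_qexp:
  assumes "1 \<le> Q"
  obtains \<Theta> a where "phase_function (entire_qexp Q) \<Theta> a"
proof (cases "Q = 1")
  case False
  then interpret qexp_base "1 / Q" using assms by unfold_locales auto
  show ?thesis using that[of \<Theta> "1 - 1 / Q"] phase_function by simp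
next
  case True
  have "phase_function (entire_qexp Q) (\<lambda>x. x) 1"
    unfolding True by (rule phase_function_exp)
  then show ?thesis by (rule that)
qed

section \<open>Generating functions\<close>

text \<open>The product is a power series \<open>d\<close> with \<open>d (q * z) = d z\<close>, hence constant.\<close>

lemma qfact_convolution_inverse:
  assumes "0 < q" "q < 1"
  shows "Abs_fps (\<lambda>n. w ^ n / of_real (qfact q n) :: complex) *
         Abs_fps (\<lambda>n. (- w) ^ n / of_real (qfact (1 / q) n)) = 1"
proof -
  define a where "a n = 1 / qfact q n" for n
  define b where "b n = (-1) ^ n / qfact (1 / q) n" for n
  have q: "0 < 1 / q" using assms by simp
  have a: "(1 - q ^ Suc n) * a (Suc n) = (1 - q) * a n" for n
  proof -
    have "qnum q (Suc n) \<noteq> 0" using qnum_Suc_ge_1[of q n] assms by linarith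
    moreover have "1 - q ^ Suc n = (1 - q) * qnum q (Suc n)" using qnum_eq[of q "Suc n"] assms by (simp add: field_simps)
    ultimately show ?thesis using qfact_pos[of q n] assms by (simp add: a_def qfact_Suc)
  qed
  have b: "(1 - q ^ Suc n) * b (Suc n) = - ((1 - q) * q ^ n * b n)" for n
  proof -
    have nz: "qnum (1 / q) (Suc n) \<noteq> 0" using qnum_Suc_ge_1[OF q, of n] by linarith
    have "1 - q ^ Suc n = (1 - q) * q ^ n * qnum (1 / q) (Suc n)"
      using assms by (simp add: qnum_eq power_divide field_simps)
    then show ?thesis using qfact_pos[OF q, of n] nz by (simp add: b_def qfact_Suc)
  qed
  have conv: "(\<Sum>k\<le>Suc n. a k * b (Suc n - k)) = 0" for n
  proof -
    \<comment> \<open>The factor splits as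
      \<open>q ^ (n + 1 - k) * (1 - q ^ k) + (1 - q ^ (n + 1 - k))\<close>; by the recursions for
      \<open>a\<close> and \<open>b\<close> the two resulting sums are opposite.\<close>
    have "(1 - q ^ Suc n) * (\<Sum>k\<le>Suc n. a k * b (Suc n - k)) =
      (\<Sum>k\<le>Suc n. q ^ (Suc n - k) * ((1 - q ^ k) * a k) * b (Suc n - k)) +
      (\<Sum>k\<le>Suc n. a k * ((1 - q ^ (Suc n - k)) * b (Suc n - k)))"
      unfolding sum_distrib_left sum.distrib[symmetric]
    proof (rule sum.cong[OF refl])
      fix k assume "k \<in> {..Suc n}"
      then have "q ^ Suc n = q ^ (Suc n - k) * q ^ k" by (simp flip: power_add)
      then show "(1 - q ^ Suc n) * (a k * b (Suc n - k)) =
        q ^ (Suc n - k) * ((1 - q ^ k) * a k) * b (Suc n - k) + a k * ((1 - q ^ (Suc n - k)) * b (Suc n - k))"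
        by (simp only:) (simp add: algebra_simps)
    qed
    also have "(\<Sum>k\<le>Suc n. q ^ (Suc n - k) * ((1 - q ^ k) * a k) * b (Suc n - k)) =
        (\<Sum>k\<le>n. q ^ (n - k) * ((1 - q) * a k) * b (n - k))"
      by (subst sum.atMost_Suc_shift) (simp only: a diff_Suc_Suc power_0 diff_self mult_zero_left mult_zero_right add_0_left)
    also have "(\<Sum>k\<le>Suc n. a k * ((1 - q ^ (Suc n - k)) * b (Suc n - k))) =
        (\<Sum>k\<le>n. a k * ((1 - q ^ Suc (n - k)) * b (Suc (n - k))))"
      by (simp add: Suc_diff_le)
    also have "\<dots> = (\<Sum>k\<le>n. - (q ^ (n - k) * ((1 - q) * a k) * b (n - k)))"
      unfolding b by (simp add: algebra_simps)
    finally have "(1 - q ^ Suc n) * (\<Sum>k\<le>Suc n. a k * b (Suc n - k)) = 0"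
      by (simp add: sum_negf)
    moreover have "q ^ Suc n < 1" using assms by (intro power_Suc_less_one) auto
    ultimately show ?thesis by auto
  qed
  show ?thesis
  proof (rule fps_ext)
    fix n
    have "(\<Sum>k\<le>n. w ^ k / of_real (qfact q k) * ((- w) ^ (n - k) / of_real (qfact (1 / q) (n - k)))) =
        w ^ n * of_real (\<Sum>k\<le>n. a k * b (n - k))"
      unfolding of_real_sum sum_distrib_left
    proof (rule sum.cong[OF refl])
      fix k assume "k \<in> {..n}"
      then have "w ^ n = w ^ k * w ^ (n - k)" by (simp flip: power_add)
      then show "w ^ k / of_real (qfact q k) * ((- w) ^ (n - k) / of_real (qfact (1 / q) (n - k))) =
          w ^ n * of_real (a k * b (n - k))"
        by (simp add: a_def b_def power_minus[of w])
    qed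
    then have nth: "fps_nth (Abs_fps (\<lambda>n. w ^ n / of_real (qfact q n) :: complex) *
         Abs_fps (\<lambda>n. (- w) ^ n / of_real (qfact (1 / q) n))) n = w ^ n * of_real (\<Sum>k\<le>n. a k * b (n - k))"
      by (simp only: fps_mult_nth atLeast0AtMost fps_nth_Abs_fps)
    show "fps_nth (Abs_fps (\<lambda>n. w ^ n / of_real (qfact q n) :: complex) *
         Abs_fps (\<lambda>n. (- w) ^ n / of_real (qfact (1 / q) n))) n = fps_nth 1 n"
      unfolding nth
    proof (cases n)
      case (Suc m)
      show "w ^ n * of_real (\<Sum>k\<le>n. a k * b (n - k)) = fps_nth 1 n"
        unfolding Suc conv by simp
    qed (simp add: a_def b_def)
  qed
qed

lemma fps_qexp_combination:
  fixes w w' c c' :: complex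
  assumes "1 \<le> Q"
  defines "F \<equiv> fps_const c * Abs_fps (\<lambda>n. w ^ n / of_real (qfact Q n)) +
                fps_const c' * Abs_fps (\<lambda>n. w' ^ n / of_real (qfact Q n))"
  shows "fps_conv_radius F = \<infinity>" and "eval_fps F z = c * entire_qexp Q (w * z) + c' * entire_qexp Q (w' * z)"
proof -
  note rad = fps_conv_radius_qexp[OF assms(1)]
  have "(\<lambda>n. c * ((w * z) ^ n / of_real (qfact Q n)) + c' * ((w' * z) ^ n / of_real (qfact Q n))) sums
      (c * entire_qexp Q (w * z) + c' * entire_qexp Q (w' * z))" for z
    by (intro sums_add sums_mult entire_qexp_sums assms)
  moreover have "fps_nth F n * z ^ n = c * ((w * z) ^ n / of_real (qfact Q n)) + c' * ((w' * z) ^ n / of_real (qfact Q n))" for n z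
    by (simp add: F_def power_mult_distrib algebra_simps)
  ultimately have sums: "(\<lambda>n. fps_nth F n * z ^ n) sums (c * entire_qexp Q (w * z) + c' * entire_qexp Q (w' * z))" for z
    by (simp only:)
  then show "eval_fps F z = c * entire_qexp Q (w * z) + c' * entire_qexp Q (w' * z)"
    by (simp add: eval_fps_def sums_iff)
  show "fps_conv_radius F = \<infinity>"
    unfolding fps_conv_radius_def using sums by (intro conv_radius_inftyI'') (auto dest: sums_summable)
qed

text \<open>The q-exponential attached to the phase has base \<open>1 / q\<close> for
  \<open>q < 1\<close> and \<open>q\<close> otherwise, hence is entire in both cases.\<close>

locale laplace_asymptotics = laplace_persistence q \<xi> + qtrig_phase "entire_qexp (if q < 1 then 1 / q else q)" \<Theta> a q W
  for q \<xi> :: real and \<Theta> :: "real \<Rightarrow> real" and a :: real and W :: "complex \<Rightarrow> complex"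
begin

definition s :: real where "s = qarctan q \<kappa>"

definition z0 :: real where "z0 = s / \<rho>"

definition c0 :: complex where
  "c0 = of_real \<kappa> * num \<kappa> \<rho> (of_real z0) / deriv (den \<kappa> \<rho>) (of_real z0)"

abbreviation "Q \<equiv> (if q < 1 then 1 / q else q)"

lemma Q_ge_1: "1 \<le> Q"
  using q_pos by simp

lemma phase_s: "\<Theta> s = arctan \<kappa>" and s_pos: "0 < s"
proof -
  show *: "\<Theta> s = arctan \<kappa>" using phase_qarctan[of \<kappa>] kappa_pos by (simp add: s_def)
  then show "0 < s" using kappa_pos phase_less_iff[of 0 s] by simp
qed

lemma z0_pos: "0 < z0" and rho_z0: "\<rho> * z0 = s"
  using s_pos rho_pos by (simp_all add: z0_def)

lemmas den_facts = den_root_simple[OF kappa_pos rho_pos phase_s, folded z0_def]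
  den_root[OF kappa_pos rho_pos phase_s, folded z0_def]
  den_root_unique[OF kappa_pos rho_pos phase_s, folded z0_def]

lemma num_z0: "num \<kappa> \<rho> (of_real z0) = (1 + of_real (\<kappa>\<^sup>2)) * cosE (of_real s)"
  using num_root[OF kappa_pos rho_pos phase_s] by (simp add: z0_def)

lemma num_z0_nonzero: "num \<kappa> \<rho> (of_real z0) \<noteq> 0"
proof -
  have "(1 + of_real (\<kappa>\<^sup>2) :: complex) = of_real (1 + \<kappa>\<^sup>2)" by simp
  moreover have "1 + \<kappa>\<^sup>2 > 0" by (simp add: add_pos_nonneg)
  ultimately have "(1 + of_real (\<kappa>\<^sup>2) :: complex) \<noteq> 0" by (metis of_real_eq_0_iff less_irrefl)
  then show ?thesis using cosE_root_nonzero[OF kappa_pos rho_pos phase_s] by (simp add: num_z0)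
qed

lemma c0_nonzero: "c0 \<noteq> 0"
  using num_z0_nonzero kappa_pos den_facts(1) by (simp add: c0_def)

definition K :: "complex fps" where "K = fps_const (\<i> * of_real \<kappa>)"

definition P :: "complex fps" where "P = Abs_fps (\<lambda>n. of_real (branch_pos n 0))"

definition B :: "complex fps" where "B = Abs_fps (\<lambda>n. of_real (\<beta> n))"

lemma Psi_at_0: "Psi n 0 = (1 + \<i> * of_real \<kappa>) * of_real (branch_pos n 0)"
  by (subst Psi_eq) (simp add: branch_at_0 algebra_simps)

text \<open>\<open>Psi_at_0\<close> and its complex conjugate as identities of generating functions.
  They are linear in \<open>B\<close> and \<open>P\<close>, so either unknown can be
  eliminated.\<close>

lemma fps_eqs:
  "Abs_fps (\<lambda>n. (\<i> * of_real \<rho>) ^ n / of_real (qfact q n)) * (B + K) = (1 + K) * P"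
  "Abs_fps (\<lambda>n. (- (\<i> * of_real \<rho>)) ^ n / of_real (qfact q n)) * (B - K) = (1 - K) * P"
proof -
  have eta: "fps_nth (B + K) n = \<eta> n" "fps_nth (B - K) n = cnj (\<eta> n)" for n
    by (simp_all add: B_def K_def \<eta>_def)
  have K1: "1 + K = fps_const (1 + \<i> * of_real \<kappa>)" "1 - K = fps_const (1 - \<i> * of_real \<kappa>)"
    by (simp_all add: K_def fps_eq_iff)
  have sum: "(\<Sum>k\<le>n. psi k * \<eta> (n - k)) = (1 + \<i> * of_real \<kappa>) * of_real (branch_pos n 0)" for n
    using Psi_at_0[of n] by (simp add: Psi_def)
  show "Abs_fps (\<lambda>n. (\<i> * of_real \<rho>) ^ n / of_real (qfact q n)) * (B + K) = (1 + K) * P"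
  proof (rule fps_ext)
    fix n
    have "fps_nth (Abs_fps psi * (B + K)) n = (\<Sum>k\<le>n. psi k * \<eta> (n - k))"
      by (simp only: fps_mult_nth atLeast0AtMost eta fps_nth_Abs_fps)
    also have "\<dots> = fps_nth ((1 + K) * P) n"
      unfolding sum K1 by (simp only: P_def fps_mult_left_const_nth fps_nth_Abs_fps)
    finally show "fps_nth (Abs_fps (\<lambda>n. (\<i> * of_real \<rho>) ^ n / of_real (qfact q n)) * (B + K)) n = fps_nth ((1 + K) * P) n"
      by (simp only: psi_def[abs_def])
  qed
  have cnj_psi: "(\<lambda>k. cnj (psi k)) = (\<lambda>k. (- (\<i> * of_real \<rho>)) ^ k / of_real (qfact q k))"
    by (simp add: psi_def fun_eq_iff)
  have cnj_sum: "(\<Sum>k\<le>n. cnj (psi k) * cnj (\<eta> (n - k))) = (1 - \<i> * of_real \<kappa>) * of_real (branch_pos n 0)" for n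
    using arg_cong[OF sum[of n], of cnj] by simp
  show "Abs_fps (\<lambda>n. (- (\<i> * of_real \<rho>)) ^ n / of_real (qfact q n)) * (B - K) = (1 - K) * P"
  proof (rule fps_ext)
    fix n
    have "fps_nth (Abs_fps (\<lambda>k. cnj (psi k)) * (B - K)) n = (\<Sum>k\<le>n. cnj (psi k) * cnj (\<eta> (n - k)))"
      by (simp only: fps_mult_nth atLeast0AtMost eta fps_nth_Abs_fps)
    also have "\<dots> = fps_nth ((1 - K) * P) n"
      unfolding cnj_sum K1 by (simp only: P_def fps_mult_left_const_nth fps_nth_Abs_fps)
    finally show "fps_nth (Abs_fps (\<lambda>n. (- (\<i> * of_real \<rho>)) ^ n / of_real (qfact q n)) * (B - K)) n = fps_nth ((1 - K) * P) n"
      by (simp only: cnj_psi)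
  qed
qed

definition Dfps :: "complex fps" where
  "Dfps = fps_const (1 - \<i> * of_real \<kappa>) * Abs_fps (\<lambda>n. (\<i> * of_real \<rho>) ^ n / of_real (qfact Q n)) +
     fps_const (- (1 + \<i> * of_real \<kappa>)) * Abs_fps (\<lambda>n. (- (\<i> * of_real \<rho>)) ^ n / of_real (qfact Q n))"

lemma Dfps: "fps_conv_radius Dfps = \<infinity>" "eval_fps Dfps = (\<lambda>z. 2 * \<i> * den \<kappa> \<rho> z)"
proof -
  show "fps_conv_radius Dfps = \<infinity>" unfolding Dfps_def by (rule fps_qexp_combination(1)[OF Q_ge_1])
  show "eval_fps Dfps = (\<lambda>z. 2 * \<i> * den \<kappa> \<rho> z)"
  proof
    fix z
    define x y where "x = entire_qexp Q (\<i> * of_real \<rho> * z)" and "y = entire_qexp Q (- (\<i> * of_real \<rho>) * z)"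
    have "eval_fps Dfps z = (1 - \<i> * of_real \<kappa>) * x + (- (1 + \<i> * of_real \<kappa>)) * y"
      unfolding Dfps_def x_def y_def by (rule fps_qexp_combination(2)[OF Q_ge_1])
    moreover have "sinE (of_real \<rho> * z) = (x - y) / (2 * \<i>)" "cosE (of_real \<rho> * z) = (x + y) / 2"
      by (simp_all add: sinE_def cosE_def x_def y_def mult.assoc)
    ultimately show "eval_fps Dfps z = 2 * \<i> * den \<kappa> \<rho> z"
      by (simp only: den_def[OF kappa_pos rho_pos phase_s]) (simp add: field_simps)
  qed
qed

lemma Dfps_asymptotics:
  assumes "fps_conv_radius f = \<infinity>" "F * Dfps = f"
  shows "(\<lambda>n. fps_nth F n * of_real z0 ^ Suc n) \<longlonglongrightarrow>
    - eval_fps f (of_real z0) / (2 * \<i> * deriv (den \<kappa> \<rho>) (of_real z0))"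
proof -
  have "den \<kappa> \<rho> field_differentiable at (of_real z0)"
    using holomorphic_den[OF kappa_pos rho_pos phase_s, of UNIV]
    by (simp add: holomorphic_on_def)
  then have "deriv (eval_fps Dfps) (of_real z0) = 2 * \<i> * deriv (den \<kappa> \<rho>) (of_real z0)"
    unfolding Dfps(2) by (rule deriv_cmult)
  moreover have "(\<lambda>n. fps_nth F n * of_real z0 ^ Suc n) \<longlonglongrightarrow>
      - eval_fps f (of_real z0) / deriv (eval_fps Dfps) (of_real z0)"
    by (rule fps_quotient_coeff_asymptotics[OF assms(1) Dfps(1) assms(2)])
      (use den_facts z0_pos calculation in \<open>auto simp: Dfps(2)\<close>)
  ultimately show ?thesis by simp
qed

text \<open>Eliminating \<open>P\<close> gives \<open>B * Dfps = f\<close>, where both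
  \<open>Dfps\<close> and \<open>f\<close> are entire for \<open>q \<ge> 1\<close> and
  \<open>f\<close> takes the value \<open>- 2 * \<i> * \<kappa> * num\<close> at
  \<open>z0\<close>.\<close>

lemma beta_tendsto:
  assumes "1 \<le> q"
  shows "(\<lambda>n. of_real (\<beta> n) * of_real z0 ^ Suc n) \<longlonglongrightarrow> c0"
proof -
  define X Y where "X = Abs_fps (\<lambda>n. (\<i> * of_real \<rho>) ^ n / of_real (qfact q n) :: complex)"
    and "Y = Abs_fps (\<lambda>n. (- (\<i> * of_real \<rho>)) ^ n / of_real (qfact q n) :: complex)"
  have Qq: "Q = q" using assms by simp
  have D: "Dfps = (1 - K) * X - (1 + K) * Y"
  proof -
    have "fps_const (1 - \<i> * of_real \<kappa>) = 1 - K" "fps_const (- (1 + \<i> * of_real \<kappa>)) = - (1 + K)"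
      by (simp_all add: K_def fps_eq_iff)
    then show ?thesis unfolding Dfps_def Qq X_def[symmetric] Y_def[symmetric] by (simp only: mult_minus_left diff_conv_add_uminus)
  qed
  define f where "f = fps_const (- (\<i> * of_real \<kappa>) * (1 - \<i> * of_real \<kappa>)) * X +
      fps_const (- (\<i> * of_real \<kappa>) * (1 + \<i> * of_real \<kappa>)) * Y"
  have f: "f = - K * ((1 - K) * X + (1 + K) * Y)"
  proof -
    have e: "fps_const (- (\<i> * of_real \<kappa>) * (1 - \<i> * of_real \<kappa>)) = - K * (1 - K)"
      "fps_const (- (\<i> * of_real \<kappa>) * (1 + \<i> * of_real \<kappa>)) = - K * (1 + K)"
      by (simp_all add: K_def flip: fps_const_1_eq_1)
    show ?thesis unfolding f_def e by (simp add: algebra_simps)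
  qed
  have eq: "X * (B + K) = (1 + K) * P" "Y * (B - K) = (1 - K) * P"
    unfolding X_def Y_def by (rule fps_eqs)+
  have "(1 - K) * (X * (B + K)) = (1 + K) * (Y * (B - K))"
    unfolding eq by (simp only: mult_ac)
  then have "B * Dfps = f" unfolding D f by (simp add: algebra_simps)
  moreover have "fps_conv_radius f = \<infinity>" unfolding f_def X_def Y_def by (rule fps_qexp_combination(1)[OF assms])
  ultimately have lim: "(\<lambda>n. fps_nth B n * of_real z0 ^ Suc n) \<longlonglongrightarrow>
      - eval_fps f (of_real z0) / (2 * \<i> * deriv (den \<kappa> \<rho>) (of_real z0))"
    by (intro Dfps_asymptotics)
  have "eval_fps f (of_real z0) = - 2 * \<i> * of_real \<kappa> * num \<kappa> \<rho> (of_real z0)"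
  proof -
    define x y where "x = entire_qexp Q (\<i> * of_real \<rho> * of_real z0)" and "y = entire_qexp Q (- (\<i> * of_real \<rho>) * of_real z0)"
    have "eval_fps f (of_real z0) = (- (\<i> * of_real \<kappa>) * (1 - \<i> * of_real \<kappa>)) * x + (- (\<i> * of_real \<kappa>) * (1 + \<i> * of_real \<kappa>)) * y"
      unfolding f_def X_def Y_def x_def y_def Qq by (rule fps_qexp_combination(2)[OF assms])
    moreover have "sinE (of_real \<rho> * of_real z0) = (x - y) / (2 * \<i>)" "cosE (of_real \<rho> * of_real z0) = (x + y) / 2"
      by (simp_all add: sinE_def cosE_def x_def y_def mult.assoc)
    ultimately show ?thesis
      by (simp only: num_def[OF kappa_pos rho_pos phase_s]) (simp add: field_simps)
  qed
  then have "- eval_fps f (of_real z0) / (2 * \<i> * deriv (den \<kappa> \<rho>) (of_real z0)) = c0"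
    by (simp add: c0_def)
  then show ?thesis using lim by (simp add: B_def)
qed

text \<open>For \<open>q < 1\<close> the series \<open>X\<close> and \<open>Y\<close> have finite
  radius, but their inverses \<open>Y'\<close> and \<open>X'\<close> are entire. Solving for
  \<open>B + K\<close> and \<open>B - K\<close> and subtracting eliminates \<open>B\<close> and
  leaves \<open>P * Dfps = - (2 * K)\<close>, with constant right-hand side.\<close>

lemma P_tendsto:
  assumes "q < 1"
  shows "(\<lambda>n. of_real (branch_pos n 0) * of_real z0 ^ Suc n) \<longlonglongrightarrow> of_real \<kappa> / deriv (den \<kappa> \<rho>) (of_real z0)"
proof -
  define X Y where "X = Abs_fps (\<lambda>n. (\<i> * of_real \<rho>) ^ n / of_real (qfact q n) :: complex)"
    and "Y = Abs_fps (\<lambda>n. (- (\<i> * of_real \<rho>)) ^ n / of_real (qfact q n) :: complex)"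
  define X' Y' where "X' = Abs_fps (\<lambda>n. (\<i> * of_real \<rho>) ^ n / of_real (qfact (1 / q) n) :: complex)"
    and "Y' = Abs_fps (\<lambda>n. (- (\<i> * of_real \<rho>)) ^ n / of_real (qfact (1 / q) n) :: complex)"
  have Qq: "Q = 1 / q" using assms by simp
  have D: "Dfps = (1 - K) * X' - (1 + K) * Y'"
  proof -
    have "fps_const (1 - \<i> * of_real \<kappa>) = 1 - K" "fps_const (- (1 + \<i> * of_real \<kappa>)) = - (1 + K)"
      by (simp_all add: K_def fps_eq_iff)
    then show ?thesis unfolding Dfps_def Qq X'_def[symmetric] Y'_def[symmetric] by (simp only: mult_minus_left diff_conv_add_uminus)
  qed
  have inv: "X * Y' = 1" "Y * X' = 1"
    using qfact_convolution_inverse[OF q_pos assms, of "\<i> * of_real \<rho>"]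
      qfact_convolution_inverse[OF q_pos assms, of "- (\<i> * of_real \<rho>)"]
    by (simp_all add: X_def Y_def X'_def Y'_def)
  have eq: "X * (B + K) = (1 + K) * P" "Y * (B - K) = (1 - K) * P"
    unfolding X_def Y_def by (rule fps_eqs)+
  have BK1: "B + K = (1 + K) * P * Y'"
    using arg_cong[OF eq(1), of "\<lambda>x. x * Y'"] inv(1) by (metis mult.commute mult.left_commute mult_1_right)
  have BK2: "B - K = (1 - K) * P * X'"
    using arg_cong[OF eq(2), of "\<lambda>x. x * X'"] inv(2) by (metis mult.commute mult.left_commute mult_1_right)
  have "P * Dfps = (1 - K) * P * X' - (1 + K) * P * Y'"
    unfolding D by (simp only: right_diff_distrib mult_ac)
  also have "\<dots> = - (2 * K)" unfolding BK1[symmetric] BK2[symmetric] by simp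
  also have "\<dots> = fps_const (- 2 * \<i> * of_real \<kappa>)" by (simp add: K_def fps_eq_iff numeral_fps_const)
  finally have "(\<lambda>n. fps_nth P n * of_real z0 ^ Suc n) \<longlonglongrightarrow>
      - eval_fps (fps_const (- 2 * \<i> * of_real \<kappa>)) (of_real z0) / (2 * \<i> * deriv (den \<kappa> \<rho>) (of_real z0))"
    by (intro Dfps_asymptotics) auto
  then show ?thesis by (simp add: P_def)
qed

lemma real_sequence_limit:
  fixes f :: "nat \<Rightarrow> real"
  assumes "(\<lambda>n. of_real (f n) * of_real z0 ^ Suc n) \<longlonglongrightarrow> (l :: complex)"
  shows "Im l = 0"
proof -
  have "(\<lambda>n. Im (of_real (f n) * of_real z0 ^ Suc n)) \<longlonglongrightarrow> Im l" by (rule tendsto_Im[OF assms])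
  moreover have "Im (of_real (f n) * of_real z0 ^ Suc n) = 0" for n
    by (simp flip: of_real_mult of_real_power power_Suc)
  ultimately show ?thesis by (simp only: LIMSEQ_const_iff)
qed

text \<open>For \<open>q \<ge> 1\<close> the constant is a limit of real numbers; for
  \<open>q < 1\<close> it is such a limit times the real value of \<open>num\<close> at
  \<open>z0\<close>.\<close>

lemma c0_real: "Im c0 = 0"
proof (cases "q < 1")
  case True
  have "Im (of_real \<kappa> / deriv (den \<kappa> \<rho>) (of_real z0)) = 0" by (rule real_sequence_limit[OF P_tendsto[OF True]])
  moreover have "Im (num \<kappa> \<rho> (of_real z0)) = 0" by (simp add: num_z0 cosE_real)
  moreover have "c0 = of_real \<kappa> / deriv (den \<kappa> \<rho>) (of_real z0) * num \<kappa> \<rho> (of_real z0)"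
    by (simp add: c0_def)
  ultimately show ?thesis by (simp only: times_complex.sel)
next
  case False
  then show ?thesis using real_sequence_limit[OF beta_tendsto] by simp
qed

section \<open>Limits for fixed initial value\<close>

definition V_ge_1 :: "real \<Rightarrow> complex" where
  "V_ge_1 y = (\<Sum>k. (\<i> * of_real s) ^ k / of_real (qfact q k) * of_real (exp (- (q * qnum q k * y))))"

lemma V_ge_1_sums:
  assumes "1 \<le> q" "0 \<le> y"
  shows "(\<lambda>k. (\<i> * of_real s) ^ k / of_real (qfact q k) * of_real (exp (- (q * qnum q k * y)))) sums V_ge_1 y"
  unfolding V_ge_1_def
proof (rule summable_sums, rule summable_norm_cancel, rule summable_comparison_test')
  show "summable (\<lambda>k. norm ((\<i> * of_real s) ^ k / of_real (qfact q k) :: complex))"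
    by (rule summable_norm_entire_qexp[OF assms(1)])
  fix k
  have "0 \<le> q * qnum q k * y" using q_pos qnum_nonneg[OF q_pos, of k] assms by simp
  then have "norm (of_real (exp (- (q * qnum q k * y))) :: complex) \<le> 1" by simp
  then show "norm (norm ((\<i> * of_real s) ^ k / of_real (qfact q k) * of_real (exp (- (q * qnum q k * y)))))
      \<le> norm ((\<i> * of_real s) ^ k / of_real (qfact q k) :: complex)"
    unfolding norm_mult norm_of_real real_norm_def abs_mult abs_norm_cancel
    by (simp add: mult_left_le)
qed

text \<open>\<open>Psi n y * z0 ^ Suc n\<close> is the convolution of the summable sequence
  \<open>T\<close> with the bounded sequence \<open>e\<close>, which tends to
  \<open>c0\<close>.\<close>

lemma Psi_tendsto_ge_1:
  assumes q: "1 \<le> q" and y: "0 \<le> y"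
  shows "(\<lambda>n. Psi n y * of_real z0 ^ Suc n) \<longlonglongrightarrow> c0 * V_ge_1 y"
proof -
  define T where "T k = (\<i> * of_real s) ^ k / of_real (qfact q k) * of_real (exp (- (q * qnum q k * y)))" for k
  define e where "e m = \<eta> m * of_real z0 ^ Suc m" for m
  have "e \<longlonglongrightarrow> c0"
  proof (rule Lim_transform_eventually[OF beta_tendsto[OF q]])
    \<comment> \<open>\<open>\<eta>\<close> and \<open>\<beta>\<close> differ at index 0
      only.\<close>
    show "\<forall>\<^sub>F n in sequentially. of_real (\<beta> n) * of_real z0 ^ Suc n = e n"
      using eventually_gt_at_top[of 0] by eventually_elim (simp add: e_def \<eta>_def)
  qed
  then obtain C where C: "\<And>m. norm (e m) \<le> C"
    using convergent_imp_Bseq[of e] by (auto simp: convergent_def Bseq_def)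
  define A where "A k n = (if k \<le> n then T k * e (n - k) else 0)" for k n
  have "((\<lambda>n. suminf (\<lambda>k. A k n)) \<longlongrightarrow> suminf (\<lambda>k. T k * c0)) sequentially"
  proof (rule conjunct2[OF conjunct2[OF tannerys_theorem]])
    fix k
    have "(\<lambda>n. A k (n + k)) \<longlonglongrightarrow> T k * c0"
      unfolding A_def by (simp add: tendsto_mult_left \<open>e \<longlonglongrightarrow> c0\<close>)
    then show "A k \<longlonglongrightarrow> T k * c0" by (rule LIMSEQ_offset)
  next
    have "norm (A k n) \<le> norm ((\<i> * of_real s) ^ k / of_real (qfact q k) :: complex) * C" for k n
    proof (cases "k \<le> n")
      case True
      have "0 \<le> q * qnum q k * y" using q_pos qnum_nonneg[OF q_pos, of k] y by simp
      then have "norm (of_real (exp (- (q * qnum q k * y))) :: complex) \<le> 1" by simp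
      then have "norm (T k) \<le> norm ((\<i> * of_real s) ^ k / of_real (qfact q k) :: complex)"
        unfolding T_def norm_mult[of _ "of_real (exp _)"] by (rule mult_left_le) simp
      then show ?thesis unfolding A_def using True C[of "n - k"]
        by (simp only: if_True norm_mult mult_mono norm_ge_zero)
    next
      case False
      have "0 \<le> C" using C[of 0] norm_ge_zero order_trans by blast
      then show ?thesis using False by (simp add: A_def)
    qed
    then show "\<forall>\<^sub>F (k, n) in at_top \<times>\<^sub>F sequentially. norm (A k n) \<le> norm ((\<i> * of_real s) ^ k / of_real (qfact q k) :: complex) * C"
      by (intro always_eventually) auto
    show "summable (\<lambda>k. norm ((\<i> * of_real s) ^ k / of_real (qfact q k) :: complex) * C)"
      by (intro summable_mult2 summable_norm_entire_qexp q)
  qed simp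
  moreover have "suminf (\<lambda>k. T k * c0) = c0 * V_ge_1 y"
    using sums_mult2[OF V_ge_1_sums[OF q y], of c0] unfolding T_def by (simp add: sums_iff mult.commute)
  moreover have "suminf (\<lambda>k. A k n) = Psi n y * of_real z0 ^ Suc n" for n
  proof -
    have "suminf (\<lambda>k. A k n) = (\<Sum>k\<le>n. A k n)"
      by (rule suminf_finite) (auto simp: A_def)
    also have "\<dots> = Psi n y * of_real z0 ^ Suc n"
      unfolding Psi_def sum_distrib_right
    proof (rule sum.cong[OF refl])
      fix k assume "k \<in> {..n}"
      then have k: "k \<le> n" by simp
      then have "of_real z0 ^ Suc n = (of_real z0 ^ k * of_real z0 ^ Suc (n - k) :: complex)"
        by (simp flip: power_add)
      moreover have "psi k * of_real z0 ^ k = (\<i> * of_real s) ^ k / of_real (qfact q k)"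
      proof -
        have "of_real s = (of_real \<rho> * of_real z0 :: complex)" by (simp flip: rho_z0)
        then show ?thesis by (simp add: psi_def power_mult_distrib)
      qed
      moreover have "A k n = (\<i> * of_real s) ^ k / of_real (qfact q k) * of_real (exp (- (q * qnum q k * y))) *
          (\<eta> (n - k) * of_real z0 ^ Suc (n - k))"
        using k by (simp add: A_def T_def e_def)
      ultimately show "A k n = psi k * of_real (exp (- (q * qnum q k * y))) * \<eta> (n - k) * of_real z0 ^ Suc n"
        by (metis mult.assoc mult.commute)
    qed
    finally show ?thesis .
  qed
  ultimately show ?thesis by simp
qed

text \<open>Half sum and half difference of \<open>V_ge_1 y\<close> and its conjugate are the even
  and odd parts of the series. The argument \<open>- s\<close> exchanges the two, hence the sign of
  the sine.\<close>

lemma qtrig2_ge_1: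
  assumes q: "1 \<le> q" and y: "0 \<le> y"
  shows "qcos2 q (of_real (- s)) (- y) = of_real (Re (V_ge_1 y))"
    and "qsin2 q (of_real (- s)) (- y) = - of_real (Im (V_ge_1 y))"
proof -
  define w where "w k = of_real (exp (- (q * qnum q k * y))) / (of_real (qfact q k) :: complex)" for k
  have V: "(\<lambda>k. (\<i> * of_real s) ^ k * w k) sums V_ge_1 y"
    using V_ge_1_sums[OF q y] by (simp add: w_def mult.commute)
  have "(\<lambda>k. cnj ((\<i> * of_real s) ^ k * w k)) sums cnj (V_ge_1 y)"
    using V by (simp only: sums_cnj)
  then have cnjV: "(\<lambda>k. (- (\<i> * of_real s)) ^ k * w k) sums cnj (V_ge_1 y)"
    by (simp add: w_def)
  have "(\<lambda>k. (\<i> * of_real (- s)) ^ k * w k) sums cnj (V_ge_1 y)"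
    "(\<lambda>k. (- (\<i> * of_real (- s))) ^ k * w k) sums V_ge_1 y"
    using V cnjV by simp_all
  note even_odd = sums_even_odd[OF this]
  have eqs: "(cnj (V_ge_1 y) + V_ge_1 y) / 2 = of_real (Re (V_ge_1 y))"
    "(cnj (V_ge_1 y) - V_ge_1 y) / (2 * \<i>) = - of_real (Im (V_ge_1 y))"
    by (simp_all add: complex_eq_iff Re_divide Im_divide)
  show "qcos2 q (of_real (- s)) (- y) = of_real (Re (V_ge_1 y))"
    "qsin2 q (of_real (- s)) (- y) = - of_real (Im (V_ge_1 y))"
  proof (atomize (full), cases "q = 1")
    case True
    \<comment> \<open>For \<open>q = 1\<close> the bracket is \<open>k\<close>, so
      \<open>exp (- (k * y))\<close> is absorbed into the power and an ordinary exponential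
      results.\<close>
    have "(\<lambda>k. (\<i> * of_real (s * exp (- y))) ^ k /\<^sub>R fact k) sums V_ge_1 y"
    proof -
      have "(\<i> * of_real s) ^ k * w k = (\<i> * of_real (s * exp (- y))) ^ k /\<^sub>R fact k" for k
        by (simp add: w_def True qfact_def qnum_def power_mult_distrib scaleR_conv_of_real field_simps
            exp_of_nat_mult[symmetric] flip: of_real_power)
      then show ?thesis using V by simp
    qed
    then have "V_ge_1 y = cis (s * exp (- y))"
      unfolding cis_conv_exp by (rule sums_unique2[OF _ exp_converges])
    then have "Re (V_ge_1 y) = cos (s * exp (- y))" "Im (V_ge_1 y) = sin (s * exp (- y))"
      by simp_all
    then show "qcos2 q (of_real (- s)) (- y) = of_real (Re (V_ge_1 y)) \<and>
        qsin2 q (of_real (- s)) (- y) = - of_real (Im (V_ge_1 y))"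
      by (simp add: qcos2_def qsin2_def True cos_of_real sin_of_real flip: of_real_mult of_real_minus)
  next
    case False
    have e: "q * ((1 - q ^ n) / (1 - q)) * - y = - (q * qnum q n * y)" for n
      using False by (simp add: qnum_eq)
    show "qcos2 q (of_real (- s)) (- y) = of_real (Re (V_ge_1 y)) \<and>
        qsin2 q (of_real (- s)) (- y) = - of_real (Im (V_ge_1 y))"
      using even_odd[unfolded eqs, THEN sums_unique] q False
      unfolding qcos2_def qsin2_def e by (simp add: w_def)
  qed
qed

text \<open>The coefficient of \<open>z ^ n\<close> in
  \<open>e_q(i \<rho> q^m z) (\<beta>(z) + i \<kappa>)\<close>. For \<open>q < 1\<close> these
  moments arise when the exponentials in \<open>Psi\<close> are expanded in powers of
  \<open>q ^ k\<close>.\<close>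

definition jackson :: "nat \<Rightarrow> nat \<Rightarrow> complex" where
  "jackson m n = (\<Sum>k\<le>n. psi k * of_real (q ^ m) ^ k * \<eta> (n - k))"

lemma jackson_0: "jackson 0 n = Psi n 0"
  by (simp add: jackson_def Psi_def)

lemma jackson_Suc_0: "jackson (Suc m) 0 = jackson m 0"
  by (simp add: jackson_def)

text \<open>Coefficient form of \<open>e_q(q x) = (1 - (1 - q) x) e_q(x)\<close> at
  \<open>x = i \<rho> q^m z\<close>.\<close>

lemma jackson_Suc_Suc:
  "jackson (Suc m) (Suc n) = jackson m (Suc n) - \<i> * of_real (\<rho> * (1 - q) * q ^ m) * jackson m n"
proof -
  have psi: "psi (Suc k) * of_real (q ^ m) ^ Suc k - psi (Suc k) * of_real (q ^ Suc m) ^ Suc k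
      = \<i> * of_real (\<rho> * (1 - q) * q ^ m) * (psi k * of_real (q ^ m) ^ k)" for k
  proof -
    have "1 - q ^ Suc k = (1 - q) * qnum q (Suc k)"
      by (cases "q = 1") (auto simp: qnum_eq)
    then have "(1 - of_real q ^ Suc k :: complex) = of_real (1 - q) * of_real (qnum q (Suc k))"
      by (metis of_real_1 of_real_diff of_real_mult of_real_power)
    then have one: "(1 - of_real q ^ Suc k) * psi (Suc k) = of_real (1 - q) * (\<i> * of_real \<rho> * psi k)"
      by (simp only: mult.assoc psi_Suc)
    have "psi (Suc k) * of_real (q ^ m) ^ Suc k - psi (Suc k) * of_real (q ^ Suc m) ^ Suc k
        = (1 - of_real q ^ Suc k) * psi (Suc k) * of_real (q ^ m) ^ Suc k"
      by (simp add: power_mult_distrib algebra_simps)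
    then show ?thesis unfolding one by (simp add: mult_ac)
  qed
  have "jackson m (Suc n) - jackson (Suc m) (Suc n) =
     (\<Sum>k\<le>Suc n. (psi k * of_real (q ^ m) ^ k - psi k * of_real (q ^ Suc m) ^ k) * \<eta> (Suc n - k))"
    by (simp only: jackson_def left_diff_distrib sum_subtractf)
  also have "\<dots> = \<i> * of_real (\<rho> * (1 - q) * q ^ m) * jackson m n"
    unfolding sum.atMost_Suc_shift psi diff_Suc_Suc by (simp add: jackson_def sum_distrib_left mult.assoc)
  finally show ?thesis by (simp add: algebra_simps)
qed

text \<open>As \<open>q [k]_q = r (1 - q ^ k)\<close>, multiplication by \<open>exp (r * y)\<close>
  turns each exponential in \<open>Psi\<close> into \<open>exp (r * y * q ^ k)\<close>, whose Taylor
  series is summed over \<open>k \<le> n\<close>.\<close>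

lemma Psi_sums_jackson:
  assumes "q < 1"
  defines "r \<equiv> q / (1 - q)"
  shows "(\<lambda>m. of_real ((r * y) ^ m / fact m) * jackson m n) sums (of_real (exp (r * y)) * Psi n y)"
proof -
  have ex: "(\<lambda>m. of_real ((r * y) ^ m / fact m) * of_real (q ^ m) ^ k) sums
      (of_real (exp (r * y) * exp (- (q * qnum q k * y))) :: complex)" for k
  proof -
    have "(\<lambda>m. (r * y * q ^ k) ^ m /\<^sub>R fact m) sums exp (r * y * q ^ k)" by (rule exp_converges)
    also have "(\<lambda>m. (r * y * q ^ k) ^ m /\<^sub>R fact m) = (\<lambda>m. (r * y) ^ m / fact m * (q ^ m) ^ k)"
      by (simp add: fun_eq_iff power_mult_distrib field_simps flip: power_mult)
    also have "r * y * q ^ k = r * y + - (q * qnum q k * y)"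
    proof -
      have "q * qnum q k = r * (1 - q ^ k)" using assms(1) by (simp add: qnum_eq r_def)
      then have *: "r * y + - (q * qnum q k * y) = r * y + - (r * (1 - q ^ k) * y)" by (simp only:)
      show ?thesis unfolding * by (simp add: algebra_simps)
    qed
    finally have "(\<lambda>m. of_real ((r * y) ^ m / fact m * (q ^ m) ^ k)) sums
        (of_real (exp (r * y + - (q * qnum q k * y))) :: complex)"
      by (simp only: sums_of_real_iff)
    then show ?thesis by (simp only: exp_add of_real_mult of_real_power)
  qed
  have "(\<lambda>m. \<Sum>k\<le>n. psi k * \<eta> (n - k) * (of_real ((r * y) ^ m / fact m) * of_real (q ^ m) ^ k)) sums
      (\<Sum>k\<le>n. psi k * \<eta> (n - k) * of_real (exp (r * y) * exp (- (q * qnum q k * y))))"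
    by (intro sums_sum sums_mult ex)
  moreover have "(\<Sum>k\<le>n. psi k * \<eta> (n - k) * (of_real ((r * y) ^ m / fact m) * of_real (q ^ m) ^ k)) =
      of_real ((r * y) ^ m / fact m) * jackson m n" for m
    unfolding jackson_def sum_distrib_left by (rule sum.cong) (simp_all only: mult_ac)
  moreover have "(\<Sum>k\<le>n. psi k * \<eta> (n - k) * of_real (exp (r * y) * exp (- (q * qnum q k * y)))) =
      of_real (exp (r * y)) * Psi n y"
    unfolding Psi_def sum_distrib_left of_real_mult by (rule sum.cong) (simp_all only: mult_ac)
  ultimately show ?thesis by simp
qed

definition jackson_lim :: "nat \<Rightarrow> complex" where
  "jackson_lim m = (\<Prod>j<m. 1 - \<i> * of_real (s * (1 - q) * q ^ j)) *
     ((1 + \<i> * of_real \<kappa>) * (of_real \<kappa> / deriv (den \<kappa> \<rho>) (of_real z0)))"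

lemma jackson_scaled:
  "jackson (Suc m) (Suc n) * of_real z0 ^ Suc (Suc n) =
     jackson m (Suc n) * of_real z0 ^ Suc (Suc n) -
     \<i> * of_real (s * (1 - q) * q ^ m) * (jackson m n * of_real z0 ^ Suc n)"
  unfolding jackson_Suc_Suc by (simp add: algebra_simps flip: rho_z0)

lemma jackson_tendsto:
  assumes "q < 1"
  shows "(\<lambda>n. jackson m n * of_real z0 ^ Suc n) \<longlonglongrightarrow> jackson_lim m"
proof (induction m)
  case 0
  have "(\<lambda>n. (1 + \<i> * of_real \<kappa>) * (of_real (branch_pos n 0) * of_real z0 ^ Suc n)) \<longlonglongrightarrow> jackson_lim 0"
    unfolding jackson_lim_def by (simp only: lessThan_0 prod.empty mult_1_left, intro tendsto_mult_left P_tendsto assms)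
  then show ?case by (simp only: jackson_0 Psi_at_0 mult.assoc)
next
  case (Suc m)
  have "(\<lambda>n. jackson (Suc m) (Suc n) * of_real z0 ^ Suc (Suc n)) \<longlonglongrightarrow>
      jackson_lim m - \<i> * of_real (s * (1 - q) * q ^ m) * jackson_lim m"
    unfolding jackson_scaled
    by (intro tendsto_diff tendsto_mult_left Suc LIMSEQ_Suc[OF Suc])
  also have "jackson_lim m - \<i> * of_real (s * (1 - q) * q ^ m) * jackson_lim m = jackson_lim (Suc m)"
  proof -
    have "jackson_lim (Suc m) = (1 - \<i> * of_real (s * (1 - q) * q ^ m)) * jackson_lim m"
      unfolding jackson_lim_def prod.lessThan_Suc by (simp only: mult_ac)
    then show ?thesis by (simp only: left_diff_distrib mult_1_left)
  qed
  finally show ?case by (rule LIMSEQ_imp_Suc)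
qed

text \<open>Each step of the recursion adds at most \<open>s\<close> times the previous bound, since
  \<open>(1 - q) * q ^ m \<le> 1\<close>. This growth, uniform in \<open>n\<close>, is beaten by the
  \<open>fact m\<close> in \<open>Psi_sums_jackson\<close>.\<close>

lemma jackson_bound:
  assumes "q < 1"
  obtains C where "\<And>m n. norm (jackson m n * of_real z0 ^ Suc n) \<le> C * (1 + s) ^ m"
proof -
  obtain C where C: "\<And>n. norm (jackson 0 n * of_real z0 ^ Suc n) \<le> C"
    using convergent_imp_Bseq[of "\<lambda>n. jackson 0 n * of_real z0 ^ Suc n"] jackson_tendsto[OF assms, of 0]
    by (auto simp: convergent_def Bseq_def)
  have "norm (jackson m n * of_real z0 ^ Suc n) \<le> C * (1 + s) ^ m" for m n
  proof (induction m arbitrary: n)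
    case (Suc m)
    have C0: "0 \<le> C" using C[of 0] norm_ge_zero order_trans by blast
    show ?case
    proof (cases n)
      case 0
      have "C * (1 + s) ^ m \<le> C * (1 + s) ^ Suc m"
        using C0 s_pos by (intro mult_left_mono power_increasing) auto
      then show ?thesis using Suc[of 0] by (simp only: 0 jackson_Suc_0)
    next
      case (Suc k)
      have "(1 - q) * q ^ m \<le> 1 * 1"
        using q_pos assms by (intro mult_mono power_le_one) auto
      then have le: "s * (1 - q) * q ^ m \<le> s" using s_pos mult_left_mono[of "(1 - q) * q ^ m" 1 s] by (simp add: mult.assoc)
      have ge: "0 \<le> s * (1 - q) * q ^ m" using s_pos q_pos assms by simp
      have "norm (jackson (Suc m) (Suc k) * of_real z0 ^ Suc (Suc k)) \<le>
          norm (jackson m (Suc k) * of_real z0 ^ Suc (Suc k)) +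
          norm (\<i> * of_real (s * (1 - q) * q ^ m) * (jackson m k * of_real z0 ^ Suc k))"
        unfolding jackson_scaled by (rule norm_triangle_ineq4)
      also have "norm (\<i> * of_real (s * (1 - q) * q ^ m) * (jackson m k * of_real z0 ^ Suc k)) =
          s * (1 - q) * q ^ m * norm (jackson m k * of_real z0 ^ Suc k)"
        using ge by (simp only: norm_mult norm_ii norm_of_real mult_1_left abs_of_nonneg)
      also have "norm (jackson m (Suc k) * of_real z0 ^ Suc (Suc k)) +
          s * (1 - q) * q ^ m * norm (jackson m k * of_real z0 ^ Suc k) \<le> C * (1 + s) ^ m + s * (C * (1 + s) ^ m)"
        using le ge s_pos by (intro add_mono mult_mono Suc.IH) auto
      finally show ?thesis by (simp add: Suc algebra_simps)
    qed
  qed (simp only: power_0 mult_1_right C)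
  then show ?thesis using that by blast
qed

lemma num_z0_eq: "(1 + \<i> * of_real \<kappa>) * entire_qexp Q (- (\<i> * of_real s)) = num \<kappa> \<rho> (of_real z0)"
proof -
  have "(1 + \<i> * of_real \<kappa>) * (w - \<i> * (of_real \<kappa> * w)) = (1 + of_real (\<kappa>\<^sup>2)) * w" for w
    by (simp add: algebra_simps power2_eq_square)
  then show ?thesis
    unfolding E_minus_eq num_z0 sinE_root[OF kappa_pos rho_pos phase_s] .
qed

text \<open>By \<open>E_prod\<close> the product in \<open>jackson_lim\<close> is a quotient of two
  values of the entire q-exponential. The numerator combines with \<open>1 + \<i> * \<kappa>\<close>
  to \<open>num\<close> at \<open>z0\<close>, hence to \<open>c0\<close>; the other value leaves
  \<open>e_q(i q^m s)\<close>.\<close>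

lemma jackson_lim_eq:
  assumes "q < 1"
  shows "jackson_lim m = c0 * (1 / entire_qexp Q (- (\<i> * of_real (q ^ m * s))))"
proof -
  interpret qexp_base q using q_pos assms by unfold_locales
  have Qq: "Q = 1 / q" using assms by simp
  define p where "p = (\<Prod>j<m. 1 - \<i> * of_real (s * (1 - q) * q ^ j))"
  define e where "e = entire_qexp Q (- (\<i> * of_real (q ^ m * s)))"
  have "entire_qexp Q (- (\<i> * of_real s)) = p * e"
    unfolding p_def e_def Qq by (subst E_prod[of _ m]) (simp add: mult_ac)
  moreover have "e \<noteq> 0" unfolding e_def by (rule nonzero')
  ultimately have "p = entire_qexp Q (- (\<i> * of_real s)) / e" by simp
  moreover have "jackson_lim m = p * ((1 + \<i> * of_real \<kappa>) * (of_real \<kappa> / deriv (den \<kappa> \<rho>) (of_real z0)))"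
    by (simp only: jackson_lim_def p_def)
  ultimately have "jackson_lim m = (1 + \<i> * of_real \<kappa>) * entire_qexp Q (- (\<i> * of_real s)) * (of_real \<kappa> / deriv (den \<kappa> \<rho>) (of_real z0)) * (1 / e)"
    by (simp only: times_divide_eq_left times_divide_eq_right mult_ac mult_1_left)
  also have "\<dots> = c0 * (1 / e)"
    unfolding num_z0_eq c0_def by (simp only: times_divide_eq_left times_divide_eq_right mult_ac)
  finally show ?thesis by (simp only: e_def)
qed

text \<open>Tannery's theorem for the expansion in moments, dominated by an exponential series. The
  limit is termwise the continuation formula defining \<open>qcos2\<close> and
  \<open>qsin2\<close>.\<close>

lemma Psi_tendsto_less_1:
  assumes q: "q < 1"
  obtains V where "(\<lambda>n. Psi n y * of_real z0 ^ Suc n) \<longlonglongrightarrow> c0 * V"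
    and "qcos2 q (of_real (- s)) (- y) = of_real (Re V)"
    and "qsin2 q (of_real (- s)) (- y) = - of_real (Im V)"
proof -
  define r where "r = q / (1 - q)"
  define T where "T m = 1 / entire_qexp Q (- (\<i> * of_real (q ^ m * s)))" for m
  define v where "v m = (r * y) ^ m / fact m" for m
  obtain C where C: "\<And>m n. norm (jackson m n * of_real z0 ^ Suc n) \<le> C * (1 + s) ^ m"
    using jackson_bound[OF q] by blast
  have tannery: "summable (\<lambda>m. norm (of_real (v m) * jackson_lim m)) \<and>
     ((\<lambda>n. \<Sum>m. of_real (v m) * (jackson m n * of_real z0 ^ Suc n)) \<longlongrightarrow> (\<Sum>m. of_real (v m) * jackson_lim m)) sequentially"
  proof (rule conjunct2[OF tannerys_theorem])
    show "(\<lambda>n. of_real (v m) * (jackson m n * of_real z0 ^ Suc n)) \<longlonglongrightarrow> of_real (v m) * jackson_lim m" for m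
      by (intro tendsto_mult_left jackson_tendsto q)
    have "norm (of_real (v m) * (jackson m n * of_real z0 ^ Suc n)) \<le> \<bar>v m\<bar> * (C * (1 + s) ^ m)" for m n
      unfolding norm_mult[of "of_real (v m)"] norm_of_real by (intro mult_left_mono C) simp
    then show "\<forall>\<^sub>F (m, n) in at_top \<times>\<^sub>F sequentially.
        norm (of_real (v m) * (jackson m n * of_real z0 ^ Suc n)) \<le> \<bar>v m\<bar> * (C * (1 + s) ^ m)"
      by (intro always_eventually) auto
    have "summable (\<lambda>m. C * ((\<bar>r * y\<bar> * (1 + s)) ^ m / fact m))"
      using summable_exp_generic[of "\<bar>r * y\<bar> * (1 + s)"]
      by (intro summable_mult) (simp add: field_simps)
    also have "(\<lambda>m. C * ((\<bar>r * y\<bar> * (1 + s)) ^ m / fact m)) = (\<lambda>m. \<bar>v m\<bar> * (C * (1 + s) ^ m))"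
      by (simp add: v_def power_mult_distrib power_abs abs_mult fun_eq_iff)
    finally show "summable (\<lambda>m. \<bar>v m\<bar> * (C * (1 + s) ^ m))" .
  qed simp
  define S where "S = (\<Sum>m. of_real (v m) * T m)"
  have lim_eq: "of_real (v m) * jackson_lim m = c0 * (of_real (v m) * T m)" for m
    unfolding jackson_lim_eq[OF q] T_def by (simp only: mult_ac)
  have "summable (\<lambda>m. of_real (v m) * jackson_lim m)" using tannery by (blast intro: summable_norm_cancel)
  \<comment> \<open>Dividing by the nonzero \<open>c0\<close> transfers summability.\<close>
  then have "summable (\<lambda>m. of_real (v m) * T m)" unfolding lim_eq using c0_nonzero by simp
  then have S: "(\<lambda>m. of_real (v m) * T m) sums S" unfolding S_def by (rule summable_sums)
  define V where "V = of_real (exp (- (r * y))) * S"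
  have "(\<lambda>n. of_real (exp (r * y)) * Psi n y * of_real z0 ^ Suc n) \<longlonglongrightarrow> c0 * S"
  proof -
    have "(\<Sum>m. of_real (v m) * jackson_lim m) = c0 * S"
      unfolding lim_eq using sums_mult[OF S, of c0] by (simp add: sums_iff)
    moreover have "(\<Sum>m. of_real (v m) * (jackson m n * of_real z0 ^ Suc n)) =
        of_real (exp (r * y)) * Psi n y * of_real z0 ^ Suc n" for n
      using sums_mult2[OF Psi_sums_jackson[OF q, of y n, folded r_def, folded v_def], of "of_real z0 ^ Suc n"]
      by (simp only: mult.assoc sums_iff)
    ultimately show ?thesis using tannery by simp
  qed
  from tendsto_mult_left[OF this, of "of_real (exp (- (r * y)))"]
  have "(\<lambda>n. Psi n y * of_real z0 ^ Suc n) \<longlonglongrightarrow> c0 * V"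
  proof -
    assume lim: "(\<lambda>n. of_real (exp (- (r * y))) * (of_real (exp (r * y)) * Psi n y * of_real z0 ^ Suc n)) \<longlonglongrightarrow>
        of_real (exp (- (r * y))) * (c0 * S)"
    have "of_real (exp (- (r * y))) * of_real (exp (r * y)) = (1 :: complex)"
      by (simp flip: of_real_mult exp_add)
    then have "of_real (exp (- (r * y))) * (of_real (exp (r * y)) * Psi n y * of_real z0 ^ Suc n) = Psi n y * of_real z0 ^ Suc n" for n
      by (simp only: mult.assoc[symmetric] mult_1_left)
    then show ?thesis using lim by (simp only: V_def mult_ac)
  qed
  moreover have "qcos2 q (of_real (- s)) (- y) = of_real (Re V)" "qsin2 q (of_real (- s)) (- y) = - of_real (Im V)"
  proof -
    have arg: "of_real (q ^ m) * of_real (- s) = (of_real (- (q ^ m * s)) :: complex)" for m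
      by simp
    have "(\<lambda>m. Re (of_real (v m) * T m)) sums Re S" "(\<lambda>m. Im (of_real (v m) * T m)) sums Im S"
      using S by (rule sums_Re, rule sums_Im)
    then have "(\<lambda>m. of_real (v m * Re (T m))) sums (of_real (Re S) :: complex)"
      "(\<lambda>m. of_real (v m * Im (T m))) sums (of_real (Im S) :: complex)"
      by (simp_all only: sums_of_real_iff Re_complex_of_real Im_complex_of_real times_complex.sel mult_zero_left diff_zero add_0_right)
    then have 1: "(\<Sum>m. of_real (v m) * of_real (Re (T m))) = (of_real (Re S) :: complex)"
      and 2: "(\<Sum>m. of_real (v m) * (- of_real (Im (T m)))) = (- of_real (Im S) :: complex)"
      using sums_minus[of "\<lambda>m. of_real (v m * Im (T m))" "of_real (Im S) :: complex"]
      by (simp_all add: sums_iff)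
    \<comment> \<open>The second argument \<open>- y\<close> turns the alternating coefficients of
      the definition into \<open>v m\<close>.\<close>
    have 3: "q * - y / (1 - q) = - (r * y)" by (simp add: r_def)
    note T = T_def[symmetric, unfolded if_P[OF q]]
    have ReV: "of_real (Re V) = of_real (exp (- (r * y))) * (of_real (Re S) :: complex)"
      and ImV: "- of_real (Im V) = of_real (exp (- (r * y))) * (- of_real (Im S) :: complex)"
      by (simp_all add: V_def)
    show "qcos2 q (of_real (- s)) (- y) = of_real (Re V)"
      unfolding qcos2_def if_P[OF q] arg qtrig_real_less_1[OF q] T 3 minus_minus v_def[symmetric] 1 ReV ..
    show "qsin2 q (of_real (- s)) (- y) = - of_real (Im V)"
      unfolding qsin2_def if_P[OF q] arg qtrig_real_less_1[OF q] T 3 minus_minus v_def[symmetric] 2 ImV ..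
  qed
  ultimately show ?thesis by (rule that)
qed

lemma Psi_tendsto:
  assumes "0 \<le> y"
  obtains V where "(\<lambda>n. Psi n y * of_real z0 ^ Suc n) \<longlonglongrightarrow> c0 * V"
    and "qcos2 q (of_real (- s)) (- y) = of_real (Re V)"
    and "qsin2 q (of_real (- s)) (- y) = - of_real (Im V)"
proof (cases "q < 1")
  case True
  then show ?thesis using Psi_tendsto_less_1 that by blast
next
  case False
  then have "1 \<le> q" by simp
  then show ?thesis using Psi_tendsto_ge_1 qtrig2_ge_1 assms that by blast
qed

section \<open>Limits of both branches and their nonvanishing\<close>

lemma branch_tendsto:
  assumes "0 \<le> y"
  shows "(\<lambda>n. of_real (branch_pos n y) * of_real z0 ^ Suc n) \<longlonglongrightarrow> c0 * qcos2 q (of_real (- s)) (- y)"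
    and "(\<lambda>n. of_real (branch_neg n y) * of_real z0 ^ Suc n) \<longlonglongrightarrow> c0 * (- of_real (1 / \<kappa>) * qsin2 q (of_real (- s)) (- y))"
proof -
  obtain V where V: "(\<lambda>n. Psi n y * of_real z0 ^ Suc n) \<longlonglongrightarrow> c0 * V"
    and qc: "qcos2 q (of_real (- s)) (- y) = of_real (Re V)"
    and qs: "qsin2 q (of_real (- s)) (- y) = - of_real (Im V)"
    using Psi_tendsto[OF assms] by blast
  have c0: "c0 = of_real (Re c0)" using c0_real by (simp add: complex_eq_iff)
  have PsiRe: "Re (Psi n y * of_real z0 ^ Suc n) = branch_pos n y * z0 ^ Suc n"
    and PsiIm: "Im (Psi n y * of_real z0 ^ Suc n) = \<kappa> * branch_neg n y * z0 ^ Suc n" for n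
    using kappa_pos
    by (simp_all only: of_real_power[symmetric] times_complex.sel Re_complex_of_real Im_complex_of_real
        branch_pos_def branch_neg_def) simp_all
  have VRe: "Re (c0 * V) = Re c0 * Re V" and VIm: "Im (c0 * V) = Re c0 * Im V"
    using c0_real by simp_all
  have "(\<lambda>n. of_real (branch_pos n y * z0 ^ Suc n)) \<longlonglongrightarrow> (of_real (Re c0 * Re V) :: complex)"
    using tendsto_Re[OF V] unfolding PsiRe VRe by (rule tendsto_of_real)
  then show "(\<lambda>n. of_real (branch_pos n y) * of_real z0 ^ Suc n) \<longlonglongrightarrow> c0 * qcos2 q (of_real (- s)) (- y)"
    unfolding qc by (subst c0) (simp only: of_real_mult of_real_power)
  have "(\<lambda>n. 1 / \<kappa> * (\<kappa> * branch_neg n y * z0 ^ Suc n)) \<longlonglongrightarrow> 1 / \<kappa> * (Re c0 * Im V)"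
    using tendsto_Im[OF V] unfolding PsiIm VIm by (rule tendsto_mult_left)
  then have "(\<lambda>n. of_real (1 / \<kappa> * (\<kappa> * branch_neg n y * z0 ^ Suc n))) \<longlonglongrightarrow> (of_real (1 / \<kappa> * (Re c0 * Im V)) :: complex)"
    by (rule tendsto_of_real)
  moreover have "1 / \<kappa> * (\<kappa> * branch_neg n y * z0 ^ Suc n) = branch_neg n y * z0 ^ Suc n" for n
    using kappa_pos by simp
  ultimately have "(\<lambda>n. of_real (branch_neg n y * z0 ^ Suc n)) \<longlonglongrightarrow> (of_real (1 / \<kappa> * (Re c0 * Im V)) :: complex)"
    by (simp only:)
  then show "(\<lambda>n. of_real (branch_neg n y) * of_real z0 ^ Suc n) \<longlonglongrightarrow> c0 * (- of_real (1 / \<kappa>) * qsin2 q (of_real (- s)) (- y))"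
    unfolding qs by (subst c0) (simp only: of_real_mult of_real_power mult_minus_left mult_minus_right minus_minus mult_ac)
qed

text \<open>The limit is nonnegative as the branches are. It is nonzero by \<open>P_tendsto\<close>
  for \<open>q < 1\<close>; otherwise because \<open>Psi n 0\<close> is
  \<open>1 + \<i> * \<kappa>\<close> times the branch and the q-exponential has no zero on the
  imaginary axis.\<close>

lemma branch_0_limit_pos:
  obtains l where "(\<lambda>n. branch_pos n 0 * z0 ^ Suc n) \<longlonglongrightarrow> l" "0 < l"
proof -
  obtain L where L: "(\<lambda>n. of_real (branch_pos n 0) * of_real z0 ^ Suc n) \<longlonglongrightarrow> L" "L \<noteq> (0 :: complex)"
  proof (cases "q < 1")
    case True
    have "of_real \<kappa> / deriv (den \<kappa> \<rho>) (of_real z0) \<noteq> 0" using kappa_pos den_facts(1) by (simp del: if_split)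
    then show ?thesis using that P_tendsto[OF True] by blast
  next
    case False
    then have q: "1 \<le> q" "Q = q" by simp_all
    have nz: "1 + \<i> * of_real \<kappa> \<noteq> 0" by (simp add: complex_eq_iff)
    have "V_ge_1 0 = entire_qexp Q (\<i> * of_real s)"
      unfolding V_ge_1_def entire_qexp_def q(2) by simp
    then have "V_ge_1 0 \<noteq> 0" using nonzero by (simp only:) blast
    then have "c0 * V_ge_1 0 / (1 + \<i> * of_real \<kappa>) \<noteq> 0" using c0_nonzero nz by simp
    moreover have "(\<lambda>n. Psi n 0 * of_real z0 ^ Suc n / (1 + \<i> * of_real \<kappa>)) \<longlonglongrightarrow> c0 * V_ge_1 0 / (1 + \<i> * of_real \<kappa>)"
      by (intro tendsto_divide Psi_tendsto_ge_1 q tendsto_const nz) simp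
    moreover have "Psi n 0 * of_real z0 ^ Suc n / (1 + \<i> * of_real \<kappa>) = of_real (branch_pos n 0) * of_real z0 ^ Suc n" for n
      unfolding Psi_at_0 using nz by simp
    ultimately show ?thesis using that by simp
  qed
  have "Im L = 0" by (rule real_sequence_limit[OF L(1)])
  then have "Re L \<noteq> 0" using L(2) by (simp add: complex_eq_iff)
  moreover have lim: "(\<lambda>n. branch_pos n 0 * z0 ^ Suc n) \<longlonglongrightarrow> Re L"
  proof -
    have "Re (of_real (branch_pos n 0) * of_real z0 ^ Suc n) = branch_pos n 0 * z0 ^ Suc n" for n
      by (simp only: of_real_power[symmetric] of_real_mult[symmetric] Re_complex_of_real)
    then show ?thesis using tendsto_Re[OF L(1)] by (simp only:)
  qed
  moreover have "0 \<le> Re L"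
    by (rule LIMSEQ_le_const[OF lim]) (use branch_nonneg[of 0] z0_pos in auto)
  ultimately show ?thesis using that by simp
qed

definition profile :: "real \<Rightarrow> complex" where
  "profile y = (if y > 0 then qcos2 q (of_real (- s)) (- y) else - of_real (1 / \<kappa>) * qsin2 q (of_real (- s)) y)"

lemma survival_tendsto:
  "(\<lambda>n. of_real (survival n y) * of_real z0 ^ Suc n) \<longlonglongrightarrow> c0 * profile y"
proof (cases "y > 0")
  case True
  show ?thesis
    unfolding survival_def profile_def if_P[OF True] using True by (intro branch_tendsto(1)) simp
next
  case False
  then show ?thesis
    unfolding survival_def profile_def if_not_P[OF False]
    using branch_tendsto(2)[of "- y"] by (simp only: minus_minus neg_0_le_iff_le not_less)
qed

text \<open>Comparison with the positive limit at 0: on \<open>y > 0\<close> by monotonicity of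
  \<open>branch_pos\<close>, on \<open>y \<le> 0\<close> by
  \<open>branch_neg_lower_bound\<close>.\<close>

lemma profile_nonzero: "c0 * profile y \<noteq> 0"
proof -
  obtain l where l: "(\<lambda>n. branch_pos n 0 * z0 ^ Suc n) \<longlonglongrightarrow> l" "0 < l"
    using branch_0_limit_pos by blast
  have "(\<lambda>n. Re (of_real (survival n y) * of_real z0 ^ Suc n)) \<longlonglongrightarrow> Re (c0 * profile y)"
    by (rule tendsto_Re[OF survival_tendsto])
  then have lim: "(\<lambda>n. survival n y * z0 ^ Suc n) \<longlonglongrightarrow> Re (c0 * profile y)"
    by (simp only: of_real_power[symmetric] of_real_mult[symmetric] Re_complex_of_real)
  have "0 < Re (c0 * profile y)"
  proof (cases "y > 0")
    case True
    have "l \<le> Re (c0 * profile y)"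
    proof (rule LIMSEQ_le[OF l(1) lim], intro exI allI impI)
      fix n
      show "branch_pos n 0 * z0 ^ Suc n \<le> survival n y * z0 ^ Suc n"
        using branch_pos_mono[of y n] True z0_pos by (intro mult_right_mono) (auto simp: survival_def)
    qed
    then show ?thesis using l by simp
  next
    case False
    \<comment> \<open>The factor \<open>z0\<close> compensates for the shift from \<open>n\<close>
      to \<open>Suc n\<close>; since \<open>- y\<close> enters the lower bound, its exponential is
      \<open>exp (q * y)\<close>.\<close>
    define b where "b = (1 - \<xi>) * exp (q * y) * z0"
    have b: "0 < b" using xi_less_1 z0_pos by (simp add: b_def)
    have "b * l \<le> Re (c0 * profile y)"
    proof (rule LIMSEQ_le[OF tendsto_mult_left[OF l(1)] LIMSEQ_Suc[OF lim]], intro exI allI impI)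
      fix n
      have "(1 - \<xi>) * exp (q * y) * branch_pos n 0 \<le> survival (Suc n) y"
        using branch_neg_lower_bound[of "- y" n] False by (simp add: survival_def)
      then have "(1 - \<xi>) * exp (q * y) * branch_pos n 0 * z0 ^ Suc (Suc n) \<le> survival (Suc n) y * z0 ^ Suc (Suc n)"
        using z0_pos by (intro mult_right_mono) auto
      then show "b * (branch_pos n 0 * z0 ^ Suc n) \<le> survival (Suc n) y * z0 ^ Suc (Suc n)"
        by (simp add: b_def mult_ac)
    qed
    moreover have "0 < b * l" using b l by simp
    ultimately show ?thesis by linarith
  qed
  then show ?thesis by auto
qed

end

theorem lemma4p12:
  fixes M :: "'a measure" and X :: "nat \<Rightarrow> 'a \<Rightarrow> real"
    and \<theta> \<xi> y \<gamma> u lam z0 :: real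
    and g N :: "complex \<Rightarrow> complex" and c :: complex and h :: "real \<Rightarrow> complex"
  assumes "\<theta> < 0" and "0 < \<xi>" and "\<xi> < 1"
    and "iid_phi M X \<xi>"
    and "\<gamma> = (1 - \<xi>) / \<xi>"
    and "u = - sqrt (\<xi> * (1 - \<xi>))"
    and "lam = - u / qarctan (- \<theta>) (1 / sqrt \<gamma>)"
    and "z0 = 1 / lam"
    and "g = (\<lambda>z. qcos (- \<theta>) (of_real u * z) + of_real (sqrt \<gamma>) * qsin (- \<theta>) (of_real u * z))"
    and "N = (\<lambda>z. qcos (- \<theta>) (of_real u * z) - of_real (1 / sqrt \<gamma>) * qsin (- \<theta>) (of_real u * z))"
    and "h = (\<lambda>y. if y > 0 then qcos2 (- \<theta>) (of_real (u * z0)) (- y)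
                  else - of_real (sqrt \<gamma>) * qsin2 (- \<theta>) (of_real (u * z0)) y)"
    and "c = Lim (at (of_real z0)) (\<lambda>z. (of_real z0 - z) * (N z / g z))"
  shows "((\<lambda>z. (of_real z0 - z) * (N z / g z)) \<longlongrightarrow> c) (at (of_real z0))
       \<and> g field_differentiable (at (of_real z0))
       \<and> c = - N (of_real z0) / deriv g (of_real z0)
       \<and> (\<lambda>n. of_real (persist M X \<theta> y n) / (c * h y * of_real lam ^ (n + 1))) \<longlonglongrightarrow> 1"
proof -
  define q where "q = - \<theta>"
  have q: "0 < q" using assms(1) by (simp add: q_def)
  let ?Q = "if q < 1 then 1 / q else q"
  have Q1: "1 \<le> ?Q" using q by simp
  obtain \<Theta> a where phase: "phase_function (entire_qexp ?Q) \<Theta> a"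
    using phase_function_entire_qexp[OF Q1] by blast
  have qtrig: "qtrig_phase (entire_qexp ?Q) \<Theta> a q
      (\<lambda>v. if q < 1 then 1 / (entire_qexp ?Q (\<i> * v) * entire_qexp ?Q (- (\<i> * v))) else 1)"
  proof (cases "q < 1")
    case True
    show ?thesis
      using qtrig_phase_less_1[OF q True] phase unfolding if_P[OF True] by blast
  next
    case False
    show ?thesis
      using qtrig_phase_ge_1[of q] phase False unfolding if_not_P[OF False] by simp
  qed
  interpret laplace_asymptotics q \<xi> \<Theta> a
      "\<lambda>v. if q < 1 then 1 / (entire_qexp ?Q (\<i> * v) * entire_qexp ?Q (- (\<i> * v))) else 1"
    using q assms(2,3) by (intro laplace_asymptotics.intro laplace_persistence.intro qtrig)
  have sqrt_gamma: "sqrt \<gamma> = 1 / \<kappa>" "1 / sqrt \<gamma> = \<kappa>"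
    using assms(2,3) by (simp_all add: assms(5) \<kappa>_def real_sqrt_divide)
  have u: "u = - \<rho>" by (simp add: assms(6) \<rho>_def)
  \<comment> \<open>The \<open>z0\<close> of the statement is the locale constant of that name,
    since \<open>lam = \<rho> / s\<close>.\<close>
  have z0: "z0 = s / \<rho>" "z0 = laplace_asymptotics.z0 q \<xi>"
    unfolding assms(8,7) u sqrt_gamma q_def[symmetric] z0_def s_def by simp_all
  have lam: "lam = 1 / z0" unfolding assms(8) by simp
  have z0_pos': "0 < z0" using z0_pos by (simp add: z0(2))
  have uz0: "u * z0 = - s" using rho_z0 by (simp add: u z0(2))
  have g: "g = (\<lambda>z. qcos q (of_real (- \<rho>) * z) + of_real (1 / \<kappa>) * qsin q (of_real (- \<rho>) * z))"
    unfolding assms(9) u sqrt_gamma q_def ..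
  have N: "N = (\<lambda>z. qcos q (of_real (- \<rho>) * z) - of_real \<kappa> * qsin q (of_real (- \<rho>) * z))"
    unfolding assms(10) u sqrt_gamma q_def by simp
  have h: "h y = profile y"
    unfolding assms(11) uz0 sqrt_gamma profile_def q_def[symmetric] ..
  note residue = quotient_residue[OF kappa_pos rho_pos phase_s g N, folded z0(1)]
  have c0: "of_real \<kappa> * num \<kappa> \<rho> (of_real z0) / deriv (den \<kappa> \<rho>) (of_real z0) = c0"
    by (simp only: c0_def z0(2))
  note residue = residue[unfolded c0]
  have c: "c = c0" unfolding assms(12) by (rule tendsto_Lim[OF _ residue(1)]) simp
  have "(\<lambda>n. of_real (survival n y) * of_real z0 ^ Suc n / (c0 * profile y)) \<longlonglongrightarrow> c0 * profile y / (c0 * profile y)"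
    unfolding z0(2) by (intro tendsto_divide survival_tendsto tendsto_const profile_nonzero)
  then have lim: "(\<lambda>n. of_real (survival n y) * of_real z0 ^ Suc n / (c0 * profile y)) \<longlonglongrightarrow> 1"
    using profile_nonzero by simp
  \<comment> \<open>Dividing by \<open>lam ^ (n + 1)\<close> is multiplying by
    \<open>z0 ^ Suc n\<close>, as \<open>lam = 1 / z0\<close>.\<close>
  moreover have "of_real (survival n y) * of_real z0 ^ Suc n / (c0 * profile y) =
      of_real (persist M X \<theta> y n) / (c * h y * of_real lam ^ (n + 1))" for n
    using z0_pos' persist_eq_survival[OF assms(4), of y n]
    by (simp add: c h lam q_def power_divide del: power_Suc)
  ultimately show ?thesis
    using residue c by simp
qed

end
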